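(* For every constant $\epsilon_1>0$ there is $\epsilon_2>0$ (depending only on $\epsilon_1$) such that the following holds: if there is an algorithm that counts the solutions of any exact set cover instance $(\mathcal{F},U)$ with $|U|=n$ and $|\mathcal{F}|\in n^{O(\log n)}$ in $O^*(2^{(1-\epsilon_1)n})$ time, then there is an algorithm that computes the permanent of any $n\times n$ matrix with entries in $\{0,1\}$ in $O^*(2^{(1-\epsilon_2)n})$ time.
   Context: An exact set cover instance consists of a finite ground set $U$ and a family $\mathcal{F}$ of subsets of $U$; a solution is a subfamily $\mathcal{F}'\subseteq\mathcal{F}$ whose members are pairwise disjoint and whose union is $U$. Counting the solutions means computing the number of such subfamilies. The permanent of $A\in R^{n\times n}$ is $\operatorname{per}(A)=\sum_{\sigma\in S_n}\prod_{i=1}^n A_{i,\sigma(i)}$, with $S_n$ the symmetric group. The notation $O^*(f(n))$ suppresses factors polylogarithmic in $f(n)$. *)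

theory Defs
  imports
    Complex_Main
    "HOL-Library.Log_Nat"
    "HOL-Library.Disjoint_Sets"
    "HOL-Library.Landau_Symbols"
    "HOL-Combinatorics.Permutations"
    "Jordan_Normal_Form.Matrix"
begin

section \<open>Exact set cover and the permanent\<close>

definition exact_cover_instance :: "'a set \<Rightarrow> 'a set set \<Rightarrow> bool" where
  "exact_cover_instance U F \<longleftrightarrow> finite U \<and> F \<subseteq> Pow U"

text \<open>
  The empty set may belong to \<open>F\<close> and to a solution, so \<^const>\<open>partition_on\<close> is not the
  right notion here.
\<close>

definition exact_covers :: "'a set \<Rightarrow> 'a set set \<Rightarrow> 'a set set set" where
  "exact_covers U F = {F'. F' \<subseteq> F \<and> disjoint F' \<and> \<Union>F' = U}"

definition permanent :: "'a::comm_ring_1 mat \<Rightarrow> 'a" where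
  "permanent A = (\<Sum>\<sigma> | \<sigma> permutes {0..<dim_row A}. \<Prod>i = 0..<dim_row A. A $$ (i, \<sigma> i))"


section \<open>Random access machines with logarithmic cost\<close>

text \<open>
  A machine has registers (a program mentions only finitely many of them) and one infinite memory
  that is accessed indirectly. Both hold arbitrary natural numbers. Programs are written with
  structured control flow, which changes running times by a constant factor only compared with
  jumps. Every step is charged the number of bits of the numbers it reads, memory addresses
  included (the logarithmic cost criterion), so the unbounded size of the stored numbers cannot
  be used to perform more than a constant number of bit operations per unit of time, up to
  polylogarithmic factors.
\<close>

type_synonym reg = nat

type_synonym state = "(reg \<Rightarrow> nat) \<times> (nat \<Rightarrow> nat)"

datatype arith = Add | Sub | Mul | Div | Mod

text \<open>Subtraction is truncated at \<open>0\<close>; \<open>a div 0 = 0\<close> and \<open>a mod 0 = a\<close>.\<close>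

fun arith_val :: "arith \<Rightarrow> nat \<Rightarrow> nat \<Rightarrow> nat" where
  "arith_val Add a b = a + b"
| "arith_val Sub a b = a - b"
| "arith_val Mul a b = a * b"
| "arith_val Div a b = a div b"
| "arith_val Mod a b = a mod b"

datatype com =
    Skip
  | Const reg nat
  | Arith reg arith reg reg  \<comment> \<open>\<open>Arith r f p q\<close>: register \<open>r\<close> receives \<open>f\<close> of registers \<open>p\<close> and \<open>q\<close>\<close>
  | Load reg reg             \<comment> \<open>\<open>Load r p\<close>: \<open>r\<close> receives the memory cell whose address is in \<open>p\<close>\<close>
  | Store reg reg            \<comment> \<open>\<open>Store p r\<close>: the memory cell whose address is in \<open>p\<close> receives \<open>r\<close>\<close>
  | Seq com com
  | If reg com com           \<comment> \<open>tests whether the register is nonzero\<close>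
  | While reg com

definition bits :: "nat \<Rightarrow> nat" where
  "bits n = max 1 (floorlog 2 n)"

text \<open>\<open>exec c s t s'\<close>: program \<open>c\<close>, started in \<open>s\<close>, halts in \<open>s'\<close> after time \<open>t\<close>.\<close>

inductive exec :: "com \<Rightarrow> state \<Rightarrow> nat \<Rightarrow> state \<Rightarrow> bool" where
  Skip: "exec Skip s 1 s"
| Const: "exec (Const r k) (R, M) (bits k) (R(r := k), M)"
| Arith: "exec (Arith r f p q) (R, M) (bits (R p) + bits (R q)) (R(r := arith_val f (R p) (R q)), M)"
| Load: "exec (Load r p) (R, M) (bits (R p) + bits (M (R p))) (R(r := M (R p)), M)"
| Store: "exec (Store p r) (R, M) (bits (R p) + bits (R r)) (R, M(R p := R r))"
| Seq: "exec c s t s' \<Longrightarrow> exec d s' t' s'' \<Longrightarrow> exec (Seq c d) s (t + t') s''"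
| IfTrue: "fst s r \<noteq> 0 \<Longrightarrow> exec c s t s' \<Longrightarrow> exec (If r c d) s (bits (fst s r) + t) s'"
| IfFalse: "fst s r = 0 \<Longrightarrow> exec d s t s' \<Longrightarrow> exec (If r c d) s (bits (fst s r) + t) s'"
| WhileFalse: "fst s r = 0 \<Longrightarrow> exec (While r c) s (bits (fst s r)) s"
| WhileTrue: "fst s r \<noteq> 0 \<Longrightarrow> exec c s t s' \<Longrightarrow> exec (While r c) s' t' s'' \<Longrightarrow>
    exec (While r c) s (bits (fst s r) + t + t') s''"

inductive_cases SkipE: "exec Skip s t s'"
inductive_cases ConstE: "exec (Const r k) s t s'"
inductive_cases ArithE: "exec (Arith r f p q) s t s'"
inductive_cases LoadE: "exec (Load r p) s t s'"
inductive_cases StoreE: "exec (Store p r) s t s'"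
inductive_cases SeqE: "exec (Seq c d) s t s'"
inductive_cases IfE: "exec (If r c d) s t s'"
inductive_cases WhileE: "exec (While r c) s t s'"

lemma exec_deterministic:
  "exec c s t s' \<Longrightarrow> exec c s u s'' \<Longrightarrow> u = t \<and> s'' = s'"
proof (induction arbitrary: u s'' rule: exec.induct)
  case (Skip s)
  then show ?case by (rule SkipE) simp
next
  case (Const r k R M)
  then show ?case by (rule ConstE) simp
next
  case (Arith r f p q R M)
  then show ?case by (rule ArithE) simp
next
  case (Load r p R M)
  then show ?case by (rule LoadE) simp
next
  case (Store p r R M)
  then show ?case by (rule StoreE) simp
next
  case (Seq c s t s' d t' s1)
  from Seq.prems obtain v s2 v' where "u = v + v'" "exec c s v s2" "exec d s2 v' s''"
    by (rule SeqE)
  then show ?case using Seq.IH by blast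
next
  case (IfTrue s r c t s' d)
  from IfTrue.prems IfTrue.hyps obtain v where "u = bits (fst s r) + v" "exec c s v s''"
    by (cases rule: IfE) auto
  then show ?case using IfTrue.IH by blast
next
  case (IfFalse s r d t s' c)
  from IfFalse.prems IfFalse.hyps obtain v where "u = bits (fst s r) + v" "exec d s v s''"
    by (cases rule: IfE) auto
  then show ?case using IfFalse.IH by blast
next
  case (WhileFalse s r c)
  from WhileFalse.prems WhileFalse.hyps show ?case
    by (cases rule: WhileE) auto
next
  case (WhileTrue s r c t s' t' s1)
  from WhileTrue.prems WhileTrue.hyps(1) obtain v s2 v' where
    "u = bits (fst s r) + v + v'" "exec c s v s2" "exec (While r c) s2 v' s''"
    by (cases rule: WhileE) auto
  then show ?case using WhileTrue.IH by blast
qed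

text \<open>The result of a computation is the content of register \<open>0\<close>.\<close>

definition outputs_within :: "com \<Rightarrow> state \<Rightarrow> nat \<Rightarrow> real \<Rightarrow> bool" where
  "outputs_within c s v T \<longleftrightarrow> (\<exists>t s'. exec c s t s' \<and> fst s' 0 = v \<and> real t \<le> T)"


section \<open>Counting problems on these machines\<close>

text \<open>
  The ground set and the family are presented by duplicate-free enumerations \<open>us\<close> and \<open>Fs\<close>:
  registers \<open>0\<close> and \<open>1\<close> hold their lengths and the memory holds the incidence matrix, row by row.
  A 0/1-matrix is likewise presented by its dimension and its entries, row by row. All other
  registers and memory cells are initially \<open>0\<close>.
\<close>

definition cover_input :: "'a list \<Rightarrow> 'a set list \<Rightarrow> state" where
  "cover_input us Fs =
     ((\<lambda>_. 0)(0 := length us, 1 := length Fs),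
      \<lambda>a. if a < length Fs * length us \<and> us ! (a mod length us) \<in> Fs ! (a div length us)
          then 1 else 0)"

definition matrix_input :: "int mat \<Rightarrow> state" where
  "matrix_input A =
     ((\<lambda>_. 0)(0 := dim_row A),
      \<lambda>a. if a < dim_row A * dim_col A then nat (A $$ (a div dim_col A, a mod dim_col A)) else 0)"

text \<open>Nothing is required of the program on instances with \<open>|F| > |U| powr g |U|\<close>.\<close>

definition counts_exact_covers :: "com \<Rightarrow> (nat \<Rightarrow> real) \<Rightarrow> (nat \<Rightarrow> real) \<Rightarrow> bool" where
  "counts_exact_covers c g T \<longleftrightarrow>
     (\<forall>(U :: nat set) F us Fs.
        exact_cover_instance U F \<and> real (card F) \<le> real (card U) powr g (card U) \<and>
        distinct us \<and> set us = U \<and> distinct Fs \<and> set Fs = F \<longrightarrow>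
        outputs_within c (cover_input us Fs) (card (exact_covers U F)) (T (card U)))"

definition computes_01_permanents :: "com \<Rightarrow> (nat \<Rightarrow> real) \<Rightarrow> bool" where
  "computes_01_permanents c T \<longleftrightarrow>
     (\<forall>n. \<forall>A \<in> carrier_mat n n. elements_mat A \<subseteq> {0, 1} \<longrightarrow>
        outputs_within c (matrix_input A) (nat (permanent A)) (T n))"

definition Ostar :: "(nat \<Rightarrow> real) \<Rightarrow> (nat \<Rightarrow> real) set" where
  "Ostar f = {T. \<exists>k::nat. T \<in> O(\<lambda>n. f n * ln (f n) ^ k)}"

end

theory Submission
  imports Defs "HOL-Real_Asymp.Real_Asymp"
begin

text \<open>
  Cut the rows into blocks of \<open>b = K lg n\<close> rows. A choice of an injective partial matching for every
  block is a permutation as soon as the images partition the columns, so the permanent is a sum over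
  such partitions \<open>(S\<^sub>j)\<close> of products of block weights, the number of matchings of block \<open>j\<close> onto \<open>S\<^sub>j\<close>.
  To count this modulo \<open>M\<close> by exact covers, use the columns, one label per block and \<open>O(lg n)\<close> extra
  elements per block as ground set; the family contains, for every block \<open>j\<close> and column set \<open>S\<close>, as many
  sets \<open>{label j} \<union> S \<union> X\<close> as the block weight of \<open>S\<close> modulo \<open>M\<close>, made distinct by sets \<open>X\<close> of extra
  elements of block \<open>j\<close>, and the singletons of extra elements. The family has size \<open>n\<close> to the power
  \<open>O(lg n)\<close>, and the ground set has only \<open>(1 + O(1/K)) n + O(lg n)\<close> elements. The moduli \<open>M \<le> 2 n\<^sup>2 + 3\<close>
  have a least common multiple above \<open>n!\<close>, so the residues determine the permanent.

  Each of the polynomially many instances is written to a fresh arithmetic progression of memory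
  cells, on which the given program is run with relocated addresses.
\<close>

section \<open>Running programs\<close>

text \<open>The obstacle is multiplicity. A family is a set, so \<open>w\<close> matchings with the
  same image have to become \<open>w\<close> different sets, told apart by about log
  \<open>w\<close> further elements. A block weight can be of the order of \<open>b!\<close>;
  numbering its matchings directly costs about \<open>b * log b\<close> elements per block, hence
  about n * log \<open>b\<close> in total, more than the columns themselves. Reducing the weights
  modulo a number polynomial in \<open>n\<close> cuts this to O(\<open>lg n\<close>) per block, a
  small fraction of \<open>b\<close>, at the price of one instance per modulus. Blocks of order
  \<open>lg n\<close> are forced from both sides: shorter ones make the overhead too large, longer
  ones the family. The overhead costs a factor \<open>1 + \<epsilon>\<close> in the exponent and the
  given algorithm saves \<open>1 - \<epsilon>\<close>, leaving
  \<open>1 - \<epsilon>\<^sup>2\<close>; half of this gain pays for the time n to the power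
  O(\<open>lg n\<close>) spent on writing the instances, the other half is the new saving. The given
  program may leave anything in the memory it has used, but is only specified when started on zeros;
  nothing tells which cells would have to be cleaned.\<close>

lemma bits_pos: "1 \<le> bits n"
  by (simp add: bits_def)

lemma less_two_power_bits: "n < 2 ^ bits n"
proof -
  have "n < 2 ^ floorlog 2 n"
    by (rule floorlog_leD) auto
  also have "\<dots> \<le> 2 ^ bits n"
    by (rule power_increasing) (auto simp: bits_def)
  finally show ?thesis .
qed

lemma bits_le: "n < 2 ^ j \<Longrightarrow> 1 \<le> j \<Longrightarrow> bits n \<le> j"
  by (auto simp: bits_def intro: floorlog_leI)

lemma bits_mono: "a \<le> b \<Longrightarrow> bits a \<le> bits b"
  using floorlog_mono[of a b 2] by (auto simp: bits_def max_def)

lemma bits_le_Suc: "bits n \<le> n + 1"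
  by (rule bits_le) (auto intro: less_trans[OF less_exp])

lemma bits_mult_le: "bits (a * b) \<le> bits a + bits b"
proof (rule bits_le)
  show "a * b < 2 ^ (bits a + bits b)"
    unfolding power_add by (intro mult_strict_mono less_two_power_bits) auto
qed (use bits_pos[of a] in simp)

lemma bits_add_le: "bits (a + b) \<le> bits a + bits b"
proof (rule bits_le)
  have "a + 1 \<le> 2 ^ bits a" "b + 1 \<le> 2 ^ bits b"
    using less_two_power_bits by (simp_all add: Suc_leI)
  then have "(a + 1) * (b + 1) \<le> 2 ^ (bits a + bits b)"
    unfolding power_add by (rule mult_le_mono)
  then show "a + b < 2 ^ (bits a + bits b)"
    by (simp add: algebra_simps)
qed (use bits_pos[of a] in simp)

section \<open>Polynomially bounded functions\<close>

text \<open>The base \<open>v + 2\<close> is at least \<open>2\<close> for every \<open>v\<close>,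
  so a larger exponent absorbs constants and sums with no exceptional small arguments.\<close>

definition poly_bounded :: "(nat \<Rightarrow> nat) \<Rightarrow> bool" where
  "poly_bounded F \<longleftrightarrow> (\<exists>k. \<forall>v. F v \<le> (v + 2) ^ k)"

lemma poly_bounded_const: "poly_bounded (\<lambda>v. c)"
proof -
  have "c \<le> (v + 2) ^ c" for v
  proof -
    have "c \<le> 2 ^ c" by (rule less_imp_le, rule less_exp)
    also have "\<dots> \<le> (v + 2) ^ c" by (rule power_mono) auto
    finally show ?thesis .
  qed
  then show ?thesis unfolding poly_bounded_def by blast
qed

lemma poly_bounded_id: "poly_bounded (\<lambda>v. v)"
  unfolding poly_bounded_def by (rule exI[of _ 1]) simp

lemma poly_bounded_mult:
  assumes "poly_bounded F" "poly_bounded G"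
  shows "poly_bounded (\<lambda>v. F v * G v)"
proof -
  obtain k l where "\<forall>v. F v \<le> (v + 2) ^ k" "\<forall>v. G v \<le> (v + 2) ^ l"
    using assms unfolding poly_bounded_def by blast
  then have "\<forall>v. F v * G v \<le> (v + 2) ^ (k + l)"
    by (simp add: power_add mult_le_mono)
  then show ?thesis unfolding poly_bounded_def by blast
qed

lemma poly_bounded_add:
  assumes "poly_bounded F" "poly_bounded G"
  shows "poly_bounded (\<lambda>v. F v + G v)"
proof -
  obtain k l where kl: "\<forall>v. F v \<le> (v + 2) ^ k" "\<forall>v. G v \<le> (v + 2) ^ l"
    using assms unfolding poly_bounded_def by blast
  have "F v + G v \<le> (v + 2) ^ Suc (k + l)" for v
  proof -
    have "F v \<le> (v + 2) ^ (k + l)" "G v \<le> (v + 2) ^ (k + l)"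
      using kl by (meson le_add1 le_add2 order_trans power_increasing trans_le_add2 one_le_numeral)+
    then have "F v + G v \<le> 2 * (v + 2) ^ (k + l)" by linarith
    also have "\<dots> \<le> (v + 2) ^ Suc (k + l)" by simp
    finally show ?thesis .
  qed
  then show ?thesis unfolding poly_bounded_def by blast
qed

lemma poly_bounded_comp:
  assumes "poly_bounded F" "mono F" "poly_bounded G"
  shows "poly_bounded (\<lambda>v. F (G v))"
proof -
  obtain k l where kl: "\<forall>v. F v \<le> (v + 2) ^ k" "\<forall>v. G v \<le> (v + 2) ^ l"
    using assms unfolding poly_bounded_def by blast
  have "F (G v) \<le> (v + 2) ^ ((l + 2) * k)" for v
  proof -
    have "G v + 2 \<le> (v + 2) ^ l + 2" using kl by simp
    also have "\<dots> \<le> (v + 2) ^ (l + 2)"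
    proof -
      have "1 \<le> (v + 2) ^ l" by simp
      moreover have "4 * (v + 2) ^ l \<le> (v + 2)\<^sup>2 * (v + 2) ^ l"
        by (rule mult_le_mono1) (simp add: power2_eq_square)
      ultimately have "(v + 2) ^ l + 2 \<le> (v + 2)\<^sup>2 * (v + 2) ^ l" by linarith
      then show ?thesis by (simp add: power_add mult.commute del: add_2_eq_Suc')
    qed
    finally have "(G v + 2) ^ k \<le> ((v + 2) ^ (l + 2)) ^ k" by (rule power_mono) simp
    then show ?thesis using kl(1) by (metis order_trans power_mult)
  qed
  then show ?thesis unfolding poly_bounded_def by blast
qed

definition run :: "com \<Rightarrow> state \<Rightarrow> nat \<Rightarrow> state \<Rightarrow> bool" where
  "run c s T s' \<longleftrightarrow> (\<exists>t\<le>T. exec c s t s')"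

lemma run_mono: "run c s T s' \<Longrightarrow> T \<le> T' \<Longrightarrow> run c s T' s'"
  unfolding run_def using order_trans by blast

lemma run_Seq: "run c s T s' \<Longrightarrow> run d s' T' s'' \<Longrightarrow> run (Seq c d) s (T + T') s''"
  unfolding run_def by (meson Seq add_mono)

lemma run_Const: "run (Const r k) (R, M) (bits k) (R(r := k), M)"
  unfolding run_def using Const by blast

lemma run_Arith:
  "run (Arith r f p q) (R, M) (bits (R p) + bits (R q)) (R(r := arith_val f (R p) (R q)), M)"
  unfolding run_def using Arith by blast

text \<open>\<open>I\<close> is indexed by the rounds still to run, which register \<open>r\<close>
  holds. A round costs \<open>T\<close> plus the test of a number at most \<open>n\<close>, charged
  at most \<open>n + 1\<close>; the final \<open>+ 1\<close> is the test that finds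
  \<open>0\<close>.\<close>

lemma run_countdown:
  assumes body: "\<And>i s. I (Suc i) s \<Longrightarrow> i < n \<Longrightarrow> \<exists>s'. run c s T s' \<and> I i s'"
    and counter: "\<And>i s. I i s \<Longrightarrow> fst s r = i"
    and start: "I n s"
  shows "\<exists>s'. run (While r c) s (n * (T + n + 1) + 1) s' \<and> I 0 s'"
proof -
  have "i \<le> n \<Longrightarrow> I i s \<Longrightarrow> \<exists>s'. run (While r c) s (i * (T + n + 1) + 1) s' \<and> I 0 s'" for i s
  proof (induction i arbitrary: s)
    case 0
    then have "exec (While r c) s (bits (fst s r)) s" "fst s r = 0"
      using counter WhileFalse by auto
    then have "run (While r c) s (0 * (T + n + 1) + 1) s"
      using bits_le_Suc[of 0] unfolding run_def by auto
    then show ?case using 0 by blast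
  next
    case (Suc i)
    obtain s1 where s1: "run c s T s1" "I i s1" using body[of i s] Suc.prems by auto
    obtain s2 where s2: "run (While r c) s1 (i * (T + n + 1) + 1) s2" "I 0 s2"
      using Suc.IH[OF _ s1(2)] Suc.prems(1) by (meson Suc_leD)
    have r: "fst s r = Suc i" using counter Suc by blast
    obtain t1 t2 where t: "exec c s t1 s1" "t1 \<le> T" "exec (While r c) s1 t2 s2"
      "t2 \<le> i * (T + n + 1) + 1"
      using s1 s2 unfolding run_def by blast
    have "exec (While r c) s (bits (fst s r) + t1 + t2) s2"
      by (rule WhileTrue) (use t r in auto)
    moreover have "bits (fst s r) + t1 + t2 \<le> Suc i * (T + n + 1) + 1"
      using r bits_le_Suc[of "Suc i"] t Suc.prems bits_mono[of "Suc i" n] bits_le_Suc[of n] by auto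
    ultimately show ?case using s2 unfolding run_def by blast
  qed
  then show ?thesis using start by blast
qed

section \<open>An expression language and its compiler\<close>

datatype expr =
    EVar nat
  | ENum nat
  | EBin arith expr expr
  | ESum expr expr
  | EShift expr expr expr
  | ERead expr
  | ECall expr "expr list"

text \<open>Arguments are de Bruijn indexed: a summation variable becomes \<open>EVar 0\<close> and
  moves the others up. Loops run only up to computed bounds, so values and running times stay
  polynomial in the arguments. \<open>EShift\<close> divides repeatedly because the power itself may
  be exponential. \<open>ECall\<close> evaluates an expression on its own argument list, so that it
  can be reused under any number of binders.\<close>

fun ev :: "(nat \<Rightarrow> nat) \<Rightarrow> expr \<Rightarrow> nat list \<Rightarrow> nat" where
  "ev A (EVar i) xs = (if i < length xs then xs ! i else 0)"
| "ev A (ENum c) xs = c"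
| "ev A (EBin f a b) xs = arith_val f (ev A a xs) (ev A b xs)"
| "ev A (ESum h f) xs = (\<Sum>i<ev A h xs. ev A f (i # xs))"
| "ev A (EShift x d n) xs = ev A x xs div ev A d xs ^ ev A n xs"
| "ev A (ERead a) xs = A (ev A a xs)"
| "ev A (ECall f gs) xs = ev A f (map (\<lambda>g. ev A g xs) gs)"

text \<open>Register \<open>e\<close> is the first free one: the value ends there and nothing below
  it changes. Copying is adding \<open>0\<close>, as there is no move instruction. In
  \<open>ESum\<close>, \<open>e\<close> accumulates, \<open>e + 1\<close> is the bound variable and
  \<open>e + 2\<close> counts down; \<open>ERead\<close> tests its address against
  \<open>n * n\<close>, with \<open>n\<close> in register \<open>0\<close>, by truncated
  subtraction.\<close>

fun compile :: "expr \<Rightarrow> reg list \<Rightarrow> reg \<Rightarrow> com"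
  and compiles :: "expr list \<Rightarrow> reg list \<Rightarrow> reg \<Rightarrow> com" where
  "compile (EVar i) rs e =
     (if i < length rs then Seq (Const e 0) (Arith e Add (rs ! i) e) else Const e 0)"
| "compile (ENum c) rs e = Const e c"
| "compile (EBin f a b) rs e =
     Seq (compile a rs e) (Seq (compile b rs (e + 1)) (Arith e f e (e + 1)))"
| "compile (ESum h f) rs e =
     Seq (compile h rs (e + 2)) (Seq (Const e 0) (Seq (Const (e + 1) 0)
       (While (e + 2)
         (Seq (compile f ((e + 1) # rs) (e + 3))
         (Seq (Arith e Add e (e + 3))
         (Seq (Const (e + 3) 1)
         (Seq (Arith (e + 1) Add (e + 1) (e + 3))
              (Arith (e + 2) Sub (e + 2) (e + 3)))))))))"
| "compile (EShift x d n) rs e =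
     Seq (compile x rs e) (Seq (compile d rs (e + 1)) (Seq (compile n rs (e + 2))
       (While (e + 2)
         (Seq (Arith e Div e (e + 1))
         (Seq (Const (e + 3) 1)
              (Arith (e + 2) Sub (e + 2) (e + 3)))))))"
| "compile (ERead a) rs e =
     Seq (compile a rs e) (Seq (Arith (e + 1) Mul 0 0) (Seq (Arith (e + 1) Sub (e + 1) e)
       (If (e + 1) (Load e e) (Const e 0))))"
| "compile (ECall f gs) rs e =
     Seq (compiles gs rs e)
     (Seq (compile f [e..<e + length gs] (Suc (e + length gs)))
     (Seq (Const e 0) (Arith e Add (Suc (e + length gs)) e)))"
| "compiles [] rs e = Skip"
| "compiles (g # gs) rs e = Seq (compile g rs e) (compiles gs rs (Suc e))"

lemma poly_boundedD:
  assumes "poly_bounded F"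
  obtains k where "\<And>v. F v \<le> (v + 2) ^ k"
  using assms unfolding poly_bounded_def by blast

text \<open>Read values are at most \<open>1\<close>, shifts only decrease, and polynomials are
  closed under composition. A sum has at most \<open>F v\<close> terms, each with arguments at most
  \<open>v + F v\<close>, since the new variable is below \<open>F v\<close>.\<close>

lemma ev_bound:
  "\<exists>F. poly_bounded F \<and> mono F \<and>
     (\<forall>A xs v. (\<forall>a. A a \<le> 1) \<longrightarrow> (\<forall>x\<in>set xs. x \<le> v) \<longrightarrow> ev A E xs \<le> F v)"
  (is "\<exists>F. ?P F E")
proof (induction E)
  case (EVar i)
  then show ?case
    by (intro exI[of _ "\<lambda>v. v"]) (auto intro: poly_bounded_id monoI)
next
  case (ENum c)
  then show ?case
    by (intro exI[of _ "\<lambda>v. c"]) (auto intro: poly_bounded_const monoI)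
next
  case (EBin f a b)
  obtain F where F: "?P F a" using EBin.IH(1) by (elim exE)
  obtain G where G: "?P G b" using EBin.IH(2) by (elim exE)
  note FG = F G
  \<comment> \<open>This product dominates all five operations, including division and remainder by
    \<open>0\<close>.\<close>
  have val: "arith_val f x y \<le> (x + 1) * (y + 1)" for x y
    by (cases f) (auto simp: algebra_simps intro: trans_le_add1 trans_le_add2
      order_trans[OF div_le_dividend] order_trans[OF mod_less_eq_dividend])
  show ?case
  proof (rule exI[of _ "\<lambda>v. (F v + 1) * (G v + 1)"], intro conjI allI impI)
    show "poly_bounded (\<lambda>v. (F v + 1) * (G v + 1))"
      using FG by (intro poly_bounded_mult poly_bounded_add poly_bounded_const) auto
    show "mono (\<lambda>v. (F v + 1) * (G v + 1))"
      using FG by (auto simp: mono_def intro!: add_mono mult_le_mono)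
    fix A :: "nat \<Rightarrow> nat" and xs :: "nat list" and v
    assume "\<forall>a. A a \<le> 1" "\<forall>x\<in>set xs. x \<le> v"
    then have "ev A a xs \<le> F v" "ev A b xs \<le> G v" using FG by blast+
    then have "(ev A a xs + 1) * (ev A b xs + 1) \<le> (F v + 1) * (G v + 1)"
      by (intro mult_le_mono add_mono) auto
    then show "ev A (EBin f a b) xs \<le> (F v + 1) * (G v + 1)"
      using val order_trans by fastforce
  qed
next
  case (ESum h f)
  obtain F where F: "?P F h" using ESum.IH(1) by (elim exE)
  obtain G where G: "?P G f" using ESum.IH(2) by (elim exE)
  note FG = F G
  show ?case
  proof (rule exI[of _ "\<lambda>v. F v * G (v + F v)"], intro conjI allI impI)
    show "poly_bounded (\<lambda>v. F v * G (v + F v))"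
    proof (rule poly_bounded_mult[OF _ poly_bounded_comp[OF _ _ poly_bounded_add[OF poly_bounded_id]]])
    qed (use FG in auto)
    show "mono (\<lambda>v. F v * G (v + F v))"
    proof (rule monoI)
      fix v w :: nat
      assume "v \<le> w"
      moreover from this have "F v \<le> F w" using F by (auto dest: monoD)
      ultimately show "F v * G (v + F v) \<le> F w * G (w + F w)"
        using G by (intro mult_le_mono monoD[of G]) auto
    qed
    fix A :: "nat \<Rightarrow> nat" and xs :: "nat list" and v
    assume A: "\<forall>a. A a \<le> 1" and xs: "\<forall>x\<in>set xs. x \<le> v"
    then have h: "ev A h xs \<le> F v" using FG by blast
    have "ev A f (i # xs) \<le> G (v + F v)" if "i < ev A h xs" for i
    proof -
      have "\<forall>x\<in>set (i # xs). x \<le> v + F v" using that h xs by auto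
      then show ?thesis using FG A by blast
    qed
    then have "(\<Sum>i<ev A h xs. ev A f (i # xs)) \<le> ev A h xs * G (v + F v)"
      using sum_bounded_above[of "{..<ev A h xs}" "\<lambda>i. ev A f (i # xs)" "G (v + F v)"] by auto
    then show "ev A (ESum h f) xs \<le> F v * G (v + F v)"
      using h by (auto intro: order_trans mult_le_mono1)
  qed
next
  case (EShift x d n)
  obtain F where F: "?P F x" using EShift.IH(1) by (elim exE)
  then show ?case
    by (intro exI[of _ F]) (auto intro: order_trans[OF div_le_dividend])
next
  case (ERead a)
  then show ?case
    by (intro exI[of _ "\<lambda>v. 1"]) (auto intro: poly_bounded_const monoI)
next
  case (ECall f gs)
  have "\<exists>G. poly_bounded G \<and> mono G \<and> (\<forall>A xs v. (\<forall>a. A a \<le> 1) \<longrightarrow> (\<forall>x\<in>set xs. x \<le> v) \<longrightarrow>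
    (\<forall>g\<in>set gs. ev A g xs \<le> G v))"
    using ECall.IH(2)
  proof (induction gs)
    case Nil
    then show ?case
      by (intro exI[of _ "\<lambda>v. v"]) (auto intro: poly_bounded_id monoI)
  next
    case (Cons g gs)
    obtain G where G: "poly_bounded G" "mono G" "\<forall>A xs v. (\<forall>a. A a \<le> 1) \<longrightarrow> (\<forall>x\<in>set xs. x \<le> v) \<longrightarrow>
      (\<forall>g\<in>set gs. ev A g xs \<le> G v)"
      using Cons by (metis list.set_intros(2))
    obtain F where F: "?P F g"
      using Cons.prems[OF list.set_intros(1)] by (elim exE)
    show ?case
    proof (rule exI[of _ "\<lambda>v. F v + G v"], intro conjI)
      show "poly_bounded (\<lambda>v. F v + G v)" by (rule poly_bounded_add) (use F G in auto)
      show "mono (\<lambda>v. F v + G v)" using F G by (auto simp: mono_def intro: add_mono)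
      show "\<forall>A xs v. (\<forall>a. A a \<le> 1) \<longrightarrow> (\<forall>x\<in>set xs. x \<le> v) \<longrightarrow>
        (\<forall>g\<in>set (g # gs). ev A g xs \<le> F v + G v)"
        using F G(3) by (auto intro: trans_le_add1 trans_le_add2)
    qed
  qed
  then obtain G where G: "poly_bounded G" "mono G" "\<forall>A xs v. (\<forall>a. A a \<le> 1) \<longrightarrow>
    (\<forall>x\<in>set xs. x \<le> v) \<longrightarrow> (\<forall>g\<in>set gs. ev A g xs \<le> G v)"
    by blast
  obtain F where F: "?P F f" using ECall.IH(1) by (elim exE)
  show ?case
  proof (rule exI[of _ "\<lambda>v. F (G v)"], intro conjI allI impI)
    show "poly_bounded (\<lambda>v. F (G v))" by (rule poly_bounded_comp) (use F G in auto)
    show "mono (\<lambda>v. F (G v))" using F G by (auto simp: mono_def)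
    fix A :: "nat \<Rightarrow> nat" and xs :: "nat list" and v
    assume A: "\<forall>a. A a \<le> 1" and xs: "\<forall>x\<in>set xs. x \<le> v"
    then have "\<forall>y\<in>set (map (\<lambda>g. ev A g xs) gs). y \<le> G v" using G(3) by simp
    then have "ev A f (map (\<lambda>g. ev A g xs) gs) \<le> F (G v)" using F A by blast
    then show "ev A (ECall f gs) xs \<le> F (G v)" by simp
  qed
qed

text \<open>
  The memory beyond the matrix is used for the set cover instances, so reads beyond it are guarded
  and give \<open>0\<close>.
\<close>

definition reads_matrix :: "(nat \<Rightarrow> nat) \<Rightarrow> (reg \<Rightarrow> nat) \<Rightarrow> (nat \<Rightarrow> nat) \<Rightarrow> bool" where
  "reads_matrix A R M \<longleftrightarrow>
     (\<forall>a. A a \<le> 1 \<and> (if a < R 0 * R 0 then M a = A a else A a = 0))"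

text \<open>Instructions are charged for the numbers they read, not for register names, so one time
  bound \<open>F\<close> serves every allocation \<open>rs\<close>, \<open>e\<close>; the induction
  over nested binders relies on this. \<open>0 < e\<close> protects register \<open>0\<close>, which
  guards memory reads.\<close>

definition compiled :: "expr \<Rightarrow> (nat \<Rightarrow> nat) \<Rightarrow> bool" where
  "compiled E F \<longleftrightarrow> poly_bounded F \<and> mono F \<and>
     (\<forall>A rs e R M v. reads_matrix A R M \<longrightarrow> R 0 \<le> v \<longrightarrow> 0 < e \<longrightarrow>
        (\<forall>r\<in>set rs. r < e \<and> R r \<le> v) \<longrightarrow>
        (\<exists>R'. run (compile E rs e) (R, M) (F v) (R', M) \<and>
              R' e = ev A E (map R rs) \<and> (\<forall>r<e. R' r = R r)))"

lemma compiledD: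
  assumes "compiled E F" "reads_matrix A R M" "R 0 \<le> v" "0 < e" "\<And>r. r \<in> set rs \<Longrightarrow> r < e"
    "\<And>r. r \<in> set rs \<Longrightarrow> R r \<le> v"
  obtains R' where "run (compile E rs e) (R, M) (F v) (R', M)"
    "R' e = ev A E (map R rs)" "\<And>r. r < e \<Longrightarrow> R' r = R r"
proof -
  have "\<forall>r\<in>set rs. r < e \<and> R r \<le> v" using assms by blast
  then show thesis using assms(1-4) that unfolding compiled_def by blast
qed

lemma reads_matrix_cong: "reads_matrix A R M \<Longrightarrow> R' 0 = R 0 \<Longrightarrow> reads_matrix A R' M"
  unfolding reads_matrix_def by simp

lemma compiledI:
  assumes "poly_bounded F" "mono F"
    and "\<And>A rs e R M v. reads_matrix A R M \<Longrightarrow> R 0 \<le> v \<Longrightarrow> 0 < e \<Longrightarrow>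
        (\<And>r. r \<in> set rs \<Longrightarrow> r < e) \<Longrightarrow> (\<And>r. r \<in> set rs \<Longrightarrow> R r \<le> v) \<Longrightarrow>
        \<exists>R'. run (compile E rs e) (R, M) (F v) (R', M) \<and>
              R' e = ev A E (map R rs) \<and> (\<forall>r<e. R' r = R r)"
  shows "compiled E F"
  unfolding compiled_def using assms by simp

lemma mono_plus: "mono F \<Longrightarrow> mono G \<Longrightarrow> mono (\<lambda>v. F v + G v :: nat)"
  by (simp add: mono_def add_mono)

lemma mono_times: "mono F \<Longrightarrow> mono G \<Longrightarrow> mono (\<lambda>v. F v * G v :: nat)"
  by (simp add: mono_def mult_le_mono)

lemma mono_comp: "mono F \<Longrightarrow> mono G \<Longrightarrow> mono (\<lambda>v. F (G v) :: nat)" for F G :: "nat \<Rightarrow> nat"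
  by (simp add: mono_def)

lemma mono_const: "mono (\<lambda>v. c)"
  by (simp add: mono_def)

lemma mono_id: "mono (\<lambda>v::nat. v)"
  by (simp add: mono_def)

lemma compile_EVar: "\<exists>F. compiled (EVar i) F"
proof (rule exI, rule compiledI)
  show "poly_bounded (\<lambda>v. v + 3)" by (intro poly_bounded_add poly_bounded_const poly_bounded_id)
  show "mono (\<lambda>v::nat. v + 3)" by (intro mono_plus mono_const mono_id)
  fix A rs e R M v
  assume *: "reads_matrix A R M" "R 0 \<le> v" "0 < e" "\<And>r. r \<in> set rs \<Longrightarrow> r < e"
    "\<And>r. r \<in> set rs \<Longrightarrow> R r \<le> v"
  show "\<exists>R'. run (compile (EVar i) rs e) (R, M) (v + 3) (R', M) \<and>
              R' e = ev A (EVar i) (map R rs) \<and> (\<forall>r<e. R' r = R r)"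
  proof (cases "i < length rs")
    case True
    then have i: "rs ! i < e" "R (rs ! i) \<le> v" using * by auto
    have "run (compile (EVar i) rs e) (R, M)
        (bits 0 + (bits ((R(e := 0)) (rs ! i)) + bits ((R(e := 0)) e)))
        ((R(e := 0))(e := R (rs ! i)), M)"
      using True i run_Seq[OF run_Const[of e 0 R M] run_Arith[of e Add "rs ! i" e "R(e := 0)" M]]
      by simp
    moreover have "bits 0 + (bits ((R(e := 0)) (rs ! i)) + bits ((R(e := 0)) e)) \<le> v + 3"
      using i bits_le_Suc[of "R (rs ! i)"] bits_le_Suc[of 0] by auto
    ultimately show ?thesis using True
      by (intro exI[of _ "(R(e := 0))(e := R (rs ! i))"]) (auto intro: run_mono)
  next
    case False
    then show ?thesis using run_Const[of e 0 R M] bits_le_Suc[of 0]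
      by (intro exI[of _ "R(e := 0)"]) (auto intro: run_mono)
  qed
qed

lemma compile_ENum: "\<exists>F. compiled (ENum c) F"
proof (rule exI, rule compiledI)
  show "poly_bounded (\<lambda>v. bits c)" by (rule poly_bounded_const)
  show "mono (\<lambda>v::nat. bits c)" by (rule mono_const)
  fix A rs e R M and v :: nat
  show "\<exists>R'. run (compile (ENum c) rs e) (R, M) (bits c) (R', M) \<and>
              R' e = ev A (ENum c) (map R rs) \<and> (\<forall>r<e. R' r = R r)"
    using run_Const[of e c R M] by (intro exI[of _ "R(e := c)"]) auto
qed

lemma ev_boundE:
  obtains F where "poly_bounded F" "mono F"
    "\<And>A xs v. (\<And>a. A a \<le> 1) \<Longrightarrow> (\<And>x. x \<in> set xs \<Longrightarrow> x \<le> v) \<Longrightarrow> ev A E xs \<le> F v"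
  using ev_bound[of E] by blast

lemma reads_matrix_le: "reads_matrix A R M \<Longrightarrow> A a \<le> 1"
  unfolding reads_matrix_def by blast

lemma compile_EBin:
  assumes a: "compiled a F" and b: "compiled b G"
  shows "\<exists>F. compiled (EBin f a b) F"
proof -
  obtain X where X: "poly_bounded X" "mono X"
    "\<And>A xs v. (\<And>a. A a \<le> 1) \<Longrightarrow> (\<And>x. x \<in> set xs \<Longrightarrow> x \<le> v) \<Longrightarrow> ev A a xs \<le> X v"
    by (rule ev_boundE[where E = "a"]) blast
  obtain Y where Y: "poly_bounded Y" "mono Y"
    "\<And>A xs v. (\<And>a. A a \<le> 1) \<Longrightarrow> (\<And>x. x \<in> set xs \<Longrightarrow> x \<le> v) \<Longrightarrow> ev A b xs \<le> Y v"
    by (rule ev_boundE[where E = "b"]) blast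
  have F: "poly_bounded F" "mono F" and G: "poly_bounded G" "mono G"
    using a b unfolding compiled_def by auto
  show ?thesis
  proof (rule exI, rule compiledI)
    show "poly_bounded (\<lambda>v. F v + (G v + ((X v + 1) + (Y v + 1))))"
      by (intro poly_bounded_add poly_bounded_const F G X Y)
    show "mono (\<lambda>v. F v + (G v + ((X v + 1) + (Y v + 1))))"
      by (intro mono_plus mono_const F G X Y)
    fix A rs e R M v
    assume *: "reads_matrix A R M" "R 0 \<le> v" "0 < e" "\<And>r. r \<in> set rs \<Longrightarrow> r < e"
      "\<And>r. r \<in> set rs \<Longrightarrow> R r \<le> v"
    obtain R1 where R1: "run (compile a rs e) (R, M) (F v) (R1, M)"
      "R1 e = ev A a (map R rs)" "\<And>r. r < e \<Longrightarrow> R1 r = R r"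
      by (rule compiledD[OF a *]) auto
    have eq: "map R1 rs = map R rs" using * R1 by simp
    obtain R2 where R2: "run (compile b rs (e + 1)) (R1, M) (G v) (R2, M)"
      "R2 (e + 1) = ev A b (map R1 rs)" "\<And>r. r < e + 1 \<Longrightarrow> R2 r = R1 r"
    proof (rule compiledD[OF b, of A R1 M v "e + 1" rs])
      show "reads_matrix A R1 M" using * R1 by (auto intro: reads_matrix_cong)
    qed (use * R1 in \<open>auto simp: less_SucI\<close>)
    let ?R3 = "R2(e := arith_val f (R2 e) (R2 (e + 1)))"
    have "run (compile (EBin f a b) rs e) (R, M) (F v + (G v + (bits (R2 e) + bits (R2 (e + 1))))) (?R3, M)"
      unfolding compile.simps by (intro run_Seq[OF R1(1) run_Seq[OF R2(1)]] run_Arith)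
    moreover have "R2 e \<le> X v" "R2 (e + 1) \<le> Y v"
      unfolding R2(2) R2(3)[of e, simplified] R1(2) eq using * reads_matrix_le
      by (auto intro!: X(3) Y(3))
    then have "bits (R2 e) + bits (R2 (e + 1)) \<le> (X v + 1) + (Y v + 1)"
      using bits_le_Suc[of "R2 e"] bits_le_Suc[of "R2 (e + 1)"] by linarith
    ultimately have "run (compile (EBin f a b) rs e) (R, M)
      (F v + (G v + ((X v + 1) + (Y v + 1)))) (?R3, M)"
      by (auto intro: run_mono)
    then show "\<exists>R'. run (compile (EBin f a b) rs e) (R, M) (F v + (G v + ((X v + 1) + (Y v + 1)))) (R', M) \<and>
              R' e = ev A (EBin f a b) (map R rs) \<and> (\<forall>r<e. R' r = R r)"
      using R1 R2 eq by (intro exI[of _ ?R3]) auto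
  qed
qed

lemma compile_ERead:
  assumes a: "compiled a F"
  shows "\<exists>F. compiled (ERead a) F"
proof -
  obtain X where X: "poly_bounded X" "mono X"
    "\<And>A xs v. (\<And>a. A a \<le> 1) \<Longrightarrow> (\<And>x. x \<in> set xs \<Longrightarrow> x \<le> v) \<Longrightarrow> ev A a xs \<le> X v"
    by (rule ev_boundE[where E = "a"]) blast
  have F: "poly_bounded F" "mono F"
    using a unfolding compiled_def by auto
  let ?T = "\<lambda>v. F v + (2 * v + 2 + ((v * v + 1 + X v + 1) + ((v * v + 1) + (X v + 3))))"
  show ?thesis
  proof (rule exI, rule compiledI)
    show "poly_bounded ?T"
      by (intro poly_bounded_add poly_bounded_mult poly_bounded_id poly_bounded_const F X)
    show "mono ?T"
      by (intro mono_plus mono_times mono_id mono_const F X)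
    fix A rs e R M v
    assume *: "reads_matrix A R M" "R 0 \<le> v" "0 < e" "\<And>r. r \<in> set rs \<Longrightarrow> r < e"
      "\<And>r. r \<in> set rs \<Longrightarrow> R r \<le> v"
    obtain R1 where R1: "run (compile a rs e) (R, M) (F v) (R1, M)"
      "R1 e = ev A a (map R rs)" "\<And>r. r < e \<Longrightarrow> R1 r = R r"
      by (rule compiledD[OF a *]) auto
    have R10: "R1 0 = R 0" using R1 * by auto
    let ?a = "R1 e"
    let ?R2 = "R1(e + 1 := R 0 * R 0)"
    let ?R3 = "?R2(e + 1 := R 0 * R 0 - ?a)"
    have a_le: "?a \<le> X v" unfolding R1(2) using * reads_matrix_le by (auto intro!: X(3))
    have s2: "run (Arith (e + 1) Mul 0 0) (R1, M) (2 * v + 2) (?R2, M)"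
      using run_Arith[of "e + 1" Mul 0 0 R1 M] * R10 bits_le_Suc[of "R 0"]
      by (auto intro: run_mono)
    have sq: "R 0 * R 0 \<le> v * v" using * by (intro mult_le_mono) auto
    have s3: "run (Arith (e + 1) Sub (e + 1) e) (?R2, M) (v * v + 1 + X v + 1) (?R3, M)"
      using run_Arith[of "e + 1" Sub "e + 1" e ?R2 M] sq a_le
        bits_le_Suc[of "R 0 * R 0"] bits_le_Suc[of ?a]
      by (auto intro: run_mono)
    let ?R4 = "?R3(e := A ?a)"
    have s4: "run (If (e + 1) (Load e e) (Const e 0)) (?R3, M) ((v * v + 1) + (X v + 3)) (?R4, M)"
    proof (cases "?a < R 0 * R 0")
      case True
      then have Ma: "M ?a = A ?a" "A ?a \<le> 1" using *(1) unfolding reads_matrix_def by metis+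
      have "exec (If (e + 1) (Load e e) (Const e 0)) (?R3, M)
        (bits (?R3 (e + 1)) + (bits (?R3 e) + bits (M (?R3 e)))) (?R3(e := M (?R3 e)), M)"
        by (rule IfTrue[of "(?R3, M)" "e + 1", simplified fst_conv, OF _ Load]) (use True in auto)
      moreover have "bits (?R3 (e + 1)) + (bits (?R3 e) + bits (M (?R3 e))) \<le> (v * v + 1) + (X v + 3)"
        using bits_le_Suc[of "R 0 * R 0 - ?a"] bits_le_Suc[of ?a] bits_le_Suc[of "A ?a"] Ma sq a_le
        by simp
      ultimately show ?thesis using Ma unfolding run_def by auto
    next
      case False
      then have Ma: "A ?a = 0" using *(1) unfolding reads_matrix_def by metis
      have "exec (If (e + 1) (Load e e) (Const e 0)) (?R3, M)
        (bits (fst (?R3, M) (e + 1)) + bits 0) (?R3(e := 0), M)"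
        by (rule IfFalse[OF _ Const]) (use False in simp)
      moreover have "bits (?R3 (e + 1)) + bits 0 \<le> (v * v + 1) + (X v + 3)"
        using False bits_le_Suc[of 0] by simp
      ultimately show ?thesis using Ma unfolding run_def by auto
    qed
    have "run (compile (ERead a) rs e) (R, M) (?T v) (?R4, M)"
      unfolding compile.simps by (intro run_Seq[OF R1(1) run_Seq[OF s2 run_Seq[OF s3 s4]]])
    then show "\<exists>R'. run (compile (ERead a) rs e) (R, M) (?T v) (R', M) \<and>
              R' e = ev A (ERead a) (map R rs) \<and> (\<forall>r<e. R' r = R r)"
      using R1 by (intro exI[of _ ?R4]) auto
  qed
qed

lemma compile_EShift:
  assumes x: "compiled x F" and d: "compiled d G" and n: "compiled n H"
  shows "\<exists>F. compiled (EShift x d n) F"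
proof -
  obtain X where X: "poly_bounded X" "mono X"
    "\<And>A xs v. (\<And>a. A a \<le> 1) \<Longrightarrow> (\<And>y. y \<in> set xs \<Longrightarrow> y \<le> v) \<Longrightarrow> ev A x xs \<le> X v"
    by (rule ev_boundE[where E = "x"]) blast
  obtain Y where Y: "poly_bounded Y" "mono Y"
    "\<And>A xs v. (\<And>a. A a \<le> 1) \<Longrightarrow> (\<And>y. y \<in> set xs \<Longrightarrow> y \<le> v) \<Longrightarrow> ev A d xs \<le> Y v"
    by (rule ev_boundE[where E = "d"]) blast
  obtain Z where Z: "poly_bounded Z" "mono Z"
    "\<And>A xs v. (\<And>a. A a \<le> 1) \<Longrightarrow> (\<And>y. y \<in> set xs \<Longrightarrow> y \<le> v) \<Longrightarrow> ev A n xs \<le> Z v"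
    by (rule ev_boundE[where E = "n"]) blast
  have F: "poly_bounded F" "mono F" and G: "poly_bounded G" "mono G" and H: "poly_bounded H" "mono H"
    using x d n unfolding compiled_def by auto
  let ?B = "\<lambda>v. X v + Y v + Z v + 10"
  let ?T = "\<lambda>v. F v + (G v + (H v + (Z v * (?B v + Z v + 1) + 1)))"
  show ?thesis
  proof (rule exI, rule compiledI)
    show "poly_bounded ?T"
      by (intro poly_bounded_add poly_bounded_mult poly_bounded_id poly_bounded_const F G H X Y Z)
    show "mono ?T"
      by (intro mono_plus mono_times mono_id mono_const F G H X Y Z)
    fix A rs e R M v
    assume *: "reads_matrix A R M" "R 0 \<le> v" "0 < e" "\<And>r. r \<in> set rs \<Longrightarrow> r < e"
      "\<And>r. r \<in> set rs \<Longrightarrow> R r \<le> v"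
    obtain R1 where R1: "run (compile x rs e) (R, M) (F v) (R1, M)"
      "R1 e = ev A x (map R rs)" "\<And>r. r < e \<Longrightarrow> R1 r = R r"
      by (rule compiledD[OF x *]) auto
    have eq1: "map R1 rs = map R rs" using * R1 by simp
    obtain R2 where R2: "run (compile d rs (e + 1)) (R1, M) (G v) (R2, M)"
      "R2 (e + 1) = ev A d (map R1 rs)" "\<And>r. r < e + 1 \<Longrightarrow> R2 r = R1 r"
    proof (rule compiledD[OF d, of A R1 M v "e + 1" rs])
      show "reads_matrix A R1 M" using * R1 by (auto intro: reads_matrix_cong)
    qed (use * R1 in \<open>auto simp: less_SucI\<close>)
    have eq2: "map R2 rs = map R rs" using * R1 R2 by (simp add: less_SucI)
    obtain R3 where R3: "run (compile n rs (e + 2)) (R2, M) (H v) (R3, M)"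
      "R3 (e + 2) = ev A n (map R2 rs)" "\<And>r. r < e + 2 \<Longrightarrow> R3 r = R2 r"
    proof (rule compiledD[OF n, of A R2 M v "e + 2" rs])
      show "reads_matrix A R2 M" using * R1 R2 by (auto intro: reads_matrix_cong)
    qed (use * R1 R2 in \<open>auto simp: less_SucI\<close>)
    define x0 d0 n0 where "x0 = ev A x (map R rs)" "d0 = ev A d (map R rs)" "n0 = ev A n (map R rs)"
    have le: "x0 \<le> X v" "d0 \<le> Y v" "n0 \<le> Z v"
      unfolding x0_d0_n0_def using * reads_matrix_le by (auto intro!: X(3) Y(3) Z(3))
    have R3v: "R3 e = x0" "R3 (e + 1) = d0" "R3 (e + 2) = n0" "\<And>r. r < e \<Longrightarrow> R3 r = R r"
      using R1 R2 R3 eq1 eq2 unfolding x0_d0_n0_def by auto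
    \<comment> \<open>Iterated division is division by the product of the divisors, so the power
      \<open>d0 ^ (n0 - i)\<close> is never stored in a register.\<close>
    define I where "I i s \<longleftrightarrow> i \<le> n0 \<and> snd s = M \<and> fst s e = x0 div d0 ^ (n0 - i) \<and> fst s (e + 1) = d0 \<and>
      fst s (e + 2) = i \<and> (\<forall>r<e. fst s r = R r)" for i s
    define body where "body = Seq (Arith e Div e (e + 1)) (Seq (Const (e + 3) 1)
              (Arith (e + 2) Sub (e + 2) (e + 3)))"
    have "\<exists>s'. run (While (e + 2) body) (R3, M) (n0 * (?B v + n0 + 1) + 1) s' \<and> I 0 s'"
    proof (rule run_countdown[where I = I])
      show "I n0 (R3, M)" unfolding I_def using R3v by simp
      show "fst s (e + 2) = i" if "I i s" for i s using that unfolding I_def by simp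
      fix i s
      assume I: "I (Suc i) s" and i: "i < n0"
      obtain Q where s: "s = (Q, M)" using I unfolding I_def by (cases s) auto
      let ?y = "x0 div d0 ^ (n0 - Suc i)"
      have Q: "Q e = ?y" "Q (e + 1) = d0" "Q (e + 2) = Suc i" "\<And>r. r < e \<Longrightarrow> Q r = R r"
        using I unfolding I_def s by auto
      let ?Q1 = "Q(e := ?y div d0)" let ?Q2 = "?Q1(e + 3 := 1)" let ?Q3 = "?Q2(e + 2 := i)"
      have yle: "?y \<le> X v" using le div_le_dividend order_trans by blast
      have 1: "run (Arith e Div e (e + 1)) (Q, M) (X v + 1 + Y v + 1) (?Q1, M)"
        using run_Arith[of e Div e "e + 1" Q M] Q bits_le_Suc[of ?y] bits_le_Suc[of d0] le yle
        by (auto intro: run_mono)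
      have 2: "run (Const (e + 3) 1) (?Q1, M) 2 (?Q2, M)"
        using run_Const[of "e + 3" 1 ?Q1 M] bits_le_Suc[of 1] by (auto intro: run_mono)
      have 3: "run (Arith (e + 2) Sub (e + 2) (e + 3)) (?Q2, M) (Z v + 1 + 2) (?Q3, M)"
        using run_Arith[of "e + 2" Sub "e + 2" "e + 3" ?Q2 M] Q bits_le_Suc[of "Suc i"]
          bits_le_Suc[of 1] le i by (auto intro: run_mono)
      have "run body s (?B v) (?Q3, M)"
        unfolding body_def s by (rule run_mono[OF run_Seq[OF 1 run_Seq[OF 2 3]]]) auto
      moreover have "I i (?Q3, M)"
        using Q i unfolding I_def by (auto simp: div_mult2_eq[symmetric] Suc_diff_Suc[symmetric] mult.commute)
      ultimately show "\<exists>s'. run body s (?B v) s' \<and> I i s'" by blast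
    qed
    then obtain R4 where R4: "run (While (e + 2) body) (R3, M) (n0 * (?B v + n0 + 1) + 1) (R4, M)"
      "I 0 (R4, M)" unfolding I_def by auto
    have "run (While (e + 2) body) (R3, M) (Z v * (?B v + Z v + 1) + 1) (R4, M)"
      by (rule run_mono[OF R4(1)]) (use le in \<open>auto intro!: mult_le_mono\<close>)
    then have "run (compile (EShift x d n) rs e) (R, M) (?T v) (R4, M)"
      unfolding compile.simps body_def by (intro run_Seq[OF R1(1) run_Seq[OF R2(1) run_Seq[OF R3(1)]]])
    then show "\<exists>R'. run (compile (EShift x d n) rs e) (R, M) (?T v) (R', M) \<and>
              R' e = ev A (EShift x d n) (map R rs) \<and> (\<forall>r<e. R' r = R r)"
      using R4(2) by (intro exI[of _ R4]) (auto simp: I_def x0_d0_n0_def)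
  qed
qed

lemma compile_ESum:
  assumes h: "compiled h F" and f: "compiled f G"
  shows "\<exists>F. compiled (ESum h f) F"
proof -
  obtain X where X: "poly_bounded X" "mono X"
    "\<And>A xs v. (\<And>a. A a \<le> 1) \<Longrightarrow> (\<And>y. y \<in> set xs \<Longrightarrow> y \<le> v) \<Longrightarrow> ev A h xs \<le> X v"
    by (rule ev_boundE[where E = "h"]) blast
  obtain Y where Y: "poly_bounded Y" "mono Y"
    "\<And>A xs v. (\<And>a. A a \<le> 1) \<Longrightarrow> (\<And>y. y \<in> set xs \<Longrightarrow> y \<le> v) \<Longrightarrow> ev A f xs \<le> Y v"
    by (rule ev_boundE[where E = "f"]) blast
  obtain Z where Z: "poly_bounded Z" "mono Z"
    "\<And>A xs v. (\<And>a. A a \<le> 1) \<Longrightarrow> (\<And>y. y \<in> set xs \<Longrightarrow> y \<le> v) \<Longrightarrow> ev A (ESum h f) xs \<le> Z v"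
    by (rule ev_boundE[where E = "(ESum h f)"]) blast
  have F: "poly_bounded F" "mono F" and G: "poly_bounded G" "mono G"
    using h f unfolding compiled_def by auto
  \<comment> \<open>The body runs with the index among its arguments, which is why its bounds are
    taken at \<open>v + X v\<close>. \<open>Z\<close> bounds the complete sum and hence every
    partial sum in the accumulator.\<close>
  let ?B = "\<lambda>v. G (v + X v) + (Z v + Y (v + X v) + 2 * X v + 10)"
  let ?T = "\<lambda>v. F v + (2 + (2 + (X v * (?B v + X v + 1) + 1)))"
  show ?thesis
  proof (rule exI, rule compiledI)
    show "poly_bounded ?T"
      by (intro poly_bounded_add poly_bounded_mult poly_bounded_const F X Y Z poly_bounded_id
          poly_bounded_comp[where F = G, OF G] poly_bounded_comp[where F = Y, OF Y(1,2)])
    show "mono ?T"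
      by (intro mono_plus mono_times mono_id mono_const F X Y Z mono_comp[where F = G, OF G(2)]
          mono_comp[where F = Y, OF Y(2)])
    fix A rs e R M v
    assume *: "reads_matrix A R M" "R 0 \<le> v" "0 < e" "\<And>r. r \<in> set rs \<Longrightarrow> r < e"
      "\<And>r. r \<in> set rs \<Longrightarrow> R r \<le> v"
    define g where "g i = ev A f (i # map R rs)" for i
    define n0 where "n0 = ev A h (map R rs)"
    have n0: "n0 \<le> X v"
      unfolding n0_def using * reads_matrix_le by (auto intro!: X(3))
    have g_le: "g i \<le> Y (v + X v)" if "i < n0" for i
      unfolding g_def
    proof (rule Y(3))
      show "x \<le> v + X v" if "x \<in> set (i # map R rs)" for x
        using that \<open>i < n0\<close> n0 *(5) by (auto intro: trans_le_add1)
    qed (use * reads_matrix_le in auto)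
    have sum_le: "sum g {..<i} \<le> Z v" if "i \<le> n0" for i
    proof -
      have "sum g {..<i} \<le> sum g {..<n0}" using that by (intro sum_mono2) auto
      also have "\<dots> = ev A (ESum h f) (map R rs)" by (simp add: g_def n0_def)
      also have "\<dots> \<le> Z v" using * reads_matrix_le by (intro Z(3)) auto
      finally show ?thesis .
    qed
    obtain R1 where R1: "run (compile h rs (e + 2)) (R, M) (F v) (R1, M)"
      "R1 (e + 2) = n0" "\<And>r. r < e + 2 \<Longrightarrow> R1 r = R r"
      unfolding n0_def
      by (rule compiledD[OF h *(1,2), of "e + 2" rs]) (use * in \<open>auto simp: less_SucI\<close>)
    let ?R2 = "R1(e := 0)" let ?R3 = "?R2(e + 1 := 0)"
    have s2: "run (Const e 0) (R1, M) 2 (?R2, M)" "run (Const (e + 1) 0) (?R2, M) 2 (?R3, M)"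
      using run_Const[of e 0 R1 M] run_Const[of "e + 1" 0 ?R2 M] bits_le_Suc[of 0]
      by (auto intro: run_mono)
    define I where "I i s \<longleftrightarrow> i \<le> n0 \<and> snd s = M \<and> fst s e = sum g {..<n0 - i} \<and> fst s (e + 1) = n0 - i \<and>
      fst s (e + 2) = i \<and> (\<forall>r<e. fst s r = R r)" for i s
    define body where "body = Seq (compile f ((e + 1) # rs) (e + 3))
         (Seq (Arith e Add e (e + 3))
         (Seq (Const (e + 3) 1)
         (Seq (Arith (e + 1) Add (e + 1) (e + 3))
              (Arith (e + 2) Sub (e + 2) (e + 3)))))"
    have "\<exists>s'. run (While (e + 2) body) (?R3, M) (n0 * (?B v + n0 + 1) + 1) s' \<and> I 0 s'"
    proof (rule run_countdown[where I = I])
      show "I n0 (?R3, M)" unfolding I_def using R1 by simp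
      show "fst s (e + 2) = i" if "I i s" for i s using that unfolding I_def by simp
      fix i s
      assume I: "I (Suc i) s" and i: "i < n0"
      obtain Q where s: "s = (Q, M)" using I unfolding I_def by (cases s) auto
      let ?k = "n0 - Suc i"
      have Q: "Q e = sum g {..<?k}" "Q (e + 1) = ?k" "Q (e + 2) = Suc i" "\<And>r. r < e \<Longrightarrow> Q r = R r"
        using I unfolding I_def s by auto
      have eq: "map Q rs = map R rs" using Q * by simp
      obtain Q0 where Q0: "run (compile f ((e + 1) # rs) (e + 3)) (Q, M) (G (v + X v)) (Q0, M)"
        "Q0 (e + 3) = g ?k" "\<And>r. r < e + 3 \<Longrightarrow> Q0 r = Q r"
      proof (rule compiledD[OF f, of A Q M "v + X v" "e + 3" "(e + 1) # rs"])
        show "reads_matrix A Q M" using * Q by (auto intro: reads_matrix_cong)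
        show "Q r \<le> v + X v" if "r \<in> set ((e + 1) # rs)" for r
          using that Q * n0 by (auto intro: trans_le_add1)
        fix Q0
        assume "run (compile f ((e + 1) # rs) (e + 3)) (Q, M) (G (v + X v)) (Q0, M)"
          "Q0 (e + 3) = ev A f (map Q ((e + 1) # rs))" "\<And>r. r < e + 3 \<Longrightarrow> Q0 r = Q r"
        then show thesis using that Q eq by (simp add: g_def)
      qed (use * Q in \<open>auto intro: trans_less_add1\<close>)
      let ?Q1 = "Q0(e := sum g {..<Suc ?k})" let ?Q2 = "?Q1(e + 3 := 1)"
      let ?Q3 = "?Q2(e + 1 := Suc ?k)" let ?Q4 = "?Q3(e + 2 := i)"
      have v: "sum g {..<?k} \<le> Z v" "g ?k \<le> Y (v + X v)" using sum_le g_le i by auto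
      have 1: "run (Arith e Add e (e + 3)) (Q0, M) (Z v + 1 + Y (v + X v) + 1) (?Q1, M)"
        using run_Arith[of e Add e "e + 3" Q0 M] Q Q0 bits_le_Suc[of "sum g {..<?k}"]
          bits_le_Suc[of "g ?k"] v
        by (auto intro: run_mono)
      have 2: "run (Const (e + 3) 1) (?Q1, M) 2 (?Q2, M)"
        using run_Const[of "e + 3" 1 ?Q1 M] bits_le_Suc[of 1] by (auto intro: run_mono)
      have 3: "run (Arith (e + 1) Add (e + 1) (e + 3)) (?Q2, M) (X v + 1 + 2) (?Q3, M)"
        using run_Arith[of "e + 1" Add "e + 1" "e + 3" ?Q2 M] Q Q0 bits_le_Suc[of ?k]
          bits_le_Suc[of 1] n0 i by (auto intro: run_mono)
      have 4: "run (Arith (e + 2) Sub (e + 2) (e + 3)) (?Q3, M) (X v + 1 + 2) (?Q4, M)"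
        using run_Arith[of "e + 2" Sub "e + 2" "e + 3" ?Q3 M] Q Q0 bits_le_Suc[of "Suc i"]
          bits_le_Suc[of 1] n0 i by (auto intro: run_mono)
      have "run body s (?B v) (?Q4, M)"
        unfolding body_def s
        by (rule run_mono[OF run_Seq[OF Q0(1) run_Seq[OF 1 run_Seq[OF 2 run_Seq[OF 3 4]]]]]) auto
      moreover have "I i (?Q4, M)"
        using Q Q0 i unfolding I_def by (auto simp: Suc_diff_Suc)
      ultimately show "\<exists>s'. run body s (?B v) s' \<and> I i s'" by blast
    qed
    then obtain R4 where R4: "run (While (e + 2) body) (?R3, M) (n0 * (?B v + n0 + 1) + 1) (R4, M)"
      "I 0 (R4, M)" unfolding I_def by auto
    have "run (While (e + 2) body) (?R3, M) (X v * (?B v + X v + 1) + 1) (R4, M)"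
      by (rule run_mono[OF R4(1)]) (use n0 in \<open>auto intro!: mult_le_mono\<close>)
    then have "run (compile (ESum h f) rs e) (R, M) (?T v) (R4, M)"
      unfolding compile.simps body_def by (intro run_Seq[OF R1(1) run_Seq[OF s2(1) run_Seq[OF s2(2)]]])
    then show "\<exists>R'. run (compile (ESum h f) rs e) (R, M) (?T v) (R', M) \<and>
              R' e = ev A (ESum h f) (map R rs) \<and> (\<forall>r<e. R' r = R r)"
      using R4(2) by (intro exI[of _ R4]) (auto simp: I_def g_def n0_def)
  qed
qed

definition compileds :: "expr list \<Rightarrow> (nat \<Rightarrow> nat) \<Rightarrow> bool" where
  "compileds gs F \<longleftrightarrow> poly_bounded F \<and> mono F \<and>
     (\<forall>A rs e R M v. reads_matrix A R M \<longrightarrow> R 0 \<le> v \<longrightarrow> 0 < e \<longrightarrow>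
        (\<forall>r\<in>set rs. r < e \<and> R r \<le> v) \<longrightarrow>
        (\<exists>R'. run (compiles gs rs e) (R, M) (F v) (R', M) \<and>
              (\<forall>i<length gs. R' (e + i) = ev A (gs ! i) (map R rs)) \<and> (\<forall>r<e. R' r = R r)))"

lemma compiledsD:
  assumes "compileds gs F" "reads_matrix A R M" "R 0 \<le> v" "0 < e" "\<And>r. r \<in> set rs \<Longrightarrow> r < e"
    "\<And>r. r \<in> set rs \<Longrightarrow> R r \<le> v"
  obtains R' where "run (compiles gs rs e) (R, M) (F v) (R', M)"
    "\<And>i. i < length gs \<Longrightarrow> R' (e + i) = ev A (gs ! i) (map R rs)" "\<And>r. r < e \<Longrightarrow> R' r = R r"
proof -
  have "\<forall>r\<in>set rs. r < e \<and> R r \<le> v" using assms by blast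
  then show thesis using assms(1-4) that unfolding compileds_def by blast
qed

lemma compiles_correct:
  assumes "\<And>g. g \<in> set gs \<Longrightarrow> \<exists>F. compiled g F"
  shows "\<exists>F. compileds gs F"
  using assms
proof (induction gs)
  case Nil
  have "run Skip s 1 s" for s unfolding run_def using Skip by blast
  then have "compileds [] (\<lambda>v. 1)"
    unfolding compileds_def by (intro conjI poly_bounded_const mono_const) auto
  then show ?case by blast
next
  case (Cons g gs)
  obtain F where F: "compiled g F" using Cons.prems by force
  obtain G where G: "compileds gs G" using Cons.IH Cons.prems by force
  have "compileds (g # gs) (\<lambda>v. F v + G v)"
    unfolding compileds_def
  proof (intro conjI allI impI)
    show "poly_bounded (\<lambda>v. F v + G v)" "mono (\<lambda>v. F v + G v)"
      using F G unfolding compiled_def compileds_def by (auto intro: poly_bounded_add mono_plus)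
    fix A rs e R M v
    assume *: "reads_matrix A R M" "R 0 \<le> v" "0 < e" "\<forall>r\<in>set rs. r < e \<and> R r \<le> v"
    obtain R1 where R1: "run (compile g rs e) (R, M) (F v) (R1, M)"
      "R1 e = ev A g (map R rs)" "\<And>r. r < e \<Longrightarrow> R1 r = R r"
      by (rule compiledD[OF F *(1-3)]) (use * in auto)
    have eq: "map R1 rs = map R rs" using * R1 by simp
    obtain R2 where R2: "run (compiles gs rs (Suc e)) (R1, M) (G v) (R2, M)"
      "\<And>i. i < length gs \<Longrightarrow> R2 (Suc e + i) = ev A (gs ! i) (map R1 rs)"
      "\<And>r. r < Suc e \<Longrightarrow> R2 r = R1 r"
    proof (rule compiledsD[OF G, of A R1 M v "Suc e" rs])
      show "reads_matrix A R1 M" using * R1 by (auto intro: reads_matrix_cong)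
    qed (use * R1 in \<open>auto simp: less_SucI\<close>)
    show "\<exists>R'. run (compiles (g # gs) rs e) (R, M) (F v + G v) (R', M) \<and>
      (\<forall>i<length (g # gs). R' (e + i) = ev A ((g # gs) ! i) (map R rs)) \<and> (\<forall>r<e. R' r = R r)"
    proof (intro exI[of _ R2] conjI allI impI)
      show "run (compiles (g # gs) rs e) (R, M) (F v + G v) (R2, M)"
        using run_Seq[OF R1(1) R2(1)] by simp
      show "R2 (e + i) = ev A ((g # gs) ! i) (map R rs)" if "i < length (g # gs)" for i
        using that R1 R2 eq by (cases i) auto
    qed (use R1 R2 in auto)
  qed
  then show ?case by blast
qed

lemma ev_bounds:
  obtains Y where "poly_bounded Y" "mono Y" "\<And>A xs v g. (\<And>a. A a \<le> 1) \<Longrightarrow>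
      (\<And>x. x \<in> set xs \<Longrightarrow> x \<le> v) \<Longrightarrow> g \<in> set gs \<Longrightarrow> ev A g xs \<le> Y v"
proof (induction gs arbitrary: thesis)
  case Nil
  show ?case by (rule Nil[OF poly_bounded_id mono_id]) simp
next
  case (Cons g gs)
  obtain Y where Y: "poly_bounded Y" "mono Y" "\<And>A xs v g. (\<And>a. A a \<le> 1) \<Longrightarrow>
      (\<And>x. x \<in> set xs \<Longrightarrow> x \<le> v) \<Longrightarrow> g \<in> set gs \<Longrightarrow> ev A g xs \<le> Y v"
    by (rule Cons.IH) blast
  obtain X where X: "poly_bounded X" "mono X"
    "\<And>A xs v. (\<And>a. A a \<le> 1) \<Longrightarrow> (\<And>y. y \<in> set xs \<Longrightarrow> y \<le> v) \<Longrightarrow> ev A g xs \<le> X v"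
    by (rule ev_boundE[where E = g]) blast
  show ?case
  proof (rule Cons.prems[OF poly_bounded_add[OF X(1) Y(1)] mono_plus[OF X(2) Y(2)]])
    fix A :: "nat \<Rightarrow> nat" and xs :: "nat list" and v h
    assume "\<And>a. A a \<le> 1" "\<And>x. x \<in> set xs \<Longrightarrow> x \<le> v" "h \<in> set (g # gs)"
    then show "ev A h xs \<le> X v + Y v"
      using X(3)[of A xs v] Y(3)[of A xs v h] by (auto intro: trans_le_add1 trans_le_add2)
  qed
qed

lemma compile_ECall:
  assumes f: "compiled f F" and gs: "\<And>g. g \<in> set gs \<Longrightarrow> \<exists>F. compiled g F"
  shows "\<exists>F. compiled (ECall f gs) F"
proof -
  obtain G where Gc: "compileds gs G"
    using compiles_correct[OF gs] by blast
  then have G: "poly_bounded G" "mono G" unfolding compileds_def by auto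
  obtain Y where Y: "poly_bounded Y" "mono Y" "\<And>A xs v g. (\<And>a. A a \<le> 1) \<Longrightarrow>
      (\<And>x. x \<in> set xs \<Longrightarrow> x \<le> v) \<Longrightarrow> g \<in> set gs \<Longrightarrow> ev A g xs \<le> Y v"
    by (rule ev_bounds[of gs]) blast
  obtain X where X: "poly_bounded X" "mono X"
    "\<And>A xs v. (\<And>a. A a \<le> 1) \<Longrightarrow> (\<And>y. y \<in> set xs \<Longrightarrow> y \<le> v) \<Longrightarrow> ev A f xs \<le> X v"
    by (rule ev_boundE[where E = f]) blast
  have F: "poly_bounded F" "mono F" using f unfolding compiled_def by auto
  \<comment> \<open>The time bound of \<open>f\<close> is taken at \<open>Y v + v\<close> and not at
    \<open>Y v\<close>, because it must also dominate register \<open>0\<close>.\<close>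
  let ?T = "\<lambda>v. G v + (F (Y v + v) + (2 + (X (Y v) + 3)))"
  show ?thesis
  proof (rule exI, rule compiledI)
    show "poly_bounded ?T"
      by (intro poly_bounded_add poly_bounded_const G(1,2) Y(1,2) poly_bounded_id
          poly_bounded_comp[where F = F, OF F] poly_bounded_comp[where F = X, OF X(1,2)])
    show "mono ?T"
      by (intro mono_plus mono_id mono_const G(1,2) Y(1,2) mono_comp[where F = F, OF F(2)]
          mono_comp[where F = X, OF X(2)])
    fix A rs e R M v
    assume *: "reads_matrix A R M" "R 0 \<le> v" "0 < e" "\<And>r. r \<in> set rs \<Longrightarrow> r < e"
      "\<And>r. r \<in> set rs \<Longrightarrow> R r \<le> v"
    let ?n = "length gs"
    let ?ys = "map (\<lambda>g. ev A g (map R rs)) gs"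
    have A: "\<And>a. A a \<le> 1" using *(1) reads_matrix_le by blast
    have ys: "y \<le> Y v" if "y \<in> set ?ys" for y
      using that Y(3)[of A "map R rs" v, OF A] *(5) by auto
    obtain R1 where R1: "run (compiles gs rs e) (R, M) (G v) (R1, M)"
      "\<And>i. i < ?n \<Longrightarrow> R1 (e + i) = ev A (gs ! i) (map R rs)" "\<And>r. r < e \<Longrightarrow> R1 r = R r"
      by (rule compiledsD[OF Gc *]) auto
    have eq: "map R1 [e..<e + ?n] = ?ys"
      using R1(2) by (intro nth_equalityI) auto
    obtain R2 where R2: "run (compile f [e..<e + ?n] (Suc (e + ?n))) (R1, M) (F (Y v + v)) (R2, M)"
      "R2 (Suc (e + ?n)) = ev A f ?ys" "\<And>r. r < Suc (e + ?n) \<Longrightarrow> R2 r = R1 r"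
    proof (rule compiledD[OF f, of A R1 M "Y v + v" "Suc (e + ?n)" "[e..<e + ?n]"])
      show "reads_matrix A R1 M" using * R1 by (auto intro: reads_matrix_cong)
      show "R1 r \<le> Y v + v" if "r \<in> set [e..<e + ?n]" for r
      proof -
        have "R1 r \<in> set (map R1 [e..<e + ?n])" using that by simp
        then show ?thesis unfolding eq using ys trans_le_add1 by blast
      qed
    qed (use * R1 eq in auto)
    let ?R3 = "R2(e := 0)" let ?R4 = "?R3(e := ev A f ?ys)"
    have 1: "run (Const e 0) (R2, M) 2 (?R3, M)"
      using run_Const[of e 0 R2 M] bits_le_Suc[of 0] by (auto intro: run_mono)
    have "ev A f ?ys \<le> X (Y v)" using A ys by (rule X(3))
    then have 2: "run (Arith e Add (Suc (e + ?n)) e) (?R3, M) (X (Y v) + 3) (?R4, M)"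
      using run_Arith[of e Add "Suc (e + ?n)" e ?R3 M] R2(2) bits_le_Suc[of "ev A f ?ys"]
        bits_le_Suc[of 0] by (auto intro: run_mono)
    have "run (compile (ECall f gs) rs e) (R, M) (?T v) (?R4, M)"
      unfolding compile.simps by (intro run_Seq[OF R1(1) run_Seq[OF R2(1) run_Seq[OF 1 2]]])
    then show "\<exists>R'. run (compile (ECall f gs) rs e) (R, M) (?T v) (R', M) \<and>
              R' e = ev A (ECall f gs) (map R rs) \<and> (\<forall>r<e. R' r = R r)"
      using R1 R2 by (intro exI[of _ ?R4]) auto
  qed
qed

lemma compile_correct: "\<exists>F. compiled E F"
proof (induction E)
  case (EVar i)
  then show ?case by (rule compile_EVar)
next
  case (ENum c)
  then show ?case by (rule compile_ENum)
next
  case (EBin f a b)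
  then show ?case using compile_EBin by blast
next
  case (ESum h f)
  then show ?case using compile_ESum by blast
next
  case (EShift x d n)
  then show ?case using compile_EShift by blast
next
  case (ERead a)
  then show ?case using compile_ERead by blast
next
  case (ECall f gs)
  then show ?case using compile_ECall by blast
qed

section \<open>Exact covers and counting\<close>

text \<open>
  A label belongs only to the sets of its own block, so an exact cover picks exactly one set per
  block; the singletons then cover the rest of \<open>Z\<close> in exactly one way.
\<close>

lemma card_labelled_exact_covers:
  fixes T :: "'j \<Rightarrow> 'e \<Rightarrow> 'a set"
  assumes label: "\<And>j e i. j \<in> J \<Longrightarrow> e \<in> G j \<Longrightarrow> i \<in> J \<Longrightarrow> lab i \<in> T j e \<longleftrightarrow> i = j"
    and labC: "lab ` J \<inter> Z = {}"
    and inj: "\<And>j. j \<in> J \<Longrightarrow> inj_on (T j) (G j)"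
    and sub: "\<And>j e. j \<in> J \<Longrightarrow> e \<in> G j \<Longrightarrow> T j e \<subseteq> C \<union> lab ` J \<union> Z"
    and CZ: "C \<inter> (lab ` J \<union> Z) = {}"
  shows "card (exact_covers (C \<union> lab ` J \<union> Z) ((\<Union>j\<in>J. T j ` G j) \<union> (\<lambda>z. {z}) ` Z)) =
    card {s \<in> PiE J G. (\<forall>i\<in>J. \<forall>j\<in>J. i \<noteq> j \<longrightarrow> T i (s i) \<inter> T j (s j) = {}) \<and>
                       C \<subseteq> (\<Union>j\<in>J. T j (s j))}"
    (is "card (exact_covers ?U ?F) = card ?S")
proof -
  define \<Phi> where "\<Phi> s = (\<lambda>j. T j (s j)) ` J \<union> (\<lambda>z. {z}) ` (Z - (\<Union>j\<in>J. T j (s j)))" for s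
  have mem: "s j \<in> G j" if "s \<in> ?S" "j \<in> J" for s j
    using that by auto
  have inj_\<Phi>: "inj_on \<Phi> ?S"
  proof (rule inj_onI)
    fix s s' assume s: "s \<in> ?S" and s': "s' \<in> ?S" and eq: "\<Phi> s = \<Phi> s'"
    show "s = s'"
    proof (rule PiE_ext)
      show "s \<in> PiE J G" "s' \<in> PiE J G" using s s' by auto
      fix j assume j: "j \<in> J"
      have "T j (s j) \<in> \<Phi> s'" using j eq unfolding \<Phi>_def by blast
      moreover have l: "lab j \<in> T j (s j)" using label j mem[OF s j] by blast
      moreover have "lab j \<notin> Z" using labC j by blast
      ultimately obtain i where i: "i \<in> J" "T j (s j) = T i (s' i)"
        unfolding \<Phi>_def by auto
      then have "i = j" using l label[OF i(1) mem[OF s' i(1)] j] by auto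
      then show "s j = s' j" using i inj[OF j] mem[OF s j] mem[OF s' j] by (auto dest: inj_onD)
    qed
  qed
  have into: "\<Phi> s \<in> exact_covers ?U ?F" if s: "s \<in> ?S" for s
  proof -
    have "\<Phi> s \<subseteq> ?F" using mem[OF s] unfolding \<Phi>_def by blast
    moreover have "disjoint (\<Phi> s)"
    proof (rule disjointI)
      fix X Y assume "X \<in> \<Phi> s" "Y \<in> \<Phi> s" "X \<noteq> Y"
      moreover have "T i (s i) \<inter> T j (s j) = {}" if "i \<in> J" "j \<in> J" "i \<noteq> j" for i j
        using s that by auto
      ultimately show "X \<inter> Y = {}"
        unfolding \<Phi>_def by (elim UnE imageE) (simp_all, metis+)
    qed
    moreover have "\<Union>(\<Phi> s) = ?U"
    proof
      show "\<Union>(\<Phi> s) \<subseteq> ?U" using sub mem[OF s] unfolding \<Phi>_def by blast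
      show "?U \<subseteq> \<Union>(\<Phi> s)"
      proof
        fix x assume "x \<in> ?U"
        then consider "x \<in> C" | j where "j \<in> J" "x = lab j" | "x \<in> Z" by blast
        then show "x \<in> \<Union>(\<Phi> s)"
        proof cases
          case 1
          then show ?thesis using s unfolding \<Phi>_def by blast
        next
          case 2
          then have "x \<in> T j (s j)" using label mem[OF s] by blast
          then show ?thesis using 2 unfolding \<Phi>_def by blast
        next
          case 3
          then show ?thesis unfolding \<Phi>_def by (cases "x \<in> (\<Union>j\<in>J. T j (s j))") auto
        qed
      qed
    qed
    ultimately show ?thesis unfolding exact_covers_def by blast
  qed
  have onto: "F' \<in> \<Phi> ` ?S" if F': "F' \<in> exact_covers ?U ?F" for F'
  proof -
    have F: "F' \<subseteq> ?F" and U: "\<Union>F' = ?U" and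
      disj: "\<And>X Y. X \<in> F' \<Longrightarrow> Y \<in> F' \<Longrightarrow> X \<noteq> Y \<Longrightarrow> X \<inter> Y = {}"
      using F' unfolding exact_covers_def disjoint_def by auto
    have "\<exists>e. e \<in> G j \<and> T j e \<in> F'" if j: "j \<in> J" for j
    proof -
      have "lab j \<in> \<Union>F'" unfolding U using j by blast
      then obtain X where X: "X \<in> F'" "lab j \<in> X" by blast
      have "lab j \<notin> Z" using labC j by blast
      then obtain i e where i: "i \<in> J" "e \<in> G i" "X = T i e" using X F by auto
      then have "i = j" using X label j by auto
      then show ?thesis using i X by auto
    qed
    then obtain s0 where s0: "\<And>j. j \<in> J \<Longrightarrow> s0 j \<in> G j \<and> T j (s0 j) \<in> F'" by metis
    define s where "s = restrict s0 J"
    have s: "s \<in> PiE J G" "\<And>j. j \<in> J \<Longrightarrow> s j \<in> G j" "\<And>j. j \<in> J \<Longrightarrow> T j (s j) \<in> F'"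
      unfolding s_def using s0 by auto
    have lab_s: "lab j \<in> T i (s i) \<longleftrightarrow> j = i" if "i \<in> J" "j \<in> J" for i j
      using label that s by blast
    \<comment> \<open>Two sets of block \<open>j\<close> share the label of \<open>j\<close>, so
      disjointness makes them equal.\<close>
    have uniq: "T j e = T j (s j)" if "j \<in> J" "e \<in> G j" "T j e \<in> F'" for j e
    proof (rule ccontr)
      assume "T j e \<noteq> T j (s j)"
      then have "T j e \<inter> T j (s j) = {}" using disj that s by blast
      then show False using label[OF that(1,2,1)] lab_s[OF that(1,1)] by auto
    qed
    have "s \<in> ?S"
    proof (rule CollectI, intro conjI ballI impI s(1))
      fix i j assume ij: "i \<in> J" "j \<in> J" "i \<noteq> j"
      have "T i (s i) \<noteq> T j (s j)" using lab_s ij by blast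
      then show "T i (s i) \<inter> T j (s j) = {}" using disj s ij by blast
    next
      show "C \<subseteq> (\<Union>j\<in>J. T j (s j))"
      proof
        fix x assume x: "x \<in> C"
        then have "x \<in> \<Union>F'" unfolding U by blast
        then obtain X where X: "X \<in> F'" "x \<in> X" by blast
        have "x \<notin> Z" using x CZ by blast
        then obtain j e where "j \<in> J" "e \<in> G j" "X = T j e" using X F by auto
        then show "x \<in> (\<Union>j\<in>J. T j (s j))" using uniq X by auto
      qed
    qed
    moreover have "F' = \<Phi> s"
    proof
      show "F' \<subseteq> \<Phi> s"
      proof
        fix X assume X: "X \<in> F'"
        then consider j e where "j \<in> J" "e \<in> G j" "X = T j e" | z where "z \<in> Z" "X = {z}"
          using F by blast
        then show "X \<in> \<Phi> s"
        proof cases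
          case 1
          then show ?thesis using uniq X unfolding \<Phi>_def by blast
        next
          case 2
          \<comment> \<open>A singleton meeting a chosen set would have to equal it, but the chosen
            set also contains a label, which lies outside \<open>Z\<close>.\<close>
          have "z \<notin> T j (s j)" if j: "j \<in> J" for j
          proof
            assume z: "z \<in> T j (s j)"
            have "lab j \<noteq> z" using labC 2 j by blast
            then have "X \<noteq> T j (s j)" using 2 lab_s[OF j j] by auto
            then show False using disj[OF X s(3)[OF j]] z 2 by auto
          qed
          then show ?thesis using 2 unfolding \<Phi>_def by blast
        qed
      qed
      show "\<Phi> s \<subseteq> F'"
      proof
        fix X assume "X \<in> \<Phi> s"
        then consider j where "j \<in> J" "X = T j (s j)" |
          z where "z \<in> Z" "z \<notin> (\<Union>j\<in>J. T j (s j))" "X = {z}"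
          unfolding \<Phi>_def by blast
        then show "X \<in> F'"
        proof cases
          case 1
          then show ?thesis using s by blast
        next
          case 2
          \<comment> \<open>An element of \<open>Z\<close> missed by the chosen sets still has to be
            covered, and only its own singleton can do that.\<close>
          then have "z \<in> \<Union>F'" unfolding U by blast
          then obtain Y where Y: "Y \<in> F'" "z \<in> Y" by blast
          then consider j e where "j \<in> J" "e \<in> G j" "Y = T j e" | z' where "z' \<in> Z" "Y = {z'}"
            using F by blast
          then show ?thesis
          proof cases
            case 1
            then have "z \<in> T j (s j)" using uniq Y by blast
            then show ?thesis using 2 1 by blast
          next
            case 2
            then show ?thesis using Y \<open>X = {z}\<close> by auto
          qed
        qed
      qed
    qed
    ultimately show ?thesis by blast
  qed
  have "bij_betw \<Phi> ?S (exact_covers ?U ?F)"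
    unfolding bij_betw_def using inj_\<Phi> into onto by blast
  then show ?thesis by (simp add: bij_betw_same_card)
qed

text \<open>Choices are grouped by their images, on which alone \<open>P\<close> depends. The count
  becomes a sum of products of class sizes, so it can be compared modulo a number by comparing class
  sizes only.\<close>

lemma card_PiE_by_image:
  fixes cl :: "'j \<Rightarrow> 'e \<Rightarrow> 'a set"
  assumes "finite J" and fin: "\<And>j. j \<in> J \<Longrightarrow> finite (G j)"
    and cl: "\<And>j e. j \<in> J \<Longrightarrow> e \<in> G j \<Longrightarrow> cl j e \<subseteq> C" and "finite C"
  shows "card {s \<in> PiE J G. P (\<lambda>j\<in>J. cl j (s j))} =
    (\<Sum>S | S \<in> PiE J (\<lambda>_. Pow C) \<and> P S. \<Prod>j\<in>J. card {e \<in> G j. cl j e = S j})"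
proof -
  let ?\<S> = "{S \<in> PiE J (\<lambda>_. Pow C). P S}"
  let ?B = "\<lambda>S. PiE J (\<lambda>j. {e \<in> G j. cl j e = S j})"
  have fin\<S>: "finite ?\<S>" using assms by (auto intro!: finite_PiE)
  have "{s \<in> PiE J G. P (\<lambda>j\<in>J. cl j (s j))} = (\<Union>S\<in>?\<S>. ?B S)"
  proof (intro equalityI subsetI)
    fix s assume s: "s \<in> {s \<in> PiE J G. P (\<lambda>j\<in>J. cl j (s j))}"
    let ?S = "\<lambda>j\<in>J. cl j (s j)"
    have "?S \<in> PiE J (\<lambda>_. Pow C)" using s cl by (auto intro!: PiE_I dest: PiE_mem)
    moreover have "s \<in> ?B ?S" using s by (auto simp: PiE_iff)
    moreover have "P ?S" using s by simp
    ultimately show "s \<in> (\<Union>S\<in>?\<S>. ?B S)" by (intro UN_I[of ?S]) simp_all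
  next
    fix s assume "s \<in> (\<Union>S\<in>?\<S>. ?B S)"
    then obtain S where "S \<in> ?\<S>" "s \<in> ?B S" by (elim UN_E)
    then have S: "S \<in> extensional J" "P S" and s: "s \<in> extensional J"
      "\<And>j. j \<in> J \<Longrightarrow> s j \<in> G j" "\<And>j. j \<in> J \<Longrightarrow> cl j (s j) = S j"
      by (simp_all add: PiE_iff)
    have "(\<lambda>j\<in>J. cl j (s j)) = S"
    proof
      show "(\<lambda>j\<in>J. cl j (s j)) j = S j" for j
        using S(1) s(3) by (cases "j \<in> J") (simp_all add: extensional_def)
    qed
    then show "s \<in> {s \<in> PiE J G. P (\<lambda>j\<in>J. cl j (s j))}"
      using S(2) s by (simp add: PiE_iff)
  qed
  also have "card \<dots> = (\<Sum>S\<in>?\<S>. card (?B S))"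
  proof (rule card_UN_disjoint[OF fin\<S>])
    show "\<forall>S\<in>?\<S>. finite (?B S)" using assms by (auto intro!: finite_PiE)
    show "\<forall>S\<in>?\<S>. \<forall>S'\<in>?\<S>. S \<noteq> S' \<longrightarrow> ?B S \<inter> ?B S' = {}"
    proof (intro ballI impI)
      fix S S' assume S: "S \<in> ?\<S>" "S' \<in> ?\<S>" "S \<noteq> S'"
      then have "S \<in> PiE J (\<lambda>_. Pow C)" "S' \<in> PiE J (\<lambda>_. Pow C)" by simp_all
      then have "\<not> (\<forall>j\<in>J. S j = S' j)" using S(3) PiE_ext by metis
      then obtain j where j: "j \<in> J" "S j \<noteq> S' j" by blast
      show "?B S \<inter> ?B S' = {}"
      proof (rule equals0I)
        fix s assume "s \<in> ?B S \<inter> ?B S'"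
        then have "s j \<in> {e \<in> G j. cl j e = S j}" "s j \<in> {e \<in> G j. cl j e = S' j}"
          using j by (auto dest: PiE_mem)
        then show False using j by auto
      qed
    qed
  qed
  also have "\<dots> = (\<Sum>S\<in>?\<S>. \<Prod>j\<in>J. card {e \<in> G j. cl j e = S j})"
    using assms(1) by (simp add: card_PiE)
  finally show ?thesis .
qed

text \<open>Counting smaller members is a bijection from \<open>C\<close> onto an initial segment of
  the naturals, so every \<open>w\<close> up to the size of \<open>C\<close> is the number of
  members with rank below \<open>w\<close>.\<close>

lemma card_below_rank:
  fixes C :: "nat set"
  assumes fin: "finite C" and w: "w \<le> card C"
  shows "card {e \<in> C. card {e' \<in> C. e' < e} < w} = w"
proof -
  let ?r = "\<lambda>e. card {e' \<in> C. e' < e}"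
  have less: "?r x < ?r y" if "x \<in> C" "y \<in> C" "x < y" for x y
    by (rule psubset_card_mono) (use that fin in auto)
  have inj: "inj_on ?r C"
  proof (rule inj_onI, rule ccontr)
    fix x y assume xy: "x \<in> C" "y \<in> C" "?r x = ?r y" "x \<noteq> y"
    then have "x < y \<or> y < x" by auto
    then show False using less[OF xy(1,2)] less[OF xy(2,1)] xy(3) by linarith
  qed
  have "?r ` C \<subseteq> {..<card C}"
  proof
    fix i assume "i \<in> ?r ` C"
    then obtain e where e: "e \<in> C" "i = ?r e" by blast
    have "?r e < card C" by (rule psubset_card_mono) (use e fin in auto)
    then show "i \<in> {..<card C}" using e by simp
  qed
  then have im: "?r ` C = {..<card C}"
    by (intro card_subset_eq) (simp_all add: card_image inj)
  have "?r ` {e \<in> C. ?r e < w} = {..<w}"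
  proof (intro equalityI subsetI)
    fix i assume "i \<in> {..<w}"
    then have "i \<in> ?r ` C" using im w by auto
    then show "i \<in> ?r ` {e \<in> C. ?r e < w}" using \<open>i \<in> {..<w}\<close> by auto
  qed auto
  moreover have "card (?r ` {e \<in> C. ?r e < w}) = card {e \<in> C. ?r e < w}"
    by (rule card_image, rule inj_on_subset[OF inj]) auto
  ultimately show ?thesis by simp
qed

section \<open>Digit expansions\<close>

lemma digits_unique:
  fixes D :: nat
  assumes "e < D ^ b" "e' < D ^ b" "\<And>i. i < b \<Longrightarrow> e div D ^ i mod D = e' div D ^ i mod D"
  shows "e = e'"
  using assms
proof (induction b arbitrary: e e')
  case (Suc b)
  have "0 < D" using Suc.prems(1) by (cases D) auto
  have "e div D = e' div D"
  proof (rule Suc.IH)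
    show "e div D < D ^ b" "e' div D < D ^ b"
      using Suc.prems(1,2) \<open>0 < D\<close> by (auto simp: less_mult_imp_div_less mult.commute)
    show "e div D div D ^ i mod D = e' div D div D ^ i mod D" if "i < b" for i
      using Suc.prems(3)[of "Suc i"] that by (simp add: div_mult2_eq)
  qed
  moreover have "e mod D = e' mod D" using Suc.prems(3)[of 0] by simp
  ultimately show ?case by (metis div_mult_mod_eq)
qed simp

lemma digits_exist:
  fixes D :: nat
  assumes "\<And>i. i < b \<Longrightarrow> f i < D"
  shows "\<exists>e<D ^ b. \<forall>i<b. e div D ^ i mod D = f i"
  using assms
proof (induction b arbitrary: f)
  case (Suc b)
  obtain e where e: "e < D ^ b" "\<forall>i<b. e div D ^ i mod D = f (Suc i)"
    using Suc.IH[of "\<lambda>i. f (Suc i)"] Suc.prems by auto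
  have f0: "f 0 < D" using Suc.prems by simp
  have "f 0 + D * e < D * Suc e" using f0 by simp
  also have "\<dots> \<le> D * D ^ b" using e(1) by (intro mult_le_mono) auto
  finally have "f 0 + D * e < D ^ Suc b" by simp
  moreover have "(f 0 + D * e) div D ^ i mod D = f i" if "i < Suc b" for i
    using that e f0 by (cases i) (auto simp: div_mult2_eq)
  ultimately show ?case by blast
qed simp

lemma bit_eq_imp_eq:
  fixes e e' :: nat
  assumes "e < 2 ^ m" "e' < 2 ^ m" "\<And>t. t < m \<Longrightarrow> e div 2 ^ t mod 2 = 1 \<longleftrightarrow> e' div 2 ^ t mod 2 = 1"
  shows "e = e'"
proof (rule digits_unique[OF assms(1,2)])
  show "e div 2 ^ i mod 2 = e' div 2 ^ i mod 2" if "i < m" for i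
    using assms(3)[OF that] by (metis mod2_eq_if)
qed

text \<open>
  The numbers \<open>D / ((n + 1) * (n choose k))\<close> form Leibniz's harmonic triangle scaled by \<open>D\<close>: each
  one with \<open>k > 0\<close> is the difference of two with smaller \<open>k\<close>, hence an integer.
\<close>

lemma leibniz_triangle_dvd:
  fixes D :: int
  assumes "\<And>j. 1 \<le> j \<Longrightarrow> j \<le> Suc n \<Longrightarrow> int j dvd D" "k \<le> n"
  shows "int (Suc n * (n choose k)) dvd D"
  using assms
proof (induction k arbitrary: n)
  case 0
  then show ?case by (metis binomial_n_0 le_refl mult.right_neutral le_add1 plus_1_eq_Suc)
next
  case (Suc k)
  then obtain n' where n: "n = Suc n'" by (cases n) auto
  let ?a = "int (Suc n * (n choose Suc k))"
  let ?b = "int (Suc n * (n choose k))"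
  let ?c = "int (Suc n' * (n' choose k))"
  have "?b dvd D" by (rule Suc.IH) (use Suc.prems in auto)
  then obtain y where y: "D = ?b * y" by blast
  have "?c dvd D" by (rule Suc.IH) (use Suc.prems n in auto)
  then obtain x where x: "D = ?c * x" by blast
  have abs: "Suc k * (n choose Suc k) = n * (n' choose k)"
    using Suc_times_binomial_eq[of n' k] unfolding n by (simp only: mult.commute)
  have r: "(n - k) * (n choose k) = n * (n' choose k)"
    using binomial_absorb_comp[of n k] n by simp
  have c: "?c = int (Suc k) * int (n choose Suc k)" "?c = int (n - k) * int (n choose k)"
  proof -
    have "?c = int (n * (n' choose k))" using n by simp
    then show "?c = int (Suc k) * int (n choose Suc k)" "?c = int (n - k) * int (n choose k)"
      using arg_cong[OF abs, of int] arg_cong[OF r, of int] by (simp_all only: of_nat_mult)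
  qed
  have pos: "0 < int (n choose k)" "0 < int (n choose Suc k)" using Suc.prems by auto
  have "?a * (x - y) = int (Suc n) * int (n choose Suc k) * x - int (Suc n) * int (n choose Suc k) * y"
    by (simp add: algebra_simps)
  \<comment> \<open>This is the recursion of the triangle, \<open>D / ?a = D / ?c - D / ?b\<close>,
    multiplied by \<open>Suc k\<close> so that no division occurs; both factorisations of
    \<open>?c\<close> enter.\<close>
  have "int (Suc k) * (?a * (x - y)) = int (Suc k) * D"
  proof -
    have "int (Suc k) * (?a * (x - y)) = int (Suc n) * (?c * x) - int (Suc n) * (?c * y)"
      unfolding c(1) by (simp add: algebra_simps)
    also have "int (Suc n) * (?c * y) = int (n - k) * (?b * y)"
      unfolding c(2) by (simp add: algebra_simps)
    also have "int (Suc n) * (?c * x) - int (n - k) * (?b * y) = int (Suc n) * D - int (n - k) * (?b * y)"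
      using x by simp
    also have "\<dots> = int (Suc n) * D - int (n - k) * D"
      unfolding y[symmetric] ..
    also have "\<dots> = int (Suc k) * D"
      using Suc.prems by (simp add: of_nat_diff algebra_simps)
    finally show ?thesis .
  qed
  then have "?a * (x - y) = D" by simp
  then show ?case by (metis dvd_triv_left)
qed

text \<open>A Chebyshev-type bound that does not mention primes:
  \<open>(2 * k + 1) * (2 * k choose k)\<close> divides \<open>D\<close>, and it is at least the row
  sum \<open>2 ^ (2 * k)\<close>, because the central binomial coefficient is the largest of the
  \<open>2 * k + 1\<close> entries of its row.\<close>

lemma four_power_le_common_multiple:
  fixes D :: nat
  assumes "\<And>j. 1 \<le> j \<Longrightarrow> j \<le> 2 * k + 1 \<Longrightarrow> j dvd D" "0 < D"
  shows "4 ^ k \<le> D"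
proof -
  have "int (Suc (2 * k) * (2 * k choose k)) dvd int D"
    by (rule leibniz_triangle_dvd) (use assms in auto)
  then have "Suc (2 * k) * (2 * k choose k) dvd D"
    by (simp only: of_nat_dvd_iff)
  then have "Suc (2 * k) * (2 * k choose k) \<le> D"
    using assms(2) by (rule dvd_imp_le)
  moreover have "4 ^ k \<le> Suc (2 * k) * (2 * k choose k)"
  proof -
    have "(4::nat) ^ k = 2 ^ (2 * k)" by (simp add: power_mult)
    also have "\<dots> = (\<Sum>i\<le>2 * k. 2 * k choose i)" by (rule choose_row_sum[symmetric])
    also have "\<dots> \<le> (\<Sum>i\<le>2 * k. 2 * k choose k)"
      by (intro sum_mono) (use binomial_maximum'[of k] in simp)
    also have "\<dots> = Suc (2 * k) * (2 * k choose k)" by simp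
    finally show ?thesis .
  qed
  ultimately show ?thesis by linarith
qed

section \<open>The exact cover instance\<close>

text \<open>The successor keeps it positive at \<open>n = 0\<close>, so that blocks are never of
  length \<open>0\<close>.\<close>

definition lg :: "nat \<Rightarrow> nat" where
  "lg n = Suc (floorlog 2 n)"

definition block :: "nat \<Rightarrow> nat \<Rightarrow> nat" where
  "block K n = K * lg n"

text \<open>The last block may be short or empty. An empty block has exactly one valid code,
  \<open>0\<close>, with no columns, so it does not affect the count of selections.\<close>

definition blocks :: "nat \<Rightarrow> nat \<Rightarrow> nat" where
  "blocks K n = Suc (n div block K n)"

text \<open>Enough bits for every number below \<open>moduli n\<close>, as
  \<open>2 * n * n + 3 \<le> 4 * (n * n + 1) \<le> 2 ^ (2 * lg n + 2)\<close>.\<close>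

definition extras :: "nat \<Rightarrow> nat" where
  "extras n = 2 * lg n + 2"

text \<open>This is \<open>2 * k + 1\<close> for \<open>k = n * n + 1\<close>: a positive common
  multiple of \<open>1\<close> up to it is at least \<open>4 ^ (n * n + 1)\<close>, which exceeds
  \<open>n!\<close>.\<close>

definition moduli :: "nat \<Rightarrow> nat" where
  "moduli n = 2 * n * n + 3"

definition ground :: "nat \<Rightarrow> nat \<Rightarrow> nat" where
  "ground K n = n + blocks K n + blocks K n * extras n"

definition codes :: "nat \<Rightarrow> nat \<Rightarrow> nat" where
  "codes K n = Suc n ^ block K n"

definition numbers :: "nat \<Rightarrow> nat \<Rightarrow> nat" where
  "numbers K n = blocks K n * codes K n + blocks K n * extras n"

definition digit :: "nat \<Rightarrow> nat \<Rightarrow> nat \<Rightarrow> nat" where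
  "digit n e i = e div Suc n ^ i mod Suc n"

definition hits :: "nat \<Rightarrow> nat \<Rightarrow> nat \<Rightarrow> nat \<Rightarrow> nat \<Rightarrow> bool" where
  "hits K n j e k \<longleftrightarrow> (\<exists>i<block K n. j * block K n + i < n \<and> digit n e i = k)"

text \<open>
  A code \<open>e\<close> is valid for block \<open>j\<close> if its digits in base \<open>n + 1\<close> assign distinct columns with
  nonzero entries to the rows of the block; digits without a row are \<open>0\<close>, so that codes are unique.
\<close>

definition valid :: "nat \<Rightarrow> (nat \<Rightarrow> nat) \<Rightarrow> nat \<Rightarrow> nat \<Rightarrow> nat \<Rightarrow> bool" where
  "valid K A n j e \<longleftrightarrow> (\<forall>i<block K n.
     if j * block K n + i < n
     then digit n e i < n \<and> A ((j * block K n + i) * n + digit n e i) \<noteq> 0 \<and>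
          (\<forall>i'<i. digit n e i' \<noteq> digit n e i)
     else digit n e i = 0)"

definition same :: "nat \<Rightarrow> nat \<Rightarrow> nat \<Rightarrow> nat \<Rightarrow> nat \<Rightarrow> bool" where
  "same K n j e e' \<longleftrightarrow> (\<forall>k<n. hits K n j e k = hits K n j e' k)"

definition rank :: "nat \<Rightarrow> (nat \<Rightarrow> nat) \<Rightarrow> nat \<Rightarrow> nat \<Rightarrow> nat \<Rightarrow> nat" where
  "rank K A n j e = card {e'. e' < e \<and> valid K A n j e' \<and> same K n j e e'}"

definition weight :: "nat \<Rightarrow> (nat \<Rightarrow> nat) \<Rightarrow> nat \<Rightarrow> nat \<Rightarrow> nat \<Rightarrow> nat" where
  "weight K A n j e = card {e'. e' < codes K n \<and> valid K A n j e' \<and> same K n j e e'}"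

text \<open>Among the valid codes with a given column set only the lowest-ranked survive, as many as
  the residue of their number. This replaces each weight by its residue, and the surviving ranks lie
  below \<open>M\<close>, so that the extra elements of one block can spell them in binary.\<close>

definition keep :: "nat \<Rightarrow> (nat \<Rightarrow> nat) \<Rightarrow> nat \<Rightarrow> nat \<Rightarrow> nat \<Rightarrow> nat \<Rightarrow> bool" where
  "keep K A n M j e \<longleftrightarrow> valid K A n j e \<and> rank K A n j e < weight K A n j e mod M"

text \<open>
  Set number \<open>x\<close> belongs to code \<open>x mod codes K n\<close> of block \<open>x div codes K n\<close>; the last
  \<open>blocks K n * extras n\<close> numbers stand for the singletons of the extra elements.
\<close>

definition good :: "nat \<Rightarrow> (nat \<Rightarrow> nat) \<Rightarrow> nat \<Rightarrow> nat \<Rightarrow> nat \<Rightarrow> bool" where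
  "good K A n M x \<longleftrightarrow>
     (x < blocks K n * codes K n \<longrightarrow> keep K A n M (x div codes K n) (x mod codes K n))"

definition belongs :: "nat \<Rightarrow> (nat \<Rightarrow> nat) \<Rightarrow> nat \<Rightarrow> nat \<Rightarrow> nat \<Rightarrow> bool" where
  "belongs K A n x y \<longleftrightarrow>
     (if x < blocks K n * codes K n then
        if y < n then hits K n (x div codes K n) (x mod codes K n) y
        else if y < n + blocks K n then y = n + x div codes K n
        else (y - n - blocks K n) div extras n = x div codes K n \<and>
             rank K A n (x div codes K n) (x mod codes K n)
               div 2 ^ ((y - n - blocks K n) mod extras n) mod 2 = 1
      else y = n + blocks K n + (x - blocks K n * codes K n))"

definition goods :: "nat \<Rightarrow> (nat \<Rightarrow> nat) \<Rightarrow> nat \<Rightarrow> nat \<Rightarrow> nat list" where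
  "goods K A n M = filter (good K A n M) [0..<numbers K n]"

definition family :: "nat \<Rightarrow> (nat \<Rightarrow> nat) \<Rightarrow> nat \<Rightarrow> nat \<Rightarrow> nat set list" where
  "family K A n M = map (\<lambda>x. {y. y < ground K n \<and> belongs K A n x y}) (goods K A n M)"

definition entry :: "nat \<Rightarrow> (nat \<Rightarrow> nat) \<Rightarrow> nat \<Rightarrow> nat \<Rightarrow> nat \<Rightarrow> nat" where
  "entry K A n M a =
     (if belongs K A n (goods K A n M ! (a div ground K n)) (a mod ground K n) then 1 else 0)"

section \<open>Expressions for logic and for the parameters and entries of the instance\<close>

definition eNot :: "expr \<Rightarrow> expr" where
  "eNot a = EBin Sub (ENum 1) a"

text \<open>Truth is being nonzero; the truncated difference \<open>1 - a\<close> negates, and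
  negating twice normalises to \<open>0\<close> or \<open>1\<close>.\<close>

definition ePos :: "expr \<Rightarrow> expr" where
  "ePos a = eNot (eNot a)"

definition eAnd :: "expr \<Rightarrow> expr \<Rightarrow> expr" where
  "eAnd a b = ePos (EBin Mul a b)"

definition eLess :: "expr \<Rightarrow> expr \<Rightarrow> expr" where
  "eLess a b = ePos (EBin Sub b a)"

definition eEq :: "expr \<Rightarrow> expr \<Rightarrow> expr" where
  "eEq a b = eNot (EBin Add (EBin Sub a b) (EBin Sub b a))"

definition eEx :: "expr \<Rightarrow> expr \<Rightarrow> expr" where
  "eEx h f = ePos (ESum h f)"

definition eAll :: "expr \<Rightarrow> expr \<Rightarrow> expr" where
  "eAll h f = eNot (ESum h (eNot f))"

definition eIf :: "expr \<Rightarrow> expr \<Rightarrow> expr \<Rightarrow> expr" where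
  "eIf c a b = EBin Add (EBin Mul (ePos c) a) (EBin Mul (eNot c) b)"

lemma indicator_nat [simp]:
  "((if P then 1 else 0 :: nat) = 0) = (\<not> P)" "(0 < (if P then 1 else 0 :: nat)) = P"
  "((if P then Suc 0 else 0) = 0) = (\<not> P)" "(0 < (if P then Suc 0 else 0)) = P"
  by auto

lemma ev_eNot [simp]: "ev A (eNot a) xs = (if ev A a xs = 0 then 1 else 0)"
  by (auto simp: eNot_def)

lemma ev_ePos [simp]: "ev A (ePos a) xs = (if ev A a xs \<noteq> 0 then 1 else 0)"
  by (simp add: ePos_def)

lemma ev_logic [simp]:
  "ev A (eAnd a b) xs = (if ev A a xs \<noteq> 0 \<and> ev A b xs \<noteq> 0 then 1 else 0)"
  "ev A (eLess a b) xs = (if ev A a xs < ev A b xs then 1 else 0)"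
  "ev A (eEq a b) xs = (if ev A a xs = ev A b xs then 1 else 0)"
  "ev A (eIf c a b) xs = (if ev A c xs \<noteq> 0 then ev A a xs else ev A b xs)"
  by (auto simp: eAnd_def eLess_def eEq_def eIf_def)

lemma ev_quantifiers [simp]:
  "ev A (eEx h f) xs = (if \<exists>i<ev A h xs. ev A f (i # xs) \<noteq> 0 then 1 else 0)"
  "ev A (eAll h f) xs = (if \<forall>i<ev A h xs. ev A f (i # xs) \<noteq> 0 then 1 else 0)"
  unfolding eEx_def eAll_def ev_eNot ev_ePos ev.simps sum_eq_0_iff[OF finite_lessThan] by auto

lemma sum_indicator: "(\<Sum>i<h. if P i then 1 else 0) = card {i. i < h \<and> P i}" for h :: nat
proof -
  have "(\<Sum>i<h. if P i then 1 else 0) = card ({..<h} \<inter> {i. P i})"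
    by (simp add: sum.If_cases)
  also have "{..<h} \<inter> {i. P i} = {i. i < h \<and> P i}" by auto
  finally show ?thesis .
qed

text \<open>The logarithm is a count of the \<open>i\<close> with \<open>2 ^ i \<le> n\<close>,
  tested by shifting \<open>n\<close> so that no power of \<open>2\<close> is formed.\<close>

definition lgE :: expr where
  "lgE = EBin Add (ENum 1) (ESum (EVar 0) (ePos (EShift (EVar 1) (ENum 2) (EVar 0))))"

definition blockE :: "nat \<Rightarrow> expr" where
  "blockE K = EBin Mul (ENum K) lgE"

definition blocksE :: "nat \<Rightarrow> expr" where
  "blocksE K = EBin Add (ENum 1) (EBin Div (EVar 0) (blockE K))"

definition extrasE :: expr where
  "extrasE = EBin Add (EBin Mul (ENum 2) lgE) (ENum 2)"

definition moduliE :: expr where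
  "moduliE = EBin Add (EBin Mul (EBin Mul (ENum 2) (EVar 0)) (EVar 0)) (ENum 3)"

definition groundE :: "nat \<Rightarrow> expr" where
  "groundE K = EBin Add (EBin Add (EVar 0) (blocksE K)) (EBin Mul (blocksE K) extrasE)"

text \<open>\<open>EVar 1\<close> stands for \<open>codes K n\<close>. That number is not polynomial
  in \<open>n\<close>, so no expression in \<open>n\<close> alone computes it; it is passed as an
  argument, and all bounds are polynomial in it as well.\<close>

definition numbersE :: "nat \<Rightarrow> expr" where
  "numbersE K = EBin Add (EBin Mul (blocksE K) (EVar 1)) (EBin Mul (blocksE K) extrasE)"

definition digitE :: expr where
  "digitE = EBin Mod (EShift (EVar 1) (EBin Add (ENum 1) (EVar 0)) (EVar 2))
                     (EBin Add (ENum 1) (EVar 0))"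

text \<open>Under the quantifier the arguments \<open>n\<close>, \<open>j\<close>, \<open>e\<close>,
  \<open>k\<close> have become \<open>EVar 1\<close> to \<open>EVar 4\<close>, while the bound
  \<open>blockE K\<close> is evaluated outside it and still finds \<open>n\<close> at
  \<open>EVar 0\<close>. The later expressions follow the same pattern.\<close>

definition hitsE :: "nat \<Rightarrow> expr" where
  "hitsE K = eEx (blockE K) (eAnd
     (eLess (EBin Add (EBin Mul (EVar 2) (ECall (blockE K) [EVar 1])) (EVar 0)) (EVar 1))
     (eEq (ECall digitE [EVar 1, EVar 3, EVar 0]) (EVar 4)))"

definition validE :: "nat \<Rightarrow> expr" where
  "validE K =
    (let row = EBin Add (EBin Mul (EVar 2) (ECall (blockE K) [EVar 1])) (EVar 0);
         dig = ECall digitE [EVar 1, EVar 3, EVar 0]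
     in eAll (blockE K) (eIf (eLess row (EVar 1))
          (eAnd (eLess dig (EVar 1))
          (eAnd (ERead (EBin Add (EBin Mul row (EVar 1)) dig))
                (eAll (EVar 0) (eNot (eEq (ECall digitE [EVar 2, EVar 4, EVar 0])
                                          (ECall digitE [EVar 2, EVar 4, EVar 1]))))))
          (eEq dig (ENum 0))))"

definition sameE :: "nat \<Rightarrow> expr" where
  "sameE K = eAll (EVar 0) (eEq (ECall (hitsE K) [EVar 1, EVar 2, EVar 3, EVar 0])
                                (ECall (hitsE K) [EVar 1, EVar 2, EVar 4, EVar 0]))"

definition rankE :: "nat \<Rightarrow> expr" where
  "rankE K = ESum (EVar 2) (eAnd (ECall (validE K) [EVar 1, EVar 2, EVar 0])
                                 (ECall (sameE K) [EVar 1, EVar 2, EVar 3, EVar 0]))"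

definition weightE :: "nat \<Rightarrow> expr" where
  "weightE K = ESum (EVar 1) (eAnd (ECall (validE K) [EVar 1, EVar 3, EVar 0])
                                   (ECall (sameE K) [EVar 1, EVar 3, EVar 4, EVar 0]))"

definition keepE :: "nat \<Rightarrow> expr" where
  "keepE K = eAnd (ECall (validE K) [EVar 0, EVar 3, EVar 4])
     (eLess (ECall (rankE K) [EVar 0, EVar 3, EVar 4])
            (EBin Mod (ECall (weightE K) [EVar 0, EVar 1, EVar 3, EVar 4]) (EVar 2)))"

definition goodE :: "nat \<Rightarrow> expr" where
  "goodE K = eIf (eLess (EVar 3) (EBin Mul (blocksE K) (EVar 1)))
     (ECall (keepE K) [EVar 0, EVar 1, EVar 2, EBin Div (EVar 3) (EVar 1), EBin Mod (EVar 3) (EVar 1)])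
     (ENum 1)"

definition belongsE :: "nat \<Rightarrow> expr" where
  "belongsE K =
    (let j = EBin Div (EVar 2) (EVar 1); e = EBin Mod (EVar 2) (EVar 1);
         z = EBin Sub (EBin Sub (EVar 3) (EVar 0)) (blocksE K)
     in eIf (eLess (EVar 2) (EBin Mul (blocksE K) (EVar 1)))
          (eIf (eLess (EVar 3) (EVar 0))
             (ECall (hitsE K) [EVar 0, j, e, EVar 3])
          (eIf (eLess (EVar 3) (EBin Add (EVar 0) (blocksE K)))
             (eEq (EVar 3) (EBin Add (EVar 0) j))
             (eAnd (eEq (EBin Div z extrasE) j)
                   (eEq (EBin Mod (EShift (ECall (rankE K) [EVar 0, j, e]) (ENum 2)
                                          (EBin Mod z extrasE)) (ENum 2)) (ENum 1)))))
          (eEq (EVar 3) (EBin Add (EBin Add (EVar 0) (blocksE K))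
                                  (EBin Sub (EVar 2) (EBin Mul (blocksE K) (EVar 1))))))"

definition countE :: "nat \<Rightarrow> expr" where
  "countE K = ESum (numbersE K) (ECall (goodE K) [EVar 1, EVar 2, EVar 3, EVar 0])"

definition belowE :: "nat \<Rightarrow> expr" where
  "belowE K = ESum (EVar 3) (ECall (goodE K) [EVar 1, EVar 2, EVar 3, EVar 0])"

text \<open>The list of good numbers is never stored: its entry at position \<open>k\<close> is the
  only good number with exactly \<open>k\<close> good predecessors, and the sum has just this one
  term.\<close>

definition nthE :: "nat \<Rightarrow> expr" where
  "nthE K = ESum (numbersE K) (eIf
     (eAnd (ECall (goodE K) [EVar 1, EVar 2, EVar 3, EVar 0])
           (eEq (ECall (belowE K) [EVar 1, EVar 2, EVar 3, EVar 0]) (EVar 4)))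
     (EVar 0) (ENum 0))"

definition entryE :: "nat \<Rightarrow> expr" where
  "entryE K = ECall (belongsE K) [EVar 0, EVar 1,
     ECall (nthE K) [EVar 0, EVar 1, EVar 2, EBin Div (EVar 3) (groundE K)],
     EBin Mod (EVar 3) (groundE K)]"

text \<open>\<open>2 ^ i \<le> n\<close> forces \<open>i < n\<close>, so cutting the count off at
  \<open>n\<close> loses nothing.\<close>

lemma floorlog_conv_card: "card {i. i < n \<and> n div 2 ^ i \<noteq> 0} = floorlog 2 n"
proof -
  have "{i. i < n \<and> n div 2 ^ i \<noteq> 0} = {..<floorlog 2 n}"
  proof (intro equalityI subsetI)
    fix i assume "i \<in> {i. i < n \<and> n div 2 ^ i \<noteq> 0}"
    then have "2 ^ i \<le> n" by (auto simp: div_eq_0_iff)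
    then show "i \<in> {..<floorlog 2 n}" using floorlog_ge_SucI[of 2 i n] by auto
  next
    fix i assume "i \<in> {..<floorlog 2 n}"
    then have "2 ^ i \<le> n" using floorlog_geD[of "Suc i" 2 n] by auto
    then have "i < n" "n div 2 ^ i \<noteq> 0"
      using less_le_trans[OF less_exp[of i]] by (auto simp: div_eq_0_iff)
    then show "i \<in> {i. i < n \<and> n div 2 ^ i \<noteq> 0}" by simp
  qed
  then show ?thesis by simp
qed

lemma ev_lgE: "ev A lgE (n # xs) = lg n"
  by (simp add: lgE_def lg_def sum_indicator floorlog_conv_card[simplified])

lemma ev_blockE: "ev A (blockE K) (n # xs) = block K n"
  by (simp add: blockE_def block_def ev_lgE)

lemma ev_blocksE: "ev A (blocksE K) (n # xs) = blocks K n"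
  by (simp add: blocksE_def blocks_def ev_blockE)

lemma ev_extrasE: "ev A extrasE (n # xs) = extras n"
  by (simp add: extrasE_def extras_def ev_lgE)

lemma ev_moduliE: "ev A moduliE (n # xs) = moduli n"
  by (simp add: moduliE_def moduli_def)

lemma ev_groundE: "ev A (groundE K) (n # xs) = ground K n"
  by (simp add: groundE_def ground_def ev_blocksE ev_extrasE)

lemma ev_numbersE: "ev A (numbersE K) (n # codes K n # xs) = numbers K n"
  by (simp add: numbersE_def numbers_def ev_blocksE ev_extrasE)

lemma ev_digitE: "ev A digitE [n, e, i] = digit n e i"
  by (simp add: digitE_def digit_def)

lemma ev_hitsE: "ev A (hitsE K) [n, j, e, k] = (if hits K n j e k then 1 else 0)"
  by (simp add: hitsE_def hits_def ev_blockE ev_digitE)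

lemma ev_validE: "ev A (validE K) [n, j, e] = (if valid K A n j e then 1 else 0)"
  unfolding validE_def valid_def Let_def
  by (simp add: ev_blockE ev_digitE if_distrib[of "\<lambda>x. x \<noteq> 0"] cong: if_cong)

lemma ev_sameE: "ev A (sameE K) [n, j, e, e'] = (if same K n j e e' then 1 else 0)"
  by (auto simp: sameE_def same_def ev_hitsE)

lemma ev_rankE: "ev A (rankE K) [n, j, e] = rank K A n j e"
  by (simp add: rankE_def rank_def ev_validE ev_sameE sum_indicator)

lemma ev_weightE: "ev A (weightE K) [n, codes K n, j, e] = weight K A n j e"
  by (simp add: weightE_def weight_def ev_validE ev_sameE sum_indicator)

lemma ev_keepE: "ev A (keepE K) [n, codes K n, M, j, e] = (if keep K A n M j e then 1 else 0)"
  by (simp add: keepE_def keep_def ev_validE ev_rankE ev_weightE)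

lemma ev_goodE: "ev A (goodE K) [n, codes K n, M, x] = (if good K A n M x then 1 else 0)"
  by (simp add: goodE_def good_def ev_blocksE ev_keepE)

lemma ev_belongsE: "ev A (belongsE K) [n, codes K n, x, y] = (if belongs K A n x y then 1 else 0)"
  by (simp add: belongsE_def belongs_def Let_def ev_blocksE ev_extrasE ev_hitsE ev_rankE)

lemma length_goods: "length (goods K A n M) = card {x. x < numbers K n \<and> good K A n M x}"
proof -
  have "length (goods K A n M) = card (set (goods K A n M))"
    by (subst distinct_card) (simp_all add: goods_def)
  also have "set (goods K A n M) = {x. x < numbers K n \<and> good K A n M x}"
    by (auto simp: goods_def)
  finally show ?thesis .
qed

lemma ev_countE: "ev A (countE K) [n, codes K n, M] = length (goods K A n M)"
  by (simp add: countE_def ev_numbersE ev_goodE sum_indicator length_goods)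

lemma ev_belowE: "ev A (belowE K) [n, codes K n, M, x] = card {x'. x' < x \<and> good K A n M x'}"
  by (simp add: belowE_def ev_goodE sum_indicator)

lemma filter_upt_nth_card:
  assumes "x < t" "P x"
  shows "filter P [0..<t] ! card {x'. x' < x \<and> P x'} = x"
proof -
  have "[0..<t] = [0..<x] @ x # [Suc x..<t]"
    using assms(1) upt_add_eq_append[of 0 x "t - x"] by (simp add: upt_conv_Cons)
  moreover have "card {x'. x' < x \<and> P x'} = length (filter P [0..<x])"
  proof -
    have "length (filter P [0..<x]) = card (set (filter P [0..<x]))"
      by (subst distinct_card) simp_all
    also have "set (filter P [0..<x]) = {x'. x' < x \<and> P x'}" by auto
    finally show ?thesis ..
  qed
  ultimately show ?thesis using assms(2) by (simp add: nth_append)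
qed

lemma ev_nthE:
  assumes "k < length (goods K A n M)"
  shows "ev A (nthE K) [n, codes K n, M, k] = goods K A n M ! k"
proof -
  let ?c = "\<lambda>x. card {x'. x' < x \<and> good K A n M x'}"
  let ?g = "goods K A n M ! k"
  have nth: "goods K A n M ! ?c x = x" if "x < numbers K n" "good K A n M x" for x
    using filter_upt_nth_card[OF that(1), of "good K A n M"] that(2) by (simp add: goods_def)
  have "?g \<in> set (goods K A n M)" using assms by simp
  then have g: "?g < numbers K n" "good K A n M ?g" by (auto simp: goods_def)
  have "?c ?g < length (goods K A n M)"
    unfolding length_goods by (rule psubset_card_mono) (use g in auto)
  then have "?c ?g = k"
    using nth[OF g] assms nth_eq_iff_index_eq[of "goods K A n M"] by (simp add: goods_def)
  then have iff: "good K A n M x \<and> ?c x = k \<longleftrightarrow> x = ?g" if "x < numbers K n" for x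
    using nth[OF that] g by auto
  have "ev A (nthE K) [n, codes K n, M, k] = (\<Sum>x<numbers K n. if good K A n M x \<and> ?c x = k then x else 0)"
    by (simp add: nthE_def ev_numbersE ev_goodE ev_belowE cong: if_cong)
  also have "\<dots> = (\<Sum>x<numbers K n. if x = ?g then ?g else 0)"
    by (rule sum.cong) (simp_all add: iff)
  also have "\<dots> = ?g" using g by simp
  finally show ?thesis .
qed

lemma ev_entryE:
  assumes "a < length (goods K A n M) * ground K n"
  shows "ev A (entryE K) [n, codes K n, M, a] = entry K A n M a"
  using less_mult_imp_div_less[OF assms]
  by (simp add: entryE_def entry_def ev_groundE ev_nthE ev_belongsE)

section \<open>Residues of block weights; selections of codes as permutations\<close>

definition matchings :: "(nat \<Rightarrow> nat) \<Rightarrow> nat \<Rightarrow> nat" where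
  "matchings A n = card {\<sigma>. \<sigma> permutes {..<n} \<and> (\<forall>r<n. A (r * n + \<sigma> r) \<noteq> 0)}"

definition columns :: "nat \<Rightarrow> nat \<Rightarrow> nat \<Rightarrow> nat \<Rightarrow> nat set" where
  "columns K n j e = {k. k < n \<and> hits K n j e k}"

definition is_partition :: "nat \<Rightarrow> nat \<Rightarrow> (nat \<Rightarrow> nat set) \<Rightarrow> bool" where
  "is_partition n q S \<longleftrightarrow>
     (\<forall>i\<in>{..<q}. \<forall>j\<in>{..<q}. i \<noteq> j \<longrightarrow> S i \<inter> S j = {}) \<and> {..<n} \<subseteq> (\<Union>j\<in>{..<q}. S j)"

lemma lg_pos: "0 < lg n"
  by (simp add: lg_def)

lemma less_two_power_lg: "n < 2 ^ lg n"
proof -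
  have "n < 2 ^ floorlog 2 n" by (rule floorlog_leD) auto
  also have "\<dots> \<le> 2 ^ lg n" by (simp add: lg_def)
  finally show ?thesis .
qed

lemma moduli_le: "moduli n \<le> 2 ^ extras n"
proof -
  have "n < 2 ^ lg n" by (rule less_two_power_lg)
  then have "n * n < 2 ^ lg n * 2 ^ lg n" by (intro mult_strict_mono) auto
  also have "\<dots> = 2 ^ (2 * lg n)" by (simp add: power_add[symmetric] mult_2)
  finally have "4 * (n * n + 1) \<le> 4 * 2 ^ (2 * lg n)" by simp
  then show ?thesis by (simp add: moduli_def extras_def)
qed

lemma same_iff: "same K n j e e' \<longleftrightarrow> columns K n j e' = columns K n j e"
  by (auto simp: same_def columns_def)

text \<open>Inside one class the rank is the position in increasing order and the weight is the size
  of the class, so the kept codes form an initial segment of it.\<close>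

lemma card_keep_class:
  "card {e \<in> {e. e < codes K n \<and> keep K A n M j e}. columns K n j e = S} =
   card {e \<in> {e. e < codes K n \<and> valid K A n j e}. columns K n j e = S} mod M"
  (is "card ?L = card ?C mod M")
proof -
  have fin: "finite ?C" by simp
  have r: "rank K A n j e = card {e' \<in> ?C. e' < e}" "weight K A n j e = card ?C" if "e \<in> ?C" for e
  proof -
    have "{e'. e' < e \<and> valid K A n j e' \<and> same K n j e e'} = {e' \<in> ?C. e' < e}"
      using that by (auto simp: same_iff)
    then show "rank K A n j e = card {e' \<in> ?C. e' < e}" by (simp add: rank_def)
    have "{e'. e' < codes K n \<and> valid K A n j e' \<and> same K n j e e'} = ?C"
      using that by (auto simp: same_iff)
    then show "weight K A n j e = card ?C" by (simp add: weight_def)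
  qed
  have eq: "?L = {e \<in> ?C. card {e' \<in> ?C. e' < e} < card ?C mod M}"
  proof (rule Set.set_eqI)
    fix e
    show "e \<in> ?L \<longleftrightarrow> e \<in> {e \<in> ?C. card {e' \<in> ?C. e' < e} < card ?C mod M}"
      using r[of e] by (cases "e \<in> ?C") (auto simp: keep_def)
  qed
  show ?thesis unfolding eq by (rule card_below_rank[OF fin]) simp
qed

text \<open>The smaller code is itself counted in the rank of the larger one. Hence ranks tell apart
  the codes with equal column sets.\<close>

lemma rank_less:
  assumes "valid K A n j e" "columns K n j e = columns K n j e'" "e < e'"
  shows "rank K A n j e < rank K A n j e'"
  unfolding rank_def
proof (rule psubset_card_mono)
  show "{e''. e'' < e \<and> valid K A n j e'' \<and> same K n j e e''} \<subset>
        {e''. e'' < e' \<and> valid K A n j e'' \<and> same K n j e' e''}"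
    using assms by (auto simp: same_iff)
qed simp

text \<open>Both counts are the same sum of products of class sizes, and sums and products respect
  congruence.\<close>

lemma card_partitions_mod:
  assumes "finite J" "\<And>j. j \<in> J \<Longrightarrow> finite (E j)" "\<And>j e. j \<in> J \<Longrightarrow> e \<in> E j \<Longrightarrow> cl j e \<subseteq> C" "finite C"
    and "\<And>j. j \<in> J \<Longrightarrow> G j \<subseteq> E j"
    and "\<And>j S. j \<in> J \<Longrightarrow> card {e \<in> G j. cl j e = S} = card {e \<in> E j. cl j e = S} mod M"
  shows "card {s \<in> PiE J G. P (\<lambda>j\<in>J. cl j (s j))} mod M =
         card {s \<in> PiE J E. P (\<lambda>j\<in>J. cl j (s j))} mod M"
proof -
  let ?\<S> = "{S. S \<in> PiE J (\<lambda>_. Pow C) \<and> P S}"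
  have "card {s \<in> PiE J G. P (\<lambda>j\<in>J. cl j (s j))} =
     (\<Sum>S\<in>?\<S>. \<Prod>j\<in>J. card {e \<in> G j. cl j e = S j})"
  proof (rule card_PiE_by_image[OF assms(1) _ _ assms(4)])
    show "finite (G j)" if "j \<in> J" for j using assms(2,5) that finite_subset by blast
    show "cl j e \<subseteq> C" if "j \<in> J" "e \<in> G j" for j e using assms(3,5) that by blast
  qed
  moreover have "card {s \<in> PiE J E. P (\<lambda>j\<in>J. cl j (s j))} =
     (\<Sum>S\<in>?\<S>. \<Prod>j\<in>J. card {e \<in> E j. cl j e = S j})"
    by (rule card_PiE_by_image[OF assms(1) _ _ assms(4)]) (use assms(2,3) in auto)
  moreover have "(\<Prod>j\<in>J. card {e \<in> G j. cl j e = S j}) mod M =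
      (\<Prod>j\<in>J. card {e \<in> E j. cl j e = S j}) mod M" for S
  proof -
    have "(\<Prod>j\<in>J. card {e \<in> G j. cl j e = S j}) = (\<Prod>j\<in>J. card {e \<in> E j. cl j e = S j} mod M)"
      by (rule prod.cong) (simp_all add: assms(6))
    then show ?thesis by (simp add: mod_prod_eq)
  qed
  then have "(\<Sum>S\<in>?\<S>. \<Prod>j\<in>J. card {e \<in> G j. cl j e = S j}) mod M =
      (\<Sum>S\<in>?\<S>. \<Prod>j\<in>J. card {e \<in> E j. cl j e = S j}) mod M"
    using mod_sum_eq[of "\<lambda>S. \<Prod>j\<in>J. card {e \<in> G j. cl j e = S j}" M ?\<S>]
      mod_sum_eq[of "\<lambda>S. \<Prod>j\<in>J. card {e \<in> E j. cl j e = S j}" M ?\<S>] by simp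
  ultimately show ?thesis by simp
qed

locale instance_params =
  fixes K n :: nat and A :: "nat \<Rightarrow> nat"
  assumes K: "1 \<le> K"
begin

abbreviation "q \<equiv> blocks K n"
abbreviation "b \<equiv> block K n"
abbreviation "m \<equiv> extras n"
abbreviation "u \<equiv> ground K n"
abbreviation "Q \<equiv> codes K n"

lemma b_pos: "0 < b"
  using K lg_pos by (simp add: block_def)

lemma Q_pos: "0 < Q"
  by (simp add: codes_def)

lemma row_block: "r < n \<Longrightarrow> r div b < q \<and> r mod b < b \<and> r div b * b + r mod b = r"
proof (intro conjI)
  assume "r < n"
  then show "r div b < q" using div_le_mono[of r n b] unfolding blocks_def by linarith
  show "r mod b < b" by (rule mod_less_divisor) (rule b_pos)
qed (rule div_mult_mod_eq)

lemma code_split: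
  assumes "j < q" "e < Q"
  shows "j * Q + e < q * Q" "(j * Q + e) div Q = j" "(j * Q + e) mod Q = e"
proof -
  have "j * Q + e < Suc j * Q" using assms by simp
  also have "\<dots> \<le> q * Q" using assms by (intro mult_le_mono1) simp
  finally show "j * Q + e < q * Q" .
qed (use assms in auto)

lemma code_unsplit:
  assumes "x < q * Q"
  shows "x div Q < q" "x mod Q < Q" "x div Q * Q + x mod Q = x"
  using less_mult_imp_div_less[OF assms] mod_less_divisor[OF Q_pos] div_mult_mod_eq by blast+

lemma valid_digit:
  assumes "valid K A n j e" "i < b" "j * b + i < n"
  shows "digit n e i < n" "A ((j * b + i) * n + digit n e i) \<noteq> 0" "hits K n j e (digit n e i)"
    "\<And>i'. i' < i \<Longrightarrow> digit n e i' \<noteq> digit n e i"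
  using assms unfolding valid_def hits_def by auto

lemma code_eqI:
  assumes "e < Q" "e' < Q" "valid K A n j e" "valid K A n j e'"
    "\<And>i. i < b \<Longrightarrow> j * b + i < n \<Longrightarrow> digit n e i = digit n e' i"
  shows "e = e'"
proof (rule digits_unique)
  show "e < Suc n ^ b" "e' < Suc n ^ b" using assms by (simp_all add: codes_def)
  fix i assume i: "i < b"
  have "digit n e i = digit n e' i"
  proof (cases "j * b + i < n")
    case True
    then show ?thesis using assms i by blast
  next
    case False
    then show ?thesis using assms(3,4) i unfolding valid_def by auto
  qed
  then show "e div Suc n ^ i mod Suc n = e' div Suc n ^ i mod Suc n"
    by (simp add: digit_def)
qed

definition selections :: "(nat \<Rightarrow> nat) set" where
  "selections = {s \<in> PiE {..<q} (\<lambda>j. {e. e < Q \<and> valid K A n j e}).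
     is_partition n q (\<lambda>j\<in>{..<q}. columns K n j (s j))}"

definition to_perm :: "(nat \<Rightarrow> nat) \<Rightarrow> nat \<Rightarrow> nat" where
  "to_perm s r = (if r < n then digit n (s (r div b)) (r mod b) else r)"

lemma selectionsD:
  assumes "s \<in> selections" "j < q"
  shows "s j < Q" "valid K A n j (s j)"
    "\<And>i. i < q \<Longrightarrow> i \<noteq> j \<Longrightarrow> columns K n i (s i) \<inter> columns K n j (s j) = {}"
  using assms by (auto simp: selections_def PiE_iff is_partition_def)

lemma to_perm_row:
  assumes "s \<in> selections" "r < n"
  shows "to_perm s r < n" "A (r * n + to_perm s r) \<noteq> 0" "to_perm s r \<in> columns K n (r div b) (s (r div b))"
proof -
  note r = row_block[OF assms(2)]
  have "r div b * b + r mod b < n" using r assms by metis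
  then have v: "digit n (s (r div b)) (r mod b) < n"
    "A ((r div b * b + r mod b) * n + digit n (s (r div b)) (r mod b)) \<noteq> 0"
    "hits K n (r div b) (s (r div b)) (digit n (s (r div b)) (r mod b))"
    using valid_digit(1-3)[OF selectionsD(2)[OF assms(1)]] r by blast+
  then show "to_perm s r < n" "to_perm s r \<in> columns K n (r div b) (s (r div b))"
    using assms(2) by (auto simp: to_perm_def columns_def)
  show "A (r * n + to_perm s r) \<noteq> 0"
    using v(2) r assms(2) by (metis to_perm_def)
qed

text \<open>Rows of different blocks get different columns because the column sets of a selection
  are disjoint; rows of one block do because the digits of a valid code are distinct.\<close>

lemma to_perm_inj:
  assumes s: "s \<in> selections" and r: "r < n" "r' < n" and eq: "to_perm s r = to_perm s r'"
  shows "r = r'"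
proof -
  note R = row_block[OF r(1)] row_block[OF r(2)]
  have j: "r div b = r' div b"
  proof (rule ccontr)
    assume "r div b \<noteq> r' div b"
    then have "columns K n (r div b) (s (r div b)) \<inter> columns K n (r' div b) (s (r' div b)) = {}"
      using selectionsD(3)[OF s] R by blast
    then show False using to_perm_row(3)[OF s] r eq by fastforce
  qed
  have neq: "to_perm s t \<noteq> to_perm s t'"
    if "t < n" "t' < n" "t div b = t' div b" "t mod b < t' mod b" for t t'
  proof -
    note t = row_block[OF that(1)] row_block[OF that(2)]
    have "t' div b * b + t' mod b < n" using t that by metis
    then have "digit n (s (t' div b)) (t mod b) \<noteq> digit n (s (t' div b)) (t' mod b)"
      using valid_digit(4)[OF selectionsD(2)[OF s]] t that by blast
    then show ?thesis using that by (simp add: to_perm_def)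
  qed
  have "r mod b = r' mod b"
  proof (rule ccontr)
    assume "r mod b \<noteq> r' mod b"
    then have "r mod b < r' mod b \<or> r' mod b < r mod b" by linarith
    then show False using neq[of r r'] neq[of r' r] j r eq by auto
  qed
  then show ?thesis using j R by metis
qed

lemma to_perm_permutes:
  assumes "s \<in> selections"
  shows "to_perm s permutes {..<n}"
proof (rule bij_imp_permutes)
  have "inj_on (to_perm s) {..<n}"
    using to_perm_inj[OF assms] by (auto intro: inj_onI)
  moreover have "to_perm s ` {..<n} \<subseteq> {..<n}" using to_perm_row[OF assms] by auto
  ultimately show "bij_betw (to_perm s) {..<n} {..<n}"
    by (simp add: bij_betw_def endo_inj_surj)
qed (simp add: to_perm_def)

lemma from_perm:
  assumes \<sigma>: "\<sigma> permutes {..<n}" and A: "\<forall>r<n. A (r * n + \<sigma> r) \<noteq> 0"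
  shows "\<exists>s\<in>selections. to_perm s = \<sigma>"
proof -
  have lt: "\<sigma> r < n" if "r < n" for r using permutes_in_image[OF \<sigma>] that by auto
  have inj: "r = r'" if "\<sigma> r = \<sigma> r'" for r r' using permutes_inj[OF \<sigma>] that by (auto dest: injD)
  \<comment> \<open>The code of a block lists the images of its rows; the digit \<open>0\<close> at
    positions without a row is the one that \<open>valid\<close> prescribes.\<close>
  have "\<exists>e<Suc n ^ b. \<forall>i<b. e div Suc n ^ i mod Suc n = (if j * b + i < n then \<sigma> (j * b + i) else 0)" for j
    by (rule digits_exist) (use lt in \<open>auto intro: less_SucI\<close>)
  then have "\<exists>e. \<forall>j. e j < Q \<and> (\<forall>i<b. digit n (e j) i = (if j * b + i < n then \<sigma> (j * b + i) else 0))"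
    unfolding codes_def digit_def by (intro choice) blast
  then obtain e where e: "\<And>j. e j < Q"
    "\<And>j i. i < b \<Longrightarrow> digit n (e j) i = (if j * b + i < n then \<sigma> (j * b + i) else 0)" by blast
  define s where "s = restrict e {..<q}"
  have s: "s j = e j" if "j < q" for j using that by (simp add: s_def)
  have v: "valid K A n j (e j)" for j
    unfolding valid_def
  proof (intro allI impI)
    fix i assume i: "i < b"
    have "digit n (e j) i' \<noteq> digit n (e j) i" if "i' < i" "j * b + i < n" for i'
      using e(2)[of i j] e(2)[of i' j] inj[of "j * b + i'" "j * b + i"] that i by auto
    then show "if j * b + i < n then digit n (e j) i < n \<and> A ((j * b + i) * n + digit n (e j) i) \<noteq> 0 \<and>
      (\<forall>i'<i. digit n (e j) i' \<noteq> digit n (e j) i) else digit n (e j) i = 0"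
      using lt A e(2)[OF i, of j] by simp
  qed
  have hit: "hits K n j (e j) k \<longleftrightarrow> (\<exists>i<b. j * b + i < n \<and> \<sigma> (j * b + i) = k)" for j k
    unfolding hits_def by (intro ex_cong1) (auto simp: e(2))
  have "is_partition n q (\<lambda>j\<in>{..<q}. columns K n j (s j))"
    unfolding is_partition_def
  proof (intro conjI ballI impI subsetI)
    fix i j assume ij: "i \<in> {..<q}" "j \<in> {..<q}" "i \<noteq> j"
    have False if hi: "hits K n i (e i) k" and hj: "hits K n j (e j) k" for k
    proof -
      obtain a where a: "a < b" "\<sigma> (i * b + a) = k" using hi unfolding hit by blast
      obtain c where c: "c < b" "\<sigma> (j * b + c) = k" using hj unfolding hit by blast
      \<comment> \<open>\<open>\<sigma>\<close> is injective on all naturals, so a common column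
        means a common row; the row number determines the block because both offsets are below
        \<open>b\<close>.\<close>
      have "i * b + a = j * b + c" using a c inj by metis
      then have "(i * b + a) div b = (j * b + c) div b" by simp
      then show False using a c ij(3) b_pos by simp
    qed
    then show "(\<lambda>j\<in>{..<q}. columns K n j (s j)) i \<inter> (\<lambda>j\<in>{..<q}. columns K n j (s j)) j = {}"
      using ij s by (auto simp: columns_def)
  next
    fix k assume k: "k \<in> {..<n}"
    obtain r where r: "r < n" "\<sigma> r = k"
      using permutes_image[OF \<sigma>] k by (metis imageE lessThan_iff)
    note R = row_block[OF r(1)]
    have "hits K n (r div b) (e (r div b)) k"
      unfolding hit using R r by (intro exI[of _ "r mod b"]) simp
    then show "k \<in> (\<Union>j\<in>{..<q}. (\<lambda>j\<in>{..<q}. columns K n j (s j)) j)"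
      using R k s by (auto simp: columns_def)
  qed
  then have "s \<in> selections"
    unfolding selections_def using e(1) v by (auto simp: s_def)
  moreover have "to_perm s = \<sigma>"
  proof
    fix r
    show "to_perm s r = \<sigma> r"
    proof (cases "r < n")
      case True
      note R = row_block[OF True]
      show ?thesis using R True s e(2)[of "r mod b" "r div b"] by (simp add: to_perm_def)
    next
      case False
      then show ?thesis using permutes_not_in[OF \<sigma>] by (simp add: to_perm_def)
    qed
  qed
  ultimately show ?thesis by blast
qed

text \<open>A permutation fixes the digits of all existing rows and validity fixes the remaining
  ones at \<open>0\<close>, so it determines the selection.\<close>

lemma card_selections: "card selections = matchings A n"
proof -
  have "inj_on to_perm selections"
  proof (rule inj_onI)
    fix s s' assume s: "s \<in> selections" "s' \<in> selections" and eq: "to_perm s = to_perm s'"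
    show "s = s'"
    proof (rule PiE_ext)
      show "s \<in> PiE {..<q} (\<lambda>j. {e. e < Q \<and> valid K A n j e})"
        "s' \<in> PiE {..<q} (\<lambda>j. {e. e < Q \<and> valid K A n j e})"
        using s by (auto simp: selections_def)
      fix j assume "j \<in> {..<q}"
      then have j: "j < q" by simp
      show "s j = s' j"
      proof (rule code_eqI)
        show "s j < Q" "s' j < Q" "valid K A n j (s j)" "valid K A n j (s' j)"
          using selectionsD s j by auto
        fix i assume "i < b" "j * b + i < n"
        then show "digit n (s j) i = digit n (s' j) i"
          using fun_cong[OF eq, of "j * b + i"] by (simp add: to_perm_def)
      qed
    qed
  qed
  moreover have "to_perm ` selections = {\<sigma>. \<sigma> permutes {..<n} \<and> (\<forall>r<n. A (r * n + \<sigma> r) \<noteq> 0)}"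
    (is "_ = ?R")
  proof (intro equalityI subsetI)
    fix \<sigma> assume "\<sigma> \<in> to_perm ` selections"
    then obtain s where "s \<in> selections" "\<sigma> = to_perm s" by blast
    then show "\<sigma> \<in> ?R" using to_perm_permutes to_perm_row(2) by simp
  next
    fix \<sigma> assume "\<sigma> \<in> ?R"
    then show "\<sigma> \<in> to_perm ` selections" using from_perm[of \<sigma>] by blast
  qed
  ultimately show ?thesis unfolding matchings_def by (metis card_image)
qed

section \<open>The set family and its exact covers\<close>

definition block_set :: "nat \<Rightarrow> nat \<Rightarrow> nat set" where
  "block_set j e = {y. y < u \<and> belongs K A n (j * Q + e) y}"

lemma belongs_code:
  assumes "j < q" "e < Q"
  shows "belongs K A n (j * Q + e) y \<longleftrightarrow>
     (if y < n then hits K n j e y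
      else if y < n + q then y = n + j
      else (y - n - q) div m = j \<and> rank K A n j e div 2 ^ ((y - n - q) mod m) mod 2 = 1)"
  using code_split[OF assms] by (simp add: belongs_def)

lemma label_block_set:
  assumes "j < q" "e < Q" "i < q"
  shows "n + i \<in> block_set j e \<longleftrightarrow> i = j"
  using assms by (simp add: block_set_def belongs_code ground_def)

lemma columns_block_set:
  assumes "j < q" "e < Q"
  shows "columns K n j e = block_set j e \<inter> {..<n}"
  using assms by (auto simp: block_set_def belongs_code ground_def columns_def)

text \<open>Labels and extra elements are private to a block, so two sets of different blocks can
  only meet in a column.\<close>

lemma block_sets_disjoint_iff:
  assumes "i < q" "e < Q" "j < q" "e' < Q" "i \<noteq> j"
  shows "block_set i e \<inter> block_set j e' = {} \<longleftrightarrow> columns K n i e \<inter> columns K n j e' = {}"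
proof
  assume "columns K n i e \<inter> columns K n j e' = {}"
  then show "block_set i e \<inter> block_set j e' = {}"
    using assms by (auto simp: block_set_def belongs_code columns_def split: if_splits)
qed (use assms in \<open>auto simp: columns_block_set\<close>)

lemma extra_bit:
  assumes "j < q" "e < Q" "t < m"
  shows "n + q + j * m + t \<in> block_set j e \<longleftrightarrow> rank K A n j e div 2 ^ t mod 2 = 1"
proof -
  have "j * m + t < Suc j * m" using assms by simp
  also have "\<dots> \<le> q * m" using assms by (intro mult_le_mono1) simp
  finally have "n + q + j * m + t < u" by (simp add: ground_def)
  moreover have "n + q + j * m + t - n - q = j * m + t" by simp
  ultimately show ?thesis using assms by (simp add: block_set_def belongs_code)
qed

lemma keep_rank:
  assumes "keep K A n M j e" "1 \<le> M" "M \<le> moduli n"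
  shows "rank K A n j e < 2 ^ m"
proof -
  have "rank K A n j e < weight K A n j e mod M" using assms by (simp add: keep_def)
  also have "\<dots> < M" using assms by simp
  finally show ?thesis using assms(3) moduli_le[of n] by linarith
qed

text \<open>The part of the set below \<open>n\<close> gives the class of the code and the extra
  elements give the binary digits of its rank; within a class the rank determines the code.\<close>

lemma inj_block_set:
  assumes j: "j < q" and M: "1 \<le> M" "M \<le> moduli n"
  shows "inj_on (block_set j) {e. e < Q \<and> keep K A n M j e}"
proof (rule inj_onI)
  fix e e' assume e: "e \<in> {e. e < Q \<and> keep K A n M j e}" "e' \<in> {e. e < Q \<and> keep K A n M j e}"
    and eq: "block_set j e = block_set j e'"
  have c: "columns K n j e = columns K n j e'" using e eq j by (simp add: columns_block_set)
  have r: "rank K A n j e = rank K A n j e'"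
  proof (rule bit_eq_imp_eq)
    show "rank K A n j e < 2 ^ m" "rank K A n j e' < 2 ^ m" using keep_rank M e by auto
    fix t assume "t < m"
    then show "rank K A n j e div 2 ^ t mod 2 = 1 \<longleftrightarrow> rank K A n j e' div 2 ^ t mod 2 = 1"
      using extra_bit[OF j, of e t] extra_bit[OF j, of e' t] e eq by simp
  qed
  have v: "valid K A n j e" "valid K A n j e'" using e by (auto simp: keep_def)
  show "e = e'"
  proof (rule ccontr)
    assume "e \<noteq> e'"
    then have "e < e' \<or> e' < e" by linarith
    then show False using rank_less[OF v(1) c] rank_less[OF v(2) c[symmetric]] r by auto
  qed
qed

lemma single_set:
  assumes "q * Q \<le> x" "x < numbers K n"
  shows "{y. y < u \<and> belongs K A n x y} = {n + q + (x - q * Q)}"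
  using assms by (auto simp: belongs_def numbers_def ground_def)

lemma set_family:
  "set (family K A n M) =
     (\<Union>j\<in>{..<q}. block_set j ` {e. e < Q \<and> keep K A n M j e}) \<union> (\<lambda>z. {z}) ` {n + q..<u}"
proof (intro equalityI subsetI)
  fix X assume "X \<in> set (family K A n M)"
  then obtain x where x: "x < numbers K n" "good K A n M x" "X = {y. y < u \<and> belongs K A n x y}"
    by (auto simp: family_def goods_def)
  show "X \<in> (\<Union>j\<in>{..<q}. block_set j ` {e. e < Q \<and> keep K A n M j e}) \<union> (\<lambda>z. {z}) ` {n + q..<u}"
  proof (cases "x < q * Q")
    case True
    note c = code_unsplit[OF True]
    have "X = block_set (x div Q) (x mod Q)" using x c(3) by (simp add: block_set_def)
    moreover have "keep K A n M (x div Q) (x mod Q)" using x True by (simp add: good_def)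
    ultimately show ?thesis using c by blast
  next
    case False
    then have "X = {n + q + (x - q * Q)}" using single_set x by simp
    moreover have "n + q + (x - q * Q) \<in> {n + q..<u}"
      using False x(1) by (auto simp: numbers_def ground_def)
    ultimately show ?thesis by blast
  qed
next
  fix X assume "X \<in> (\<Union>j\<in>{..<q}. block_set j ` {e. e < Q \<and> keep K A n M j e}) \<union> (\<lambda>z. {z}) ` {n + q..<u}"
  then consider j e where "j < q" "e < Q" "keep K A n M j e" "X = block_set j e" |
    z where "n + q \<le> z" "z < u" "X = {z}" by auto
  then obtain x where "x < numbers K n" "good K A n M x" "X = {y. y < u \<and> belongs K A n x y}"
  proof cases
    case 1
    note c = code_split[OF 1(1,2)]
    show thesis
      by (rule that[of "j * Q + e"]) (use 1 c in \<open>auto simp: numbers_def good_def block_set_def\<close>)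
  next
    case 2
    have "{y. y < u \<and> belongs K A n (q * Q + (z - n - q)) y} = {z}"
      using 2 by (subst single_set) (auto simp: numbers_def ground_def)
    moreover have "q * Q + (z - n - q) < numbers K n"
      using 2 by (simp add: numbers_def ground_def)
    moreover have "good K A n M (q * Q + (z - n - q))" by (simp add: good_def)
    ultimately show thesis using that 2 by metis
  qed
  then show "X \<in> set (family K A n M)" by (auto simp: family_def goods_def)
qed

text \<open>Every block set contains the label of its block, which lies below \<open>n + q\<close>,
  whereas singletons lie at or above \<open>n + q\<close>. Only sets of the same block remain to be
  compared.\<close>

lemma distinct_family:
  assumes M: "1 \<le> M" "M \<le> moduli n"
  shows "distinct (family K A n M)"
proof -
  have "inj_on (\<lambda>x. {y. y < u \<and> belongs K A n x y}) (set (goods K A n M))"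
  proof (rule inj_onI)
    fix x x' assume x: "x \<in> set (goods K A n M)" "x' \<in> set (goods K A n M)"
      and eq: "{y. y < u \<and> belongs K A n x y} = {y. y < u \<and> belongs K A n x' y}"
    have lt: "x < numbers K n" "x' < numbers K n" and g: "good K A n M x" "good K A n M x'"
      using x by (auto simp: goods_def)
    have bs: "{y. y < u \<and> belongs K A n z y} = block_set (z div Q) (z mod Q)"
      "keep K A n M (z div Q) (z mod Q)" if "z < q * Q" "good K A n M z" for z
      using that code_unsplit[OF that(1)] by (simp_all add: block_set_def good_def)
    have nlab: False if "z < q * Q" "good K A n M z" "q * Q \<le> z'" "z' < numbers K n"
      "{y. y < u \<and> belongs K A n z y} = {y. y < u \<and> belongs K A n z' y}" for z z'
    proof -
      note c = code_unsplit[OF that(1)]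
      have "n + z div Q \<in> {y. y < u \<and> belongs K A n z y}"
        unfolding bs(1)[OF that(1,2)] using label_block_set c by blast
      then show False unfolding that(5) using single_set[OF that(3,4)] c by auto
    qed
    consider "x < q * Q" "x' < q * Q" | "x < q * Q" "q * Q \<le> x'" | "q * Q \<le> x" "x' < q * Q" |
      "q * Q \<le> x" "q * Q \<le> x'" by linarith
    then show "x = x'"
    proof cases
      case 1
      note c = code_unsplit[OF 1(1)] and c' = code_unsplit[OF 1(2)]
      have e: "block_set (x div Q) (x mod Q) = block_set (x' div Q) (x' mod Q)"
        using eq bs(1) 1 g by simp
      have "n + x div Q \<in> block_set (x' div Q) (x' mod Q)"
        unfolding e[symmetric] using label_block_set c by blast
      then have j: "x div Q = x' div Q" using label_block_set c c' by blast
      have "keep K A n M (x div Q) (x mod Q)" "keep K A n M (x' div Q) (x' mod Q)"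
        using bs(2) 1 g by blast+
      then have "x mod Q = x' mod Q"
        using inj_onD[OF inj_block_set[OF c(1) M], of "x mod Q" "x' mod Q"] e j c(2) c'(2) by simp
      then show ?thesis using j c c' by metis
    next
      case 2
      then show ?thesis using nlab g lt eq by blast
    next
      case 3
      then show ?thesis using nlab[of x' x] g lt eq by blast
    next
      case 4
      then show ?thesis using eq single_set lt by auto
    qed
  qed
  then show ?thesis by (simp add: family_def distinct_map goods_def)
qed

text \<open>Whether a choice of sets is part of an exact cover depends on the column sets alone.
  Passing from kept to valid codes changes every class size by a multiple of \<open>M\<close>, and
  valid codes count permutations.\<close>

lemma card_exact_covers_mod:
  assumes M: "1 \<le> M" "M \<le> moduli n"
  shows "card (exact_covers {..<u} (set (family K A n M))) mod M = matchings A n mod M"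
proof -
  let ?G = "\<lambda>j. {e. e < Q \<and> keep K A n M j e}"
  let ?E = "\<lambda>j. {e. e < Q \<and> valid K A n j e}"
  let ?S = "\<lambda>G. {s \<in> PiE {..<q} G. is_partition n q (\<lambda>j\<in>{..<q}. columns K n j (s j))}"
  have U: "{..<u} = {..<n} \<union> (\<lambda>j. n + j) ` {..<q} \<union> {n + q..<u}"
  proof (intro equalityI subsetI)
    fix y assume y: "y \<in> {..<u}"
    show "y \<in> {..<n} \<union> (\<lambda>j. n + j) ` {..<q} \<union> {n + q..<u}"
    proof (cases "n \<le> y \<and> y < n + q")
      case True
      then have "y = n + (y - n)" "y - n < q" by auto
      then show ?thesis by blast
    qed (use y in auto)
  qed (auto simp: ground_def)
  have 1: "card (exact_covers {..<u} (set (family K A n M))) =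
    card {s \<in> PiE {..<q} ?G. (\<forall>i\<in>{..<q}. \<forall>j\<in>{..<q}. i \<noteq> j \<longrightarrow> block_set i (s i) \<inter> block_set j (s j) = {}) \<and>
                       {..<n} \<subseteq> (\<Union>j\<in>{..<q}. block_set j (s j))}"
    unfolding set_family U
  proof (rule card_labelled_exact_covers)
    show "(n + i \<in> block_set j e) = (i = j)" if "j \<in> {..<q}" "e \<in> ?G j" "i \<in> {..<q}" for j e i
      using that label_block_set by auto
    show "inj_on (block_set j) (?G j)" if "j \<in> {..<q}" for j
      using that inj_block_set M by auto
    show "block_set j e \<subseteq> {..<n} \<union> (\<lambda>j. n + j) ` {..<q} \<union> {n + q..<u}" for j e
      unfolding U[symmetric] by (auto simp: block_set_def)
  qed auto
  have 2: "{s \<in> PiE {..<q} ?G. (\<forall>i\<in>{..<q}. \<forall>j\<in>{..<q}. i \<noteq> j \<longrightarrow> block_set i (s i) \<inter> block_set j (s j) = {}) \<and>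
                       {..<n} \<subseteq> (\<Union>j\<in>{..<q}. block_set j (s j))} = ?S ?G"
  proof (rule Collect_cong, rule conj_cong[OF refl])
    fix s assume s: "s \<in> PiE {..<q} ?G"
    then have sQ: "s j < Q" if "j < q" for j using that by (auto dest: PiE_mem)
    have "(\<forall>i\<in>{..<q}. \<forall>j\<in>{..<q}. i \<noteq> j \<longrightarrow> block_set i (s i) \<inter> block_set j (s j) = {}) \<longleftrightarrow>
      (\<forall>i\<in>{..<q}. \<forall>j\<in>{..<q}. i \<noteq> j \<longrightarrow> columns K n i (s i) \<inter> columns K n j (s j) = {})"
      using block_sets_disjoint_iff sQ by auto
    moreover have "{..<n} \<subseteq> (\<Union>j\<in>{..<q}. block_set j (s j)) \<longleftrightarrow>
      {..<n} \<subseteq> (\<Union>j\<in>{..<q}. columns K n j (s j))"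
      using columns_block_set sQ by auto
    ultimately show "((\<forall>i\<in>{..<q}. \<forall>j\<in>{..<q}. i \<noteq> j \<longrightarrow> block_set i (s i) \<inter> block_set j (s j) = {}) \<and>
      {..<n} \<subseteq> (\<Union>j\<in>{..<q}. block_set j (s j))) \<longleftrightarrow>
      is_partition n q (\<lambda>j\<in>{..<q}. columns K n j (s j))"
      by (simp add: is_partition_def)
  qed
  have 3: "card (?S ?G) mod M = card (?S ?E) mod M"
  proof (rule card_partitions_mod)
    show "card {e \<in> ?G j. columns K n j e = S} = card {e \<in> ?E j. columns K n j e = S} mod M" for j S
      by (rule card_keep_class)
    show "columns K n j e \<subseteq> {..<n}" for j e by (auto simp: columns_def)
  qed (auto simp: keep_def)
  show ?thesis unfolding card_selections[symmetric] selections_def 1 2 by (rule 3)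
qed

end

section \<open>Chinese remaindering and relocation\<close>

text \<open>Minimisation written as a sum: the number of initial segments of candidates without a
  success is the position of the first success. Expressions offer no other way to search.\<close>

lemma card_initial_failures:
  assumes "P t0" "t0 < h" "\<And>t. t < t0 \<Longrightarrow> \<not> P t"
  shows "card {k. k < h \<and> (\<forall>t<Suc k. \<not> P t)} = t0"
proof -
  have "{k. k < h \<and> (\<forall>t<Suc k. \<not> P t)} = {..<t0}"
  proof (intro equalityI subsetI)
    fix k assume k: "k \<in> {k. k < h \<and> (\<forall>t<Suc k. \<not> P t)}"
    show "k \<in> {..<t0}"
    proof (rule ccontr)
      assume "k \<notin> {..<t0}"
      then have "t0 < Suc k" by simp
      then show False using k assms(1) by blast
    qed
  qed (use assms in auto)
  then show ?thesis by simp
qed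

text \<open>
  Large numbers enter only modulo \<open>M\<close>: from \<open>M\<close> and \<open>L mod M\<close>, \<open>factorE\<close> finds \<open>lcm L M div L\<close> by linear
  search, and \<open>quotE\<close> finds the multiple of \<open>L\<close> that lifts a residue from \<open>L\<close> to \<open>lcm L M\<close>.
\<close>

definition factorE :: expr where
  "factorE = EBin Add (ENum 1) (ESum (EVar 0) (eAll (EBin Add (EVar 0) (ENum 1))
     (eNot (eEq (EBin Mod (EBin Mul (EVar 3) (EBin Add (EVar 0) (ENum 1))) (EVar 2)) (ENum 0)))))"

definition quotE :: expr where
  "quotE = ESum (EVar 0) (eAll (EBin Add (EVar 0) (ENum 1))
     (eNot (eEq (EBin Mod (EBin Add (EVar 4) (EBin Mul (EVar 5) (EVar 0))) (EVar 2)) (EVar 3))))"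

lemma lcm_factor:
  fixes L M :: nat
  assumes "0 < L" "1 \<le> M"
  defines "s0 \<equiv> lcm L M div L"
  shows "1 \<le> s0" "s0 \<le> M" "L * s0 = lcm L M" "M dvd L * s0"
    "\<And>k. M dvd L * k \<Longrightarrow> 0 < k \<Longrightarrow> s0 \<le> k"
proof -
  show eq: "L * s0 = lcm L M" unfolding s0_def by simp
  then show "M dvd L * s0" by (metis dvd_lcm2)
  have "0 < lcm L M" using assms by (simp add: lcm_pos_nat)
  then show "1 \<le> s0" using eq by (cases s0) auto
  show least: "s0 \<le> k" if "M dvd L * k" "0 < k" for k
  proof -
    have "lcm L M dvd L * k" using that by simp
    then have "L * s0 \<le> L * k" unfolding eq using assms that by (intro dvd_imp_le) auto
    then show ?thesis using assms(1) by (simp only: nat_mult_le_cancel1)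
  qed
  show "s0 \<le> M" by (rule least) (use assms in auto)
qed

lemma ev_factorE:
  assumes "0 < L" "1 \<le> M"
  shows "L * ev A factorE [M, L mod M] = lcm L M"
proof -
  let ?s = "lcm L M div L"
  note s = lcm_factor[OF assms]
  let ?P = "\<lambda>t. (L mod M * Suc t) mod M = 0"
  have P: "?P t \<longleftrightarrow> M dvd L * Suc t" for t
    by (metis dvd_eq_mod_eq_0 mod_mult_left_eq)
  \<comment> \<open>Candidate number \<open>t\<close> is the factor \<open>Suc t\<close>, so the
    search stops at \<open>?s - 1\<close>; the leading \<open>ENum 1\<close> of
    \<open>factorE\<close> restores the factor.\<close>
  have "card {k. k < M \<and> (\<forall>t<Suc k. \<not> ?P t)} = ?s - 1"
  proof (rule card_initial_failures)
    show "?P (?s - 1)" unfolding P using s(1,4) by simp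
    show "?s - 1 < M" using s(1,2) by linarith
    show "\<not> ?P t" if "t < ?s - 1" for t
      unfolding P using s(5)[of "Suc t"] that by auto
  qed
  then have "ev A factorE [M, L mod M] = ?s"
    using s(1) by (simp add: factorE_def sum_indicator)
  then show ?thesis using s(3) by simp
qed

lemma ev_quotE:
  assumes "0 < L" "1 \<le> M"
  shows "p mod L + L * ev A quotE [M, p mod M, p mod L mod M, L mod M] = p mod lcm L M"
    "ev A quotE [M, p mod M, p mod L mod M, L mod M] \<le> M"
proof -
  let ?s = "lcm L M div L"
  let ?p = "p mod lcm L M"
  let ?t = "?p div L"
  note s = lcm_factor[OF assms]
  have x: "p mod L = ?p mod L" by (simp add: mod_mod_cancel)
  then have p': "?p = p mod L + L * ?t" by simp
  have "0 < lcm L M" using assms by (simp add: lcm_pos_nat)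
  then have "?p < L * ?s" unfolding s(3) by simp
  then have t: "?t < ?s" by (simp add: less_mult_imp_div_less mult.commute)
  let ?P = "\<lambda>t. (p mod L mod M + L mod M * t) mod M = p mod M"
  have P: "?P t \<longleftrightarrow> (p mod L + L * t) mod M = p mod M" for t
    by (metis mod_add_cong mod_mod_trivial mod_mult_left_eq)
  have "card {k. k < M \<and> (\<forall>t<Suc k. \<not> ?P t)} = ?t"
  proof (rule card_initial_failures)
    show "?P ?t" unfolding P p'[symmetric] by (simp add: mod_mod_cancel)
    then have P0: "(p mod L + L * ?t) mod M = p mod M" unfolding P .
    show "?t < M" using t s(2) by linarith
    show "\<not> ?P t'" if t': "t' < ?t" for t'
    proof
      assume "?P t'"
      then have "(p mod L + L * t') mod M = (p mod L + L * ?t) mod M"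
        unfolding P P0 .
      \<comment> \<open>Two solutions below \<open>?s\<close> would make \<open>M\<close> divide
        \<open>L\<close> times a positive number below \<open>?s\<close>, against the minimality of
        \<open>?s\<close>.\<close>
      then have "M dvd (p mod L + L * ?t) - (p mod L + L * t')"
        using mod_eq_dvd_iff_nat[of "p mod L + L * t'" "p mod L + L * ?t" M] t' by simp
      then have "M dvd L * (?t - t')" by (simp add: diff_mult_distrib2)
      then have "?s \<le> ?t - t'" using s(5) t' by simp
      then show False using t by linarith
    qed
  qed
  then have "ev A quotE [M, p mod M, p mod L mod M, L mod M] = ?t"
    by (simp add: quotE_def sum_indicator)
  then show "p mod L + L * ev A quotE [M, p mod M, p mod L mod M, L mod M] = p mod lcm L M"
    "ev A quotE [M, p mod M, p mod L mod M, L mod M] \<le> M"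
    using p' t s(2) by simp_all
qed

section \<open>The permanent of a 0/1 matrix as a number of permutations, and its size\<close>

lemma permanent_eq_matchings:
  assumes A: "A \<in> carrier_mat n n" and el: "elements_mat A \<subseteq> {0, 1}"
  shows "nat (permanent A) = matchings (snd (matrix_input A)) n"
proof -
  let ?a = "snd (matrix_input A)"
  have dim: "dim_row A = n" "dim_col A = n" using A by auto
  have entry: "A $$ (r, c) \<in> {0, 1}" if "r < n" "c < n" for r c
  proof -
    have "A $$ (r, c) \<in> elements_mat A"
      using that dim by (auto simp: elements_mat_def intro!: bexI[of _ r])
    then show ?thesis using el by blast
  qed
  have a: "?a (r * n + c) = nat (A $$ (r, c))" if "r < n" "c < n" for r c
  proof -
    have "r * n + c < Suc r * n" using that by simp
    also have "\<dots> \<le> n * n" using that by (intro mult_le_mono1) simp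
    finally show ?thesis using that dim by (simp add: matrix_input_def)
  qed
  have prod: "(\<Prod>i = 0..<n. A $$ (i, \<sigma> i)) = (if \<forall>r<n. ?a (r * n + \<sigma> r) \<noteq> 0 then 1 else 0)"
    if "\<sigma> permutes {0..<n}" for \<sigma>
  proof -
    have lt: "\<sigma> r < n" if "r < n" for r
      using permutes_in_image[OF \<open>\<sigma> permutes {0..<n}\<close>] that by auto
    show ?thesis
    proof (cases "\<forall>r<n. ?a (r * n + \<sigma> r) \<noteq> 0")
      case True
      then have "A $$ (i, \<sigma> i) = 1" if "i < n" for i
        using that lt a[of i "\<sigma> i"] entry[of i "\<sigma> i"] by auto
      then show ?thesis using True by simp
    next
      case False
      then obtain r where "r < n" "?a (r * n + \<sigma> r) = 0" by blast
      then have "A $$ (r, \<sigma> r) = 0" using lt a[of r "\<sigma> r"] entry[of r "\<sigma> r"] by auto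
      then have "(\<Prod>i = 0..<n. A $$ (i, \<sigma> i)) = 0"
        using \<open>r < n\<close> by (intro prod_zero) auto
      then show ?thesis by (simp only: if_not_P[OF False])
    qed
  qed
  have "permanent A = (\<Sum>\<sigma> | \<sigma> permutes {0..<n}. if \<forall>r<n. ?a (r * n + \<sigma> r) \<noteq> 0 then 1 else 0)"
    unfolding permanent_def dim by (rule sum.cong) (simp_all add: prod)
  also have "\<dots> = int (card ({\<sigma>. \<sigma> permutes {0..<n}} \<inter> {\<sigma>. \<forall>r<n. ?a (r * n + \<sigma> r) \<noteq> 0}))"
    by (subst sum.If_cases) (simp_all add: finite_permutations)
  also have "{\<sigma>. \<sigma> permutes {0..<n}} \<inter> {\<sigma>. \<forall>r<n. ?a (r * n + \<sigma> r) \<noteq> 0} =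
      {\<sigma>. \<sigma> permutes {..<n} \<and> (\<forall>r<n. ?a (r * n + \<sigma> r) \<noteq> 0)}"
    by (auto simp: atLeast0LessThan)
  finally show ?thesis by (simp add: matchings_def)
qed

text \<open>The crude chain \<open>n! \<le> n ^ n \<le> 2 ^ (n * n)\<close> suffices, since it only
  makes the number of moduli quadratic in \<open>n\<close>.\<close>

lemma matchings_less: "matchings A n < 4 ^ (n * n + 1)"
proof -
  have "matchings A n \<le> card {\<sigma>. \<sigma> permutes {..<n}}"
    unfolding matchings_def by (rule card_mono) (auto simp: finite_permutations)
  also have "\<dots> = fact n" by (simp add: card_permutations)
  also have "fact n \<le> (n ^ n :: nat)" using Factorial.fact_le_power[of n, where ?'a = nat] unfolding of_nat_id .
  also have "\<dots> \<le> (2 ^ n) ^ n" by (rule power_mono) (simp_all add: less_imp_le)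
  also have "\<dots> = 2 ^ (n * n)" by (simp add: power_mult)
  also have "\<dots> \<le> (4 ^ (n * n) :: nat)" by (rule power_mono) auto
  also have "\<dots> < 4 ^ (n * n + 1)" by simp
  finally show ?thesis .
qed

text \<open>
  Memory cell \<open>a\<close> of the relocated program is cell \<open>base + stride * a\<close>; registers \<open>5\<close> and \<open>6\<close> hold
  \<open>base\<close> and \<open>stride\<close>, and register \<open>7\<close> is scratch space.
\<close>

fun relocate :: "com \<Rightarrow> com" where
  "relocate Skip = Skip"
| "relocate (Const r k) = Const (r + 40) k"
| "relocate (Arith r f p q) = Arith (r + 40) f (p + 40) (q + 40)"
| "relocate (Load r p) = Seq (Arith 7 Mul 6 (p + 40)) (Seq (Arith 7 Add 5 7) (Load (r + 40) 7))"
| "relocate (Store p r) = Seq (Arith 7 Mul 6 (p + 40)) (Seq (Arith 7 Add 5 7) (Store 7 (r + 40)))"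
| "relocate (Seq c d) = Seq (relocate c) (relocate d)"
| "relocate (If r c d) = If (r + 40) (relocate c) (relocate d)"
| "relocate (While r c) = While (r + 40) (relocate c)"

text \<open>Only the registers that a program mentions have to be reset before each of its runs, so
  resetting them is a fixed program.\<close>

fun reg_bound :: "com \<Rightarrow> nat" where
  "reg_bound Skip = 0"
| "reg_bound (Const r k) = Suc r"
| "reg_bound (Arith r f p q) = Suc (max r (max p q))"
| "reg_bound (Load r p) = Suc (max r p)"
| "reg_bound (Store p r) = Suc (max r p)"
| "reg_bound (Seq c d) = max (reg_bound c) (reg_bound d)"
| "reg_bound (If r c d) = max (Suc r) (max (reg_bound c) (reg_bound d))"
| "reg_bound (While r c) = max (Suc r) (reg_bound c)"

definition simulates :: "nat \<Rightarrow> nat \<Rightarrow> nat \<Rightarrow> state \<Rightarrow> state \<Rightarrow> bool" where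
  "simulates w \<beta> \<sigma> s s' \<longleftrightarrow> (\<forall>r<w. fst s' (r + 40) = fst s r) \<and>
     (\<forall>a. snd s' (\<beta> + \<sigma> * a) = snd s a) \<and> fst s' 5 = \<beta> \<and> fst s' 6 = \<sigma>"

definition outside_eq :: "nat \<Rightarrow> nat \<Rightarrow> state \<Rightarrow> state \<Rightarrow> bool" where
  "outside_eq \<beta> \<sigma> s s' \<longleftrightarrow> (\<forall>r<40. r \<noteq> 7 \<longrightarrow> fst s' r = fst s r) \<and>
     (\<forall>a. (\<forall>i. a \<noteq> \<beta> + \<sigma> * i) \<longrightarrow> snd s' a = snd s a)"

lemma outside_eq_trans: "outside_eq \<beta> \<sigma> s s' \<Longrightarrow> outside_eq \<beta> \<sigma> s' s'' \<Longrightarrow> outside_eq \<beta> \<sigma> s s''"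
  by (simp add: outside_eq_def)

lemma outside_eq_refl: "outside_eq \<beta> \<sigma> s s"
  by (simp add: outside_eq_def)

lemma run_Load: "run (Load r p) (R, M) (bits (R p) + bits (M (R p))) (R(r := M (R p)), M)"
  unfolding run_def using Load by blast

lemma run_Store: "run (Store p r) (R, M) (bits (R p) + bits (R r)) (R, M(R p := R r))"
  unfolding run_def using Store by blast

lemma relocated_address:
  assumes "R 5 = \<beta>" "R 6 = \<sigma>"
  shows "\<exists>T \<le> 2 * bits \<beta> + 2 * bits \<sigma> + 2 * bits (R (p + 40)).
    \<forall>d T' s'. run d (R(7 := \<beta> + \<sigma> * R (p + 40)), M) T' s' \<longrightarrow>
      run (Seq (Arith 7 Mul 6 (p + 40)) (Seq (Arith 7 Add 5 7) d)) (R, M) (T + T') s'"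
proof -
  let ?a = "R (p + 40)"
  let ?R1 = "R(7 := \<sigma> * ?a)"
  let ?T = "(bits \<sigma> + bits ?a) + (bits \<beta> + bits (\<sigma> * ?a))"
  have 1: "run (Arith 7 Mul 6 (p + 40)) (R, M) (bits \<sigma> + bits ?a) (?R1, M)"
    using run_Arith[of 7 Mul 6 "p + 40" R M] assms by simp
  have 2: "run (Arith 7 Add 5 7) (?R1, M) (bits \<beta> + bits (\<sigma> * ?a)) (R(7 := \<beta> + \<sigma> * ?a), M)"
    using run_Arith[of 7 Add 5 7 ?R1 M] assms by simp
  have "run (Seq (Arith 7 Mul 6 (p + 40)) (Seq (Arith 7 Add 5 7) d)) (R, M) (?T + T') s'"
    if "run d (R(7 := \<beta> + \<sigma> * ?a), M) T' s'" for d T' s'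
    by (rule run_mono[OF run_Seq[OF 1 run_Seq[OF 2 that]]]) simp
  moreover have "?T \<le> 2 * bits \<beta> + 2 * bits \<sigma> + 2 * bits ?a"
    using bits_mult_le[of \<sigma> ?a] by linarith
  ultimately show ?thesis by blast
qed

text \<open>For positive numbers \<open>x + y - 1 \<le> x * y\<close>, so a multiplicative slowdown
  absorbs the additive cost of translating an address.\<close>

lemma relocation_cost:
  fixes a b c d :: nat
  assumes "1 \<le> a" "1 \<le> b" "1 \<le> c" "1 \<le> d"
  shows "3 * a + 3 * b + 3 * c + d \<le> (4 * a + 4 * b) * (c + d)"
proof -
  have "4 * a * (c + d) \<ge> 4 * (a + (c + d) - 1)" "4 * b * (c + d) \<ge> 4 * (b + (c + d) - 1)"
    if "1 \<le> a" "1 \<le> b" "1 \<le> c + d"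
  proof -
    have "x + y - 1 \<le> x * y" if "1 \<le> x" "1 \<le> y" for x y :: nat
      using that by (cases x; cases y) auto
    then show "4 * a * (c + d) \<ge> 4 * (a + (c + d) - 1)" "4 * b * (c + d) \<ge> 4 * (b + (c + d) - 1)"
      using that by simp_all
  qed
  then show ?thesis using assms unfolding distrib_right by linarith
qed

text \<open>The cell \<open>\<beta> + \<sigma> * a\<close> has an address of at most
  \<open>bits \<beta> + bits \<sigma> + bits a\<close> bits, and \<open>bits a\<close> is already
  charged to the original access. Hence every step slows down by a factor that depends only on
  \<open>\<beta>\<close> and \<open>\<sigma>\<close>.\<close>

lemma relocate_correct:
  assumes "exec c s t s'" "reg_bound c \<le> w" "simulates w \<beta> \<sigma> s z" "0 < \<sigma>"
  shows "\<exists>z'. run (relocate c) z ((4 * bits \<beta> + 4 * bits \<sigma>) * t) z' \<and> simulates w \<beta> \<sigma> s' z' \<and> outside_eq \<beta> \<sigma> z z'"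
  using assms(1,2,3)
proof (induction arbitrary: z rule: exec.induct)
  case (Skip s)
  have "run Skip z 1 z" unfolding run_def using exec.Skip by blast
  then have "run (relocate Skip) z ((4 * bits \<beta> + 4 * bits \<sigma>) * 1) z"
    unfolding relocate.simps by (rule run_mono) (use bits_pos[of \<beta>] in simp)
  then show ?case using Skip outside_eq_refl by blast
next
  case (Const r k R M)
  obtain R2 M2 where z: "z = (R2, M2)" by (cases z)
  have "bits k \<le> (4 * bits \<beta> + 4 * bits \<sigma>) * bits k" using bits_pos[of \<beta>] by simp
  then have "run (Const (r + 40) k) z ((4 * bits \<beta> + 4 * bits \<sigma>) * bits k) (R2(r + 40 := k), M2)"
    unfolding z by (rule run_mono[OF run_Const])
  then show ?case using Const unfolding z
    by (intro exI[of _ "(R2(r + 40 := k), M2)"]) (auto simp: simulates_def outside_eq_def)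
next
  case (Arith r f p q R M)
  obtain R2 M2 where z: "z = (R2, M2)" by (cases z)
  let ?T = "bits (R p) + bits (R q)"
  have R: "R2 (p + 40) = R p" "R2 (q + 40) = R q"
    using Arith unfolding z by (auto simp: simulates_def)
  have "?T \<le> (4 * bits \<beta> + 4 * bits \<sigma>) * ?T" using bits_pos[of \<beta>] by simp
  then have "run (Arith (r + 40) f (p + 40) (q + 40)) z ((4 * bits \<beta> + 4 * bits \<sigma>) * ?T)
      (R2(r + 40 := arith_val f (R p) (R q)), M2)"
    unfolding z using run_mono[OF run_Arith[of "r + 40" f "p + 40" "q + 40" R2 M2]] R by simp
  then show ?case using Arith unfolding z
    by (intro exI[of _ "(R2(r + 40 := arith_val f (R p) (R q)), M2)"])
      (auto simp: simulates_def outside_eq_def)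
next
  case (Load r p R M)
  obtain R2 M2 where z: "z = (R2, M2)" by (cases z)
  have R: "R2 (p + 40) = R p" "R2 5 = \<beta>" "R2 6 = \<sigma>" "M2 (\<beta> + \<sigma> * R p) = M (R p)"
    using Load unfolding z by (auto simp: simulates_def)
  let ?z' = "(R2(7 := \<beta> + \<sigma> * R p, r + 40 := M (R p)), M2)"
  obtain T where T: "T \<le> 2 * bits \<beta> + 2 * bits \<sigma> + 2 * bits (R p)"
    "\<And>d T' s'. run d (R2(7 := \<beta> + \<sigma> * R p), M2) T' s' \<Longrightarrow>
      run (Seq (Arith 7 Mul 6 (p + 40)) (Seq (Arith 7 Add 5 7) d)) (R2, M2) (T + T') s'"
    using relocated_address[OF R(2,3), of p M2] unfolding R by blast
  have "run (relocate (Load r p)) z (T + (bits (\<beta> + \<sigma> * R p) + bits (M (R p)))) ?z'"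
    unfolding relocate.simps z
    by (rule T(2)) (use run_Load[of "r + 40" 7 "R2(7 := \<beta> + \<sigma> * R p)" M2] R(4) in simp)
  moreover have "T + (bits (\<beta> + \<sigma> * R p) + bits (M (R p))) \<le>
      (4 * bits \<beta> + 4 * bits \<sigma>) * (bits (R p) + bits (M (R p)))"
  proof -
    have "T + (bits (\<beta> + \<sigma> * R p) + bits (M (R p))) \<le>
      3 * bits \<beta> + 3 * bits \<sigma> + 3 * bits (R p) + bits (M (R p))"
      using T(1) bits_add_le[of \<beta> "\<sigma> * R p"] bits_mult_le[of \<sigma> "R p"] by linarith
    also have "\<dots> \<le> (4 * bits \<beta> + 4 * bits \<sigma>) * (bits (R p) + bits (M (R p)))"
      using bits_pos[of \<beta>] bits_pos[of \<sigma>] bits_pos[of "R p"] bits_pos[of "M (R p)"]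
      by (rule relocation_cost)
    finally show ?thesis .
  qed
  ultimately have "run (relocate (Load r p)) z
      ((4 * bits \<beta> + 4 * bits \<sigma>) * (bits (R p) + bits (M (R p)))) ?z'"
    by (rule run_mono)
  then show ?case using Load unfolding z
    by (intro exI[of _ ?z']) (auto simp: simulates_def outside_eq_def)
next
  case (Store p r R M)
  obtain R2 M2 where z: "z = (R2, M2)" by (cases z)
  have R: "R2 (p + 40) = R p" "R2 5 = \<beta>" "R2 6 = \<sigma>" "R2 (r + 40) = R r"
    using Store unfolding z by (auto simp: simulates_def)
  let ?z' = "(R2(7 := \<beta> + \<sigma> * R p), M2(\<beta> + \<sigma> * R p := R r))"
  obtain T where T: "T \<le> 2 * bits \<beta> + 2 * bits \<sigma> + 2 * bits (R p)"
    "\<And>d T' s'. run d (R2(7 := \<beta> + \<sigma> * R p), M2) T' s' \<Longrightarrow>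
      run (Seq (Arith 7 Mul 6 (p + 40)) (Seq (Arith 7 Add 5 7) d)) (R2, M2) (T + T') s'"
    using relocated_address[OF R(2,3), of p M2] unfolding R by blast
  have "run (relocate (Store p r)) z (T + (bits (\<beta> + \<sigma> * R p) + bits (R r))) ?z'"
    unfolding relocate.simps z
    by (rule T(2)) (use run_Store[of 7 "r + 40" "R2(7 := \<beta> + \<sigma> * R p)" M2] R(4) in simp)
  moreover have "T + (bits (\<beta> + \<sigma> * R p) + bits (R r)) \<le>
      (4 * bits \<beta> + 4 * bits \<sigma>) * (bits (R p) + bits (R r))"
  proof -
    have "T + (bits (\<beta> + \<sigma> * R p) + bits (R r)) \<le>
      3 * bits \<beta> + 3 * bits \<sigma> + 3 * bits (R p) + bits (R r)"
      using T(1) bits_add_le[of \<beta> "\<sigma> * R p"] bits_mult_le[of \<sigma> "R p"] by linarith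
    also have "\<dots> \<le> (4 * bits \<beta> + 4 * bits \<sigma>) * (bits (R p) + bits (R r))"
      using bits_pos[of \<beta>] bits_pos[of \<sigma>] bits_pos[of "R p"] bits_pos[of "R r"]
      by (rule relocation_cost)
    finally show ?thesis .
  qed
  ultimately have "run (relocate (Store p r)) z
      ((4 * bits \<beta> + 4 * bits \<sigma>) * (bits (R p) + bits (R r))) ?z'"
    by (rule run_mono)
  \<comment> \<open>A positive stride makes the address map injective, so that one store changes
    just one simulated cell.\<close>
  moreover have "\<sigma> * a = \<sigma> * b \<longleftrightarrow> a = b" for a b using assms(4) by simp
  then have "simulates w \<beta> \<sigma> (R, M(R p := R r)) ?z'" "outside_eq \<beta> \<sigma> z ?z'"
    using Store unfolding z by (auto simp: simulates_def outside_eq_def)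
  ultimately show ?case by blast
next
  case (Seq c s t s' d t' s'')
  have bounds: "reg_bound c \<le> w" "reg_bound d \<le> w" using Seq.prems by auto
  obtain z1 where z1: "run (relocate c) z ((4 * bits \<beta> + 4 * bits \<sigma>) * t) z1"
    "simulates w \<beta> \<sigma> s' z1" "outside_eq \<beta> \<sigma> z z1"
    using Seq.IH(1)[OF bounds(1) Seq.prems(2)] by blast
  obtain z2 where z2: "run (relocate d) z1 ((4 * bits \<beta> + 4 * bits \<sigma>) * t') z2"
    "simulates w \<beta> \<sigma> s'' z2" "outside_eq \<beta> \<sigma> z1 z2"
    using Seq.IH(2)[OF bounds(2) z1(2)] by blast
  have "run (relocate (Seq c d)) z ((4 * bits \<beta> + 4 * bits \<sigma>) * (t + t')) z2"
    using run_Seq[OF z1(1) z2(1)] by (simp only: relocate.simps distrib_left)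
  then show ?case using z2(2) outside_eq_trans[OF z1(3) z2(3)] by blast
next
  case (IfTrue s r c t s' d)
  have bounds: "reg_bound c \<le> w" "r < w" using IfTrue.prems by auto
  obtain z1 where z1: "run (relocate c) z ((4 * bits \<beta> + 4 * bits \<sigma>) * t) z1"
    "simulates w \<beta> \<sigma> s' z1" "outside_eq \<beta> \<sigma> z z1"
    using IfTrue.IH[OF bounds(1) IfTrue.prems(2)] by blast
  have r: "fst z (r + 40) = fst s r" using IfTrue.prems bounds by (simp add: simulates_def)
  obtain t1 where t1: "t1 \<le> (4 * bits \<beta> + 4 * bits \<sigma>) * t" "exec (relocate c) z t1 z1"
    using z1(1) unfolding run_def by blast
  have "exec (relocate (If r c d)) z (bits (fst z (r + 40)) + t1) z1"
    unfolding relocate.simps by (rule exec.IfTrue) (use r IfTrue.hyps t1 in auto)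
  moreover have "bits (fst z (r + 40)) + t1 \<le> (4 * bits \<beta> + 4 * bits \<sigma>) * (bits (fst s r) + t)"
    unfolding r distrib_left by (rule add_mono[OF _ t1(1)]) (use bits_pos[of \<beta>] in simp)
  ultimately show ?case using z1(2,3) unfolding run_def by blast
next
  case (IfFalse s r d t s' c)
  have bounds: "reg_bound d \<le> w" "r < w" using IfFalse.prems by auto
  obtain z1 where z1: "run (relocate d) z ((4 * bits \<beta> + 4 * bits \<sigma>) * t) z1"
    "simulates w \<beta> \<sigma> s' z1" "outside_eq \<beta> \<sigma> z z1"
    using IfFalse.IH[OF bounds(1) IfFalse.prems(2)] by blast
  have r: "fst z (r + 40) = fst s r" using IfFalse.prems bounds by (simp add: simulates_def)
  obtain t1 where t1: "t1 \<le> (4 * bits \<beta> + 4 * bits \<sigma>) * t" "exec (relocate d) z t1 z1"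
    using z1(1) unfolding run_def by blast
  have "exec (relocate (If r c d)) z (bits (fst z (r + 40)) + t1) z1"
    unfolding relocate.simps by (rule exec.IfFalse) (use r IfFalse.hyps t1 in auto)
  moreover have "bits (fst z (r + 40)) + t1 \<le> (4 * bits \<beta> + 4 * bits \<sigma>) * (bits (fst s r) + t)"
    unfolding r distrib_left by (rule add_mono[OF _ t1(1)]) (use bits_pos[of \<beta>] in simp)
  ultimately show ?case using z1(2,3) unfolding run_def by blast
next
  case (WhileFalse s r c)
  have r: "fst z (r + 40) = fst s r" using WhileFalse.prems by (simp add: simulates_def)
  have "exec (relocate (While r c)) z (bits (fst z (r + 40))) z"
    unfolding relocate.simps by (rule exec.WhileFalse) (use r WhileFalse.hyps in auto)
  moreover have "bits (fst z (r + 40)) \<le> (4 * bits \<beta> + 4 * bits \<sigma>) * bits (fst s r)"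
    unfolding r using bits_pos[of \<beta>] by simp
  ultimately show ?case using WhileFalse.prems(2) outside_eq_refl unfolding run_def by blast
next
  case (WhileTrue s r c t s' t' s'')
  have bounds: "reg_bound c \<le> w" "r < w" using WhileTrue.prems by auto
  obtain z1 where z1: "run (relocate c) z ((4 * bits \<beta> + 4 * bits \<sigma>) * t) z1"
    "simulates w \<beta> \<sigma> s' z1" "outside_eq \<beta> \<sigma> z z1"
    using WhileTrue.IH(1)[OF bounds(1) WhileTrue.prems(2)] by blast
  obtain z2 where z2: "run (relocate (While r c)) z1 ((4 * bits \<beta> + 4 * bits \<sigma>) * t') z2"
    "simulates w \<beta> \<sigma> s'' z2" "outside_eq \<beta> \<sigma> z1 z2"
    using WhileTrue.IH(2)[OF WhileTrue.prems(1) z1(2)] by blast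
  have r: "fst z (r + 40) = fst s r" using WhileTrue.prems bounds by (simp add: simulates_def)
  obtain t1 where t1: "t1 \<le> (4 * bits \<beta> + 4 * bits \<sigma>) * t" "exec (relocate c) z t1 z1"
    using z1(1) unfolding run_def by blast
  obtain t2 where t2: "t2 \<le> (4 * bits \<beta> + 4 * bits \<sigma>) * t'" "exec (While (r + 40) (relocate c)) z1 t2 z2"
    using z2(1) unfolding run_def by auto
  have "exec (relocate (While r c)) z (bits (fst z (r + 40)) + t1 + t2) z2"
    unfolding relocate.simps by (rule exec.WhileTrue) (use r WhileTrue.hyps t1 t2 in auto)
  moreover have "bits (fst z (r + 40)) + t1 + t2 \<le>
      (4 * bits \<beta> + 4 * bits \<sigma>) * (bits (fst s r) + t + t')"
    unfolding r distrib_left by (intro add_mono t1(1) t2(1)) (use bits_pos[of \<beta>] in simp)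
  ultimately show ?case using z2(2) outside_eq_trans[OF z1(3) z2(3)] unfolding run_def by blast
qed

section \<open>Hoare triples with running times\<close>

text \<open>
  Running times are only tracked up to a power of \<open>w p + 2\<close>, except that the factor \<open>z p + 1\<close>, which
  will stand for the running time of the given algorithm, must not be raised to a power.
\<close>

definition triple :: "('p \<Rightarrow> nat) \<Rightarrow> ('p \<Rightarrow> nat) \<Rightarrow> ('p \<Rightarrow> (reg \<Rightarrow> nat) \<Rightarrow> (nat \<Rightarrow> nat) \<Rightarrow> bool) \<Rightarrow> com \<Rightarrow>
    ('p \<Rightarrow> (reg \<Rightarrow> nat) \<Rightarrow> (nat \<Rightarrow> nat) \<Rightarrow> bool) \<Rightarrow> bool" where
  "triple w z P c Q \<longleftrightarrow> (\<exists>k. \<forall>p R M. P p R M \<longrightarrow>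
     (\<exists>R' M'. run c (R, M) ((w p + 2) ^ k * (z p + 1)) (R', M') \<and> Q p R' M'))"

lemma tripleI:
  assumes "\<And>p R M. P p R M \<Longrightarrow>
     \<exists>R' M'. run c (R, M) ((w p + 2) ^ k * (z p + 1)) (R', M') \<and> Q p R' M'"
  shows "triple w z P c Q"
  unfolding triple_def using assms by blast

lemma tripleE:
  assumes "triple w z P c Q"
  obtains k where "\<And>p R M. P p R M \<Longrightarrow>
     \<exists>R' M'. run c (R, M) ((w p + 2) ^ k * (z p + 1)) (R', M') \<and> Q p R' M'"
  using assms unfolding triple_def by blast

lemma triple_pre:
  assumes "triple w z P c Q" "\<And>p R M. P' p R M \<Longrightarrow> P p R M"
  shows "triple w z P' c Q"
proof -
  obtain k where "\<And>p R M. P p R M \<Longrightarrow>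
     \<exists>R' M'. run c (R, M) ((w p + 2) ^ k * (z p + 1)) (R', M') \<and> Q p R' M'"
    using assms(1) by (rule tripleE) blast
  then show ?thesis using assms(2) by (intro tripleI) blast
qed

text \<open>The second command comes first among the premises, so that repeated application of the
  rules works backwards from a known postcondition. The other rules are accordingly stated with
  their weakest preconditions, and what remains of a correctness proof is one implication.\<close>

lemma triple_Seq:
  assumes "triple w z Q d S" "triple w z P c Q"
  shows "triple w z P (Seq c d) S"
proof -
  obtain k where k: "\<And>p R M. P p R M \<Longrightarrow>
     \<exists>R' M'. run c (R, M) ((w p + 2) ^ k * (z p + 1)) (R', M') \<and> Q p R' M'"
    using assms(2) by (rule tripleE) blast
  obtain l where l: "\<And>p R M. Q p R M \<Longrightarrow>
     \<exists>R' M'. run d (R, M) ((w p + 2) ^ l * (z p + 1)) (R', M') \<and> S p R' M'"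
    using assms(1) by (rule tripleE) blast
  show ?thesis
  proof (rule tripleI)
    fix p R M assume "P p R M"
    then obtain R1 M1 where 1: "run c (R, M) ((w p + 2) ^ k * (z p + 1)) (R1, M1)" "Q p R1 M1"
      using k by blast
    then obtain R2 M2 where 2: "run d (R1, M1) ((w p + 2) ^ l * (z p + 1)) (R2, M2)" "S p R2 M2"
      using l by blast
    have "(w p + 2) ^ k + (w p + 2) ^ l \<le> (w p + 2) ^ (k + l + 1)"
    proof -
      have "(w p + 2) ^ k \<le> (w p + 2) ^ (k + l)" "(w p + 2) ^ l \<le> (w p + 2) ^ (k + l)"
        by (auto intro!: power_increasing)
      then have "(w p + 2) ^ k + (w p + 2) ^ l \<le> 2 * (w p + 2) ^ (k + l)" by linarith
      also have "\<dots> \<le> (w p + 2) * (w p + 2) ^ (k + l)" by (rule mult_le_mono1) simp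
      finally show ?thesis by simp
    qed
    then have "((w p + 2) ^ k + (w p + 2) ^ l) * (z p + 1) \<le> (w p + 2) ^ (k + l + 1) * (z p + 1)"
      by (rule mult_le_mono1)
    then have "run (Seq c d) (R, M) ((w p + 2) ^ (k + l + 1) * (z p + 1)) (R2, M2)"
      using run_mono[OF run_Seq[OF 1(1) 2(1)]] by (simp add: distrib_right)
    then show "\<exists>R' M'. run (Seq c d) (R, M) ((w p + 2) ^ (k + l + 1) * (z p + 1)) (R', M') \<and> S p R' M'"
      using 2 by blast
  qed
qed

lemma le_time_bound: "x \<le> (y + 2) ^ k \<Longrightarrow> x \<le> (y + 2) ^ k * (z + 1)" for x y z :: nat
  by (rule order_trans[of _ "(y + 2) ^ k * 1"]) (auto simp del: mult_1_right mult_Suc_right intro: mult_le_mono2)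

lemma triple_Const: "triple w z (\<lambda>p R M. Q p (R(r := k)) M) (Const r k) Q"
proof (rule tripleI)
  fix p R M assume Q: "Q p (R(r := k)) M"
  have "bits k \<le> 2 ^ (k + 1)"
    using bits_le_Suc[of k] less_exp[of "k + 1"] by linarith
  also have "\<dots> \<le> (w p + 2) ^ (k + 1)" by (rule power_mono) auto
  finally have "run (Const r k) (R, M) ((w p + 2) ^ (k + 1) * (z p + 1)) (R(r := k), M)"
    by (intro run_mono[OF run_Const] le_time_bound)
  then show "\<exists>R' M'. run (Const r k) (R, M) ((w p + 2) ^ (k + 1) * (z p + 1)) (R', M') \<and> Q p R' M'"
    using Q by blast
qed

lemma two_le_square: "2 * (x + 2) \<le> (x + 2) ^ 2" for x :: nat
  unfolding power2_eq_square by (rule mult_le_mono1) simp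

lemma triple_Arith:
  "triple w z (\<lambda>p R M. bits (R x) \<le> w p + 2 \<and> bits (R y) \<le> w p + 2 \<and>
     Q p (R(r := arith_val f (R x) (R y))) M) (Arith r f x y) Q"
proof (rule tripleI)
  fix p R M
  assume *: "bits (R x) \<le> w p + 2 \<and> bits (R y) \<le> w p + 2 \<and> Q p (R(r := arith_val f (R x) (R y))) M"
  then have "bits (R x) + bits (R y) \<le> 2 * (w p + 2)" unfolding add_mult_distrib2 by linarith
  also have "\<dots> \<le> (w p + 2) ^ 2" by (rule two_le_square)
  finally have "bits (R x) + bits (R y) \<le> (w p + 2) ^ 2" .
  then have "run (Arith r f x y) (R, M) ((w p + 2) ^ 2 * (z p + 1)) (R(r := arith_val f (R x) (R y)), M)"
    by (intro run_mono[OF run_Arith] le_time_bound)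
  then show "\<exists>R' M'. run (Arith r f x y) (R, M) ((w p + 2) ^ 2 * (z p + 1)) (R', M') \<and> Q p R' M'"
    using * by blast
qed

lemma triple_Store:
  "triple w z (\<lambda>p R M. bits (R x) \<le> w p + 2 \<and> bits (R y) \<le> w p + 2 \<and>
     Q p R (M(R x := R y))) (Store x y) Q"
proof (rule tripleI)
  fix p R M
  assume *: "bits (R x) \<le> w p + 2 \<and> bits (R y) \<le> w p + 2 \<and> Q p R (M(R x := R y))"
  then have "bits (R x) + bits (R y) \<le> 2 * (w p + 2)" unfolding add_mult_distrib2 by linarith
  also have "\<dots> \<le> (w p + 2) ^ 2" by (rule two_le_square)
  finally have "bits (R x) + bits (R y) \<le> (w p + 2) ^ 2" .
  then have "run (Store x y) (R, M) ((w p + 2) ^ 2 * (z p + 1)) (R, M(R x := R y))"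
    by (intro run_mono[OF run_Store] le_time_bound)
  then show "\<exists>R' M'. run (Store x y) (R, M) ((w p + 2) ^ 2 * (z p + 1)) (R', M') \<and> Q p R' M'"
    using * by blast
qed

text \<open>The precondition ranges over all \<open>R'\<close> that agree below \<open>e\<close> and
  hold the value at \<open>e\<close>, because compiled code leaves the scratch registers above
  \<open>e\<close> unspecified.\<close>

lemma triple_compile:
  assumes "0 < e" "\<forall>r\<in>set rs. r < e"
  shows "triple w z (\<lambda>p R M. reads_matrix (A p) R M \<and> R 0 \<le> w p \<and> (\<forall>r\<in>set rs. R r \<le> w p) \<and>
     (\<forall>R'. R' e = ev (A p) E (map R rs) \<and> (\<forall>r<e. R' r = R r) \<longrightarrow> Q p R' M)) (compile E rs e) Q"
proof -
  obtain F where F: "compiled E F" using compile_correct by blast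
  then have "poly_bounded F" unfolding compiled_def by blast
  then obtain k where k: "\<And>v. F v \<le> (v + 2) ^ k" by (rule poly_boundedD) blast
  show ?thesis
  proof (rule tripleI)
    fix p R M
    assume *: "reads_matrix (A p) R M \<and> R 0 \<le> w p \<and> (\<forall>r\<in>set rs. R r \<le> w p) \<and>
     (\<forall>R'. R' e = ev (A p) E (map R rs) \<and> (\<forall>r<e. R' r = R r) \<longrightarrow> Q p R' M)"
    obtain R' where R': "run (compile E rs e) (R, M) (F (w p)) (R', M)"
      "R' e = ev (A p) E (map R rs)" "\<And>r. r < e \<Longrightarrow> R' r = R r"
      by (rule compiledD[OF F, of "A p" R M "w p" e rs]) (use * assms in auto)
    have "run (compile E rs e) (R, M) ((w p + 2) ^ k * (z p + 1)) (R', M)"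
      by (intro run_mono[OF R'(1)] le_time_bound k)
    then show "\<exists>R' M'. run (compile E rs e) (R, M) ((w p + 2) ^ k * (z p + 1)) (R', M') \<and> Q p R' M'"
      using * R' by blast
  qed
qed

lemma countdown_cost:
  fixes i k w z :: nat
  assumes "i \<le> w"
  shows "i * ((w + 2) ^ k * (z + 1) + i + 1) + 1 \<le> (w + 2) ^ (k + 3) * (z + 1)"
proof -
  let ?X = "w + 2"
  let ?V = "?X ^ (k + 3) * (z + 1)"
  have "i * ((w + 2) ^ k * (z + 1) + i + 1) \<le> ?X * (?X ^ k * (z + 1) + ?X)"
    using assms by (intro mult_le_mono) auto
  also have "\<dots> = ?X * (?X ^ k * (z + 1)) + ?X * ?X" by (rule distrib_left)
  finally have 1: "i * ((w + 2) ^ k * (z + 1) + i + 1) \<le> ?X * (?X ^ k * (z + 1)) + ?X * ?X" .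
  have V: "?V = ?X * ?X * (?X * (?X ^ k * (z + 1)))" by (simp only: power_add power3_eq_cube ac_simps)
  have "4 * (?X * (?X ^ k * (z + 1))) \<le> ?V"
    unfolding V using mult_le_mono[of 2 ?X 2 ?X] by (intro mult_le_mono1) simp
  moreover have "2 * (?X * ?X) \<le> ?V"
  proof -
    have "0 < ?X ^ k * (z + 1)" by simp
    then have "1 \<le> ?X ^ k * (z + 1)" by linarith
    then have "2 * 1 \<le> ?X * (?X ^ k * (z + 1))" by (intro mult_le_mono) auto
    then have "?X * ?X * (2 * 1) \<le> ?V" unfolding V by (rule mult_le_mono2)
    then show ?thesis by simp
  qed
  moreover have "4 \<le> ?X * ?X" using mult_le_mono[of 2 ?X 2 ?X] by simp
  ultimately show ?thesis using 1 by linarith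
qed

text \<open>The body is a single triple over pairs of parameter and counter. This makes its exponent
  the same in every round; the at most \<open>w p\<close> rounds then only raise the exponent by a
  constant.\<close>

lemma triple_countdown:
  assumes body: "triple (\<lambda>x. w (fst x)) (\<lambda>x. z (fst x)) (\<lambda>x. I (fst x) (Suc (snd x))) c
      (\<lambda>x. I (fst x) (snd x))"
    and counter: "\<And>p i R M. I p i R M \<Longrightarrow> R r = i \<and> i \<le> w p"
  shows "triple w z (\<lambda>p R M. (\<exists>i. I p i R M) \<and> (\<forall>R' M'. I p 0 R' M' \<longrightarrow> Q p R' M')) (While r c) Q"
proof -
  obtain k where k: "\<And>x R M. I (fst x) (Suc (snd x)) R M \<Longrightarrow>
     \<exists>R' M'. run c (R, M) ((w (fst x) + 2) ^ k * (z (fst x) + 1)) (R', M') \<and> I (fst x) (snd x) R' M'"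
    using body by (rule tripleE) blast
  show ?thesis
  proof (rule tripleI)
    fix p R M
    assume *: "(\<exists>i. I p i R M) \<and> (\<forall>R' M'. I p 0 R' M' \<longrightarrow> Q p R' M')"
    then obtain i where i: "I p i R M" by blast
    have "\<exists>s'. run (While r c) (R, M) (i * ((w p + 2) ^ k * (z p + 1) + i + 1) + 1) s' \<and>
        (case s' of (R', M') \<Rightarrow> I p 0 R' M')"
    proof (rule run_countdown[where I = "\<lambda>i s. case s of (R', M') \<Rightarrow> I p i R' M'"])
      fix j s assume "case s of (R', M') \<Rightarrow> I p (Suc j) R' M'"
      then show "\<exists>s'. run c s ((w p + 2) ^ k * (z p + 1)) s' \<and> (case s' of (R', M') \<Rightarrow> I p j R' M')"
        using k[of "(p, j)"] by (cases s) fastforce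
    next
      fix j s assume "case s of (R', M') \<Rightarrow> I p j R' M'"
      then show "fst s r = j" using counter by (cases s) auto
    qed (use i in auto)
    then obtain R' M' where R': "run (While r c) (R, M) (i * ((w p + 2) ^ k * (z p + 1) + i + 1) + 1) (R', M')"
      "I p 0 R' M'" by auto
    have "run (While r c) (R, M) ((w p + 2) ^ (k + 3) * (z p + 1)) (R', M')"
      by (rule run_mono[OF R'(1)], rule countdown_cost) (use counter[OF i] in simp)
    then show "\<exists>R' M'. run (While r c) (R, M) ((w p + 2) ^ (k + 3) * (z p + 1)) (R', M') \<and> Q p R' M'"
      using R'(2) * by blast
  qed
qed

text \<open>The one rule that spends the factor \<open>z p + 1\<close>: the original run takes at
  most \<open>z p\<close> steps of time, and the slowdown is linear in
  \<open>w p + 2\<close>.\<close>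

lemma triple_relocate:
  assumes "reg_bound c \<le> v"
  shows "triple w z (\<lambda>p R M. \<exists>s t s'. exec c s t s' \<and> t \<le> z p \<and> 0 < R 6 \<and>
      bits (R 5) \<le> w p + 2 \<and> bits (R 6) \<le> w p + 2 \<and> simulates v (R 5) (R 6) s (R, M) \<and>
      (\<forall>R' M'. simulates v (R 5) (R 6) s' (R', M') \<and> outside_eq (R 5) (R 6) (R, M) (R', M') \<longrightarrow> Q p R' M'))
    (relocate c) Q"
proof (rule tripleI)
  fix p R M
  assume "\<exists>s t s'. exec c s t s' \<and> t \<le> z p \<and> 0 < R 6 \<and>
      bits (R 5) \<le> w p + 2 \<and> bits (R 6) \<le> w p + 2 \<and> simulates v (R 5) (R 6) s (R, M) \<and>
      (\<forall>R' M'. simulates v (R 5) (R 6) s' (R', M') \<and> outside_eq (R 5) (R 6) (R, M) (R', M') \<longrightarrow> Q p R' M')"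
  then obtain s t s' where *: "exec c s t s'" "t \<le> z p" "0 < R 6" "bits (R 5) \<le> w p + 2"
    "bits (R 6) \<le> w p + 2" "simulates v (R 5) (R 6) s (R, M)"
    "\<And>R' M'. simulates v (R 5) (R 6) s' (R', M') \<Longrightarrow> outside_eq (R 5) (R 6) (R, M) (R', M') \<Longrightarrow> Q p R' M'"
    by blast
  obtain R' M' where R': "run (relocate c) (R, M) ((4 * bits (R 5) + 4 * bits (R 6)) * t) (R', M')"
    "simulates v (R 5) (R 6) s' (R', M')" "outside_eq (R 5) (R 6) (R, M) (R', M')"
    using relocate_correct[OF *(1) assms *(6,3)] by (metis surj_pair)
  have "4 * bits (R 5) + 4 * bits (R 6) \<le> 8 * (w p + 2)"
    using *(4,5) unfolding add_mult_distrib2 by linarith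
  also have "8 * (w p + 2) \<le> (w p + 2) ^ 4"
  proof -
    have "2 ^ 3 \<le> (w p + 2) ^ 3" by (rule power_mono) auto
    then have "8 * (w p + 2) \<le> (w p + 2) ^ 3 * (w p + 2)" by (intro mult_le_mono1) simp
    then show ?thesis by (simp add: power_numeral_reduce mult.commute)
  qed
  finally have "(4 * bits (R 5) + 4 * bits (R 6)) * t \<le> (w p + 2) ^ 4 * (z p + 1)"
    using *(2) by (intro mult_le_mono) auto
  then have "run (relocate c) (R, M) ((w p + 2) ^ 4 * (z p + 1)) (R', M')"
    by (rule run_mono[OF R'(1)])
  then show "\<exists>R' M'. run (relocate c) (R, M) ((w p + 2) ^ 4 * (z p + 1)) (R', M') \<and> Q p R' M'"
    using R' * by blast
qed

fun clear :: "nat \<Rightarrow> com" where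
  "clear 0 = Skip"
| "clear (Suc v) = Seq (clear v) (Const (v + 40) 0)"

lemma triple_clear:
  "triple w z (\<lambda>p R M. Q p (\<lambda>r. if 40 \<le> r \<and> r < 40 + v then 0 else R r) M) (clear v) Q"
proof (induction v arbitrary: Q)
  case 0
  show ?case
  proof (rule tripleI)
    fix p R M assume *: "Q p (\<lambda>r. if 40 \<le> r \<and> r < 40 + 0 then 0 else R r) M"
    have "(\<lambda>r. if 40 \<le> r \<and> r < 40 + 0 then 0 else R r) = R" by auto
    moreover have "run Skip (R, M) 1 (R, M)" unfolding run_def using Skip by blast
    ultimately show "\<exists>R' M'. run (clear 0) (R, M) ((w p + 2) ^ 0 * (z p + 1)) (R', M') \<and> Q p R' M'"
      using * by (auto intro: run_mono)
  qed
next
  case (Suc v)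
  show ?case
    unfolding clear.simps
  proof (rule triple_Seq[OF triple_Const], rule triple_pre[OF Suc])
    fix p R M assume *: "Q p (\<lambda>r. if 40 \<le> r \<and> r < 40 + Suc v then 0 else R r) M"
    have "(\<lambda>r. if 40 \<le> r \<and> r < 40 + v then 0 else R r)(v + 40 := 0) =
      (\<lambda>r. if 40 \<le> r \<and> r < 40 + Suc v then 0 else R r)" by auto
    then show "Q p ((\<lambda>r. if 40 \<le> r \<and> r < 40 + v then 0 else R r)(v + 40 := 0)) M" using * by simp
  qed
qed

section \<open>The program for the permanent\<close>

lemma bits_le_bound: "x \<le> v \<Longrightarrow> bits x \<le> v + 2"
  using bits_le_Suc[of x] by linarith

definition baseE :: expr where
  "baseE = EBin Add (EBin Mul (EVar 0) (EVar 0)) (EVar 1)"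

definition strideE :: expr where
  "strideE = EBin Add moduliE (ENum 1)"

lemma ev_baseE: "ev A baseE [n, M] = n * n + M"
  by (simp add: baseE_def)

text \<open>Larger than every modulus, so the starting addresses \<open>n * n + M\<close> differ
  modulo the stride and the progressions for different moduli are disjoint.\<close>

definition stride :: "nat \<Rightarrow> nat" where
  "stride n = moduli n + 1"

lemma ev_strideE: "ev A strideE [n] = stride n"
  by (simp add: strideE_def stride_def ev_moduliE)

text \<open>The bracket is the bound for memory addresses. The accumulated residue, its modulus and
  the answers of the given program are too large to be bounded by value; the other terms bound their
  bit lengths, as well as the parameters of the instance.\<close>

definition work_bound :: "nat \<Rightarrow> nat \<Rightarrow> nat" where
  "work_bound K n = (n * n + moduli n + stride n * (numbers K n * ground K n + 1))
     + moduli n * moduli n + moduli n + codes K n + ground K n + numbers K n + block K n + n + 10"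

locale reduction =
  fixes K :: nat and c :: com and \<tau> :: "nat \<Rightarrow> nat"
  assumes K: "1 \<le> K"
    and solver: "\<And>n A M. 1 \<le> M \<Longrightarrow> M \<le> moduli n \<Longrightarrow>
      \<exists>t s'. exec c (cover_input [0..<ground K n] (family K A n M)) t s' \<and> t \<le> \<tau> n \<and>
        fst s' 0 = card (exact_covers {..<ground K n} (set (family K A n M)))"
begin

abbreviation "W \<equiv> work_bound K"

section \<open>Invariants and phases of the loop over the moduli\<close>

definition zero_one :: "nat \<Rightarrow> (nat \<Rightarrow> nat) \<Rightarrow> bool" where
  "zero_one n a \<longleftrightarrow> (\<forall>x. a x \<le> 1 \<and> (n * n \<le> x \<longrightarrow> a x = 0))"

text \<open>The moduli are used in decreasing order and register \<open>1\<close> holds the next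
  one, so those above \<open>M\<close> are done. Register \<open>3\<close> is a common multiple of
  the moduli done and register \<open>2\<close> is the permanent modulo it; the size bound gains one
  factor \<open>moduli n\<close> per modulus.\<close>

definition core :: "nat \<Rightarrow> (nat \<Rightarrow> nat) \<Rightarrow> nat \<Rightarrow> (reg \<Rightarrow> nat) \<Rightarrow> bool" where
  "core n a M R \<longleftrightarrow> zero_one n a \<and> M \<le> moduli n \<and> R 0 = n \<and> R 1 = M \<and> R 4 = codes K n \<and>
     0 < R 3 \<and> R 3 \<le> moduli n ^ (moduli n - M) \<and> (\<forall>j. M < j \<longrightarrow> j \<le> moduli n \<longrightarrow> j dvd R 3) \<and>
     R 2 = matchings a n mod R 3"

text \<open>Nothing is claimed about the progressions of moduli already used: the given program may
  have left anything there.\<close>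

definition fresh :: "nat \<Rightarrow> (nat \<Rightarrow> nat) \<Rightarrow> nat \<Rightarrow> (nat \<Rightarrow> nat) \<Rightarrow> bool" where
  "fresh n a M Mem \<longleftrightarrow> (\<forall>x<n * n. Mem x = a x) \<and>
     (\<forall>j x. 1 \<le> j \<longrightarrow> j \<le> M \<longrightarrow> Mem (n * n + j + stride n * x) = 0)"

text \<open>The incidence matrix is written from its end, so the loop counter \<open>l\<close> is
  also the index of the last entry written, and \<open>l = 0\<close> means that the input is
  complete.\<close>

definition filling :: "nat \<Rightarrow> (nat \<Rightarrow> nat) \<Rightarrow> nat \<Rightarrow> nat \<Rightarrow> (reg \<Rightarrow> nat) \<Rightarrow> (nat \<Rightarrow> nat) \<Rightarrow> bool" where
  "filling n a M l R Mem \<longleftrightarrow> core n a M R \<and> 1 \<le> M \<and> fresh n a (M - 1) Mem \<and>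
     R 5 = n * n + M \<and> R 6 = stride n \<and> R 8 = length (goods K a n M) \<and> R 9 = ground K n \<and>
     R 10 = l \<and> l \<le> length (goods K a n M) * ground K n \<and>
     (\<forall>x. Mem (n * n + M + stride n * x) =
        (if l \<le> x \<and> x < length (goods K a n M) * ground K n then entry K a n M x else 0))"

definition called :: "nat \<Rightarrow> (nat \<Rightarrow> nat) \<Rightarrow> nat \<Rightarrow> (reg \<Rightarrow> nat) \<Rightarrow> (nat \<Rightarrow> nat) \<Rightarrow> bool" where
  "called n a M R Mem \<longleftrightarrow> core n a M R \<and> 1 \<le> M \<and> fresh n a (M - 1) Mem \<and>
     R 40 = card (exact_covers {..<ground K n} (set (family K a n M)))"

lemma reads_matrix_core: "zero_one n a \<Longrightarrow> R 0 = n \<Longrightarrow> fresh n a M Mem \<Longrightarrow> reads_matrix a R Mem"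
  unfolding reads_matrix_def zero_one_def fresh_def by auto

lemma core_le: "core n a M R \<Longrightarrow> R 0 \<le> W n \<and> R 1 \<le> W n \<and> R 4 \<le> W n"
  by (auto simp: core_def work_bound_def)

lemma moduli_pos: "1 \<le> moduli n"
  by (simp add: moduli_def)

lemma core_bits:
  assumes "core n a M R"
  shows "bits (R 3) \<le> moduli n * moduli n" "bits (R 2) \<le> moduli n * moduli n"
proof -
  have "R 3 \<le> moduli n ^ (moduli n - M)" using assms by (simp add: core_def)
  also have "\<dots> \<le> moduli n ^ moduli n" using moduli_pos by (intro power_increasing) auto
  also have "\<dots> < (2 ^ moduli n) ^ moduli n"
    using moduli_pos[of n] by (intro power_strict_mono less_exp) auto
  finally have 3: "R 3 < 2 ^ (moduli n * moduli n)" by (simp add: power_mult)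
  have 1: "1 \<le> moduli n * moduli n" using moduli_pos[of n] by simp
  show "bits (R 3) \<le> moduli n * moduli n" by (rule bits_le[OF 3 1])
  have "R 2 < R 3" using assms by (simp add: core_def)
  then show "bits (R 2) \<le> moduli n * moduli n" by (intro bits_le[OF _ 1] less_trans[OF _ 3])
qed

lemma region_inj:
  assumes "n * n + j + stride n * x = n * n + M + stride n * y" "j \<le> moduli n" "M \<le> moduli n"
  shows "j = M \<and> x = y"
proof -
  have "(j + stride n * x) mod stride n = (M + stride n * y) mod stride n"
    using assms(1) by (metis add_left_cancel add.assoc)
  then have "j = M" using assms(2,3) unfolding mod_mult_self2 stride_def by simp
  then have "stride n * x = stride n * y" using assms(1) by simp
  then have "x = y" by (simp add: stride_def mult_cancel1 del: mult_Suc)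
  then show ?thesis using \<open>j = M\<close> by simp
qed

lemma length_goods_le: "length (goods K a n M) \<le> numbers K n"
  unfolding goods_def by (rule order_trans[OF length_filter_le]) simp

definition fill_step :: com where
  "fill_step =
     Seq (Const 11 1)
    (Seq (Arith 10 Sub 10 11)
    (Seq (compile (entryE K) [0, 4, 1, 10] 11)
    (Seq (Arith 12 Mul 6 10)
    (Seq (Arith 12 Add 5 12)
         (Store 12 11)))))"

lemma filling_cong:
  assumes "filling n a M l R Mem" "\<And>r. r < 10 \<Longrightarrow> R' r = R r"
  shows "core n a M R' \<and> R' 5 = n * n + M \<and> R' 6 = stride n \<and>
    R' 8 = length (goods K a n M) \<and> R' 9 = ground K n"
  using assms unfolding filling_def core_def by simp

lemma fresh_upd:
  assumes "fresh n a (M - 1) Mem" "1 \<le> M" "M \<le> moduli n"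
  shows "fresh n a (M - 1) (Mem(n * n + M + stride n * x := v))"
  unfolding fresh_def
proof (intro conjI allI impI)
  show "(Mem(n * n + M + stride n * x := v)) y = a y" if "y < n * n" for y
    using that assms(1) by (simp add: fresh_def)
  fix j y assume j: "1 \<le> j" "j \<le> M - 1"
  then have "n * n + j + stride n * y \<noteq> n * n + M + stride n * x"
    using region_inj[of n j y M x] assms(2,3) by linarith
  then show "(Mem(n * n + M + stride n * x := v)) (n * n + j + stride n * y) = 0"
    using assms(1) j by (simp add: fresh_def)
qed

lemma address_le:
  assumes "M \<le> moduli n" "x \<le> numbers K n * ground K n"
  shows "n * n + M + stride n * x \<le> W n"
proof -
  have "stride n * x \<le> stride n * (numbers K n * ground K n + 1)"
    using assms(2) by (intro mult_le_mono2) simp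
  then show ?thesis using assms(1) unfolding work_bound_def by linarith
qed

lemma entries_le: "numbers K n * ground K n + 1 \<le> W n"
proof -
  have "numbers K n * ground K n + 1 \<le> stride n * (numbers K n * ground K n + 1)"
    unfolding stride_def by (metis le_add2 mult_1 mult_le_mono1)
  then show ?thesis unfolding work_bound_def by linarith
qed

lemma fill_step_correct:
  "triple (\<lambda>x. W (fst (fst x))) z
     (\<lambda>x. filling (fst (fst x)) (fst (snd (fst x))) (snd (snd (fst x))) (Suc (snd x))) fill_step
     (\<lambda>x. filling (fst (fst x)) (fst (snd (fst x))) (snd (snd (fst x))) (snd x))"
  unfolding fill_step_def
  apply (rule triple_pre)
   apply (rule triple_Seq triple_Store triple_Const triple_Arith
      triple_compile[where A = "\<lambda>x. fst (snd (fst x))"] | (simp; fail))+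
  subgoal premises pre for p R Mem
  proof -
    obtain n a M l where p: "p = ((n, a, M), l)" by (metis surj_pair)
    have f: "filling n a M (Suc l) R Mem" using pre by (simp add: p)
    let ?len = "length (goods K a n M) * ground K n"
    let ?R0 = "R(11 := 1, 10 := l)"
    have l: "Suc l \<le> ?len" using f by (simp add: filling_def)
    have len: "?len \<le> numbers K n * ground K n" using length_goods_le by (rule mult_le_mono1)
    have M: "1 \<le> M" "M \<le> moduli n" and core: "core n a M R" and dom: "zero_one n a" and
      fr: "fresh n a (M - 1) Mem" and R: "R 5 = n * n + M" "R 6 = stride n" "R 10 = Suc l"
      using f by (auto simp: filling_def core_def)
    have lW: "l \<le> W n" "Suc l \<le> W n" using l len entries_le[of n] by linarith+
    have "reads_matrix a ?R0 Mem" using reads_matrix_core[of n a ?R0 "M - 1" Mem] dom fr core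
      by (simp add: core_def)
    moreover have "?R0 0 \<le> W n" "\<forall>r\<in>set [0, 4, 1, 10]. ?R0 r \<le> W n"
      using core_le[OF core] lW by auto
    moreover have "bits 1 \<le> W n + 2" by (rule bits_le_bound) (simp add: work_bound_def)
    moreover have "bits (Suc l) \<le> W n + 2" by (rule bits_le_bound[OF lW(2)])
    moreover have "filling n a M l (R'(12 := n * n + M + stride n * l))
        (Mem(n * n + M + stride n * l := entry K a n M l))"
      if v: "R' 10 = l" "\<And>r. r < 10 \<Longrightarrow> R' r = R r" for R'
      unfolding filling_def
    proof (intro conjI allI)
      show "core n a M (R'(12 := n * n + M + stride n * l))"
        using filling_cong[OF f v(2)] by (simp add: core_def)
      show "fresh n a (M - 1) (Mem(n * n + M + stride n * l := entry K a n M l))"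
        by (rule fresh_upd[OF fr M])
      show "(Mem(n * n + M + stride n * l := entry K a n M l)) (n * n + M + stride n * x) =
          (if l \<le> x \<and> x < ?len then entry K a n M x else 0)" for x
      proof (cases "x = l")
        case True
        then show ?thesis using l by simp
      next
        case False
        then have "n * n + M + stride n * x \<noteq> n * n + M + stride n * l"
          using region_inj[of n M x M l] M by blast
        then have "(Mem(n * n + M + stride n * l := entry K a n M l)) (n * n + M + stride n * x) =
            Mem (n * n + M + stride n * x)" by simp
        also have "\<dots> = (if Suc l \<le> x \<and> x < ?len then entry K a n M x else 0)"
          using f by (simp add: filling_def)
        also have "\<dots> = (if l \<le> x \<and> x < ?len then entry K a n M x else 0)"
          using False by auto
        finally show ?thesis .
      qed
    qed (use filling_cong[OF f v(2)] v f M l in \<open>auto simp: filling_def\<close>)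
    moreover have addr: "n * n + M + stride n * l \<le> W n"
      using address_le[OF M(2), of l] l len by simp
    moreover have "bits (stride n) \<le> W n + 2" "bits l \<le> W n + 2" "bits (n * n + M) \<le> W n + 2"
      "bits (stride n * l) \<le> W n + 2" "bits (n * n + M + stride n * l) \<le> W n + 2"
      "bits (entry K a n M l) \<le> W n + 2"
    proof -
      have "stride n \<le> W n" "entry K a n M l \<le> W n"
        by (simp_all add: work_bound_def stride_def entry_def)
      then show "bits (stride n) \<le> W n + 2" "bits (entry K a n M l) \<le> W n + 2"
        by (simp_all only: bits_le_bound)
      show "bits l \<le> W n + 2" by (rule bits_le_bound[OF lW(1)])
      have "n * n + M \<le> W n" "stride n * l \<le> W n" using addr by linarith+
      then show "bits (n * n + M) \<le> W n + 2" "bits (stride n * l) \<le> W n + 2"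
        by (simp_all only: bits_le_bound)
      show "bits (n * n + M + stride n * l) \<le> W n + 2" by (rule bits_le_bound[OF addr])
    qed
    moreover have "R 0 = n" "R (Suc 0) = M" "R 4 = codes K n"
      "ev a (entryE K) [n, codes K n, M, l] = entry K a n M l"
      using core l by (auto simp: core_def ev_entryE)
    ultimately show ?thesis
      by (simp add: p R)
  qed
  done

lemma core_cong: "core n a M R \<Longrightarrow> (\<And>r. r < 5 \<Longrightarrow> R' r = R r) \<Longrightarrow> core n a M R'"
  by (simp add: core_def)

definition prepare :: com where
  "prepare = Seq (compile baseE [0, 1] 5) (Seq (compile strideE [0] 6) (Seq (compile (countE K) [0, 4, 1] 8)
     (Seq (compile (groundE K) [0] 9) (Seq (Arith 10 Mul 8 9) (While 10 fill_step)))))"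

lemma fill_loop_correct:
  "triple (\<lambda>p. W (fst p)) z (\<lambda>p R Mem. (\<exists>l. filling (fst p) (fst (snd p)) (snd (snd p)) l R Mem) \<and>
      (\<forall>R' Mem'. filling (fst p) (fst (snd p)) (snd (snd p)) 0 R' Mem' \<longrightarrow> Q p R' Mem'))
     (While 10 fill_step) Q"
proof (rule triple_countdown[where I = "\<lambda>p. filling (fst p) (fst (snd p)) (snd (snd p))"])
  fix p i R Mem assume f: "filling (fst p) (fst (snd p)) (snd (snd p)) i R Mem"
  obtain n a M where p: "p = (n, a, M)" by (metis surj_pair)
  have "i \<le> length (goods K a n M) * ground K n" using f by (simp add: filling_def p)
  also have "\<dots> \<le> numbers K n * ground K n" by (rule mult_le_mono1) (rule length_goods_le)
  also have "\<dots> \<le> W n" using entries_le[of n] by linarith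
  finally show "R 10 = i \<and> i \<le> W (fst p)" using f by (simp add: filling_def p)
qed (rule fill_step_correct)

lemma prepare_correct:
  "triple (\<lambda>p. W (fst p)) z
     (\<lambda>p R Mem. core (fst p) (fst (snd p)) (snd (snd p)) R \<and> 1 \<le> snd (snd p) \<and>
        fresh (fst p) (fst (snd p)) (snd (snd p)) Mem) prepare
     (\<lambda>p. filling (fst p) (fst (snd p)) (snd (snd p)) 0)"
  unfolding prepare_def
  apply (rule triple_pre)
   apply (rule triple_Seq fill_loop_correct triple_Arith
      triple_compile[where A = "\<lambda>x. fst (snd x)"] | (simp; fail))+
  subgoal premises pre for p R Mem
  proof -
    obtain n a M where p: "p = (n, a, M)" by (metis surj_pair)
    have core: "core n a M R" and M: "1 \<le> M" "M \<le> moduli n" and fr: "fresh n a M Mem"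
      using pre by (auto simp: p core_def)
    have A: "core n a M R' \<and> reads_matrix a R' Mem \<and> R' 0 \<le> W n \<and> R' (Suc 0) \<le> W n \<and> R' 4 \<le> W n \<and>
        R' 0 = n \<and> R' (Suc 0) = M \<and> R' 4 = codes K n"
      if "\<And>r. r < 5 \<Longrightarrow> R' r = R r" for R'
    proof -
      have c: "core n a M R'" by (rule core_cong[OF core that])
      then show ?thesis using core_le[OF c] reads_matrix_core[OF _ _ fr, of R']
        by (auto simp: core_def)
    qed
    have fill: "filling n a M (length (goods K a n M) * ground K n) R' Mem"
      if "core n a M R'" "R' 5 = n * n + M" "R' 6 = stride n" "R' 8 = length (goods K a n M)"
        "R' 9 = ground K n" "R' 10 = length (goods K a n M) * ground K n" for R'
      unfolding filling_def using that M fr by (auto simp: fresh_def)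
    have "length (goods K a n M) \<le> W n" "ground K n \<le> W n"
      using length_goods_le[of a n M] unfolding work_bound_def by linarith+
    then have cnt: "bits (length (goods K a n M)) \<le> W n + 2" "bits (ground K n) \<le> W n + 2"
      by (simp_all only: bits_le_bound)
    show ?thesis
      using A[of R] M cnt
      by (auto simp: p A ev_baseE ev_strideE ev_countE ev_groundE
          intro!: exI[of _ "length (goods K a n M) * ground K n"] fill core_cong[OF core])
  qed
  done

text \<open>The \<open>+ 2\<close> makes registers \<open>0\<close> and \<open>1\<close> part of the
  simulation whatever the given program mentions, so its inputs can be placed in \<open>40\<close>
  and \<open>41\<close> and its result read from \<open>40\<close>.\<close>

definition call :: com where
  "call = Seq (clear (reg_bound c + 2)) (Seq (Const 11 0) (Seq (Arith 40 Add 9 11)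
     (Seq (Arith 41 Add 8 11) (relocate c))))"

lemma cover_input_family:
  "snd (cover_input [0..<ground K n] (family K a n M)) x =
     (if x < length (goods K a n M) * ground K n then entry K a n M x else 0)"
proof (cases "x < length (goods K a n M) * ground K n")
  case True
  then have u: "0 < ground K n" by (cases "ground K n") auto
  then have "x mod ground K n < ground K n" by simp
  moreover have "x div ground K n < length (goods K a n M)"
    using True by (rule less_mult_imp_div_less)
  ultimately show ?thesis
    using True by (simp add: cover_input_def family_def entry_def)
next
  case False
  then show ?thesis by (simp add: cover_input_def family_def)
qed

lemma cover_input_regs:
  "fst (cover_input [0..<ground K n] (family K a n M)) =
     (\<lambda>_. 0)(0 := ground K n, 1 := length (goods K a n M))"
  by (simp add: cover_input_def family_def)

lemma call_correct:
  "triple (\<lambda>p. W (fst p)) (\<lambda>p. \<tau> (fst p))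
     (\<lambda>p. filling (fst p) (fst (snd p)) (snd (snd p)) 0) call
     (\<lambda>p. called (fst p) (fst (snd p)) (snd (snd p)))"
  unfolding call_def
  apply (rule triple_pre)
   apply (rule triple_Seq triple_clear triple_Arith triple_Const
      triple_relocate[where v = "reg_bound c + 2"] | (simp; fail))+
  subgoal premises pre for p R Mem
  proof -
    obtain n a M where p: "p = (n, a, M)" by (metis surj_pair)
    have f: "filling n a M 0 R Mem" using pre by (simp add: p)
    have M: "1 \<le> M" "M \<le> moduli n" and core: "core n a M R" and fr: "fresh n a (M - 1) Mem"
      and R: "R 5 = n * n + M" "R 6 = stride n" "R 8 = length (goods K a n M)" "R 9 = ground K n"
      and mem: "\<And>x. Mem (n * n + M + stride n * x) =
        (if x < length (goods K a n M) * ground K n then entry K a n M x else 0)"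
      using f by (auto simp: filling_def core_def)
    obtain t s' where s': "exec c (cover_input [0..<ground K n] (family K a n M)) t s'" "t \<le> \<tau> n"
      "fst s' 0 = card (exact_covers {..<ground K n} (set (family K a n M)))"
      using solver[OF M] by blast
    have "length (goods K a n M) \<le> W n" "ground K n \<le> W n" "stride n \<le> W n" "n * n + M \<le> W n" "0 \<le> W n"
      using length_goods_le[of a n M] address_le[OF M(2), of 0] unfolding work_bound_def stride_def
      by linarith+
    then have b: "bits (length (goods K a n M)) \<le> W n + 2" "bits (ground K n) \<le> W n + 2"
      "bits (stride n) \<le> W n + 2" "bits (n * n + M) \<le> W n + 2" "bits 0 \<le> W n + 2"
      by (simp_all only: bits_le_bound)
    let ?R = "(\<lambda>r. if 40 \<le> r \<and> r < 40 + (reg_bound c + 2) then 0 else R r)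
      (11 := 0, 40 := ground K n, 41 := length (goods K a n M))"
    have sim: "simulates (reg_bound c + 2) (n * n + M) (stride n)
        (cover_input [0..<ground K n] (family K a n M)) (?R, Mem)"
      unfolding simulates_def cover_input_regs cover_input_family using R mem by auto
    have post: "called n a M R' Mem'"
      if "simulates (reg_bound c + 2) (n * n + M) (stride n) s' (R', Mem')"
        "outside_eq (n * n + M) (stride n) (?R, Mem) (R', Mem')" for R' Mem'
    proof -
      have r: "R' r = R r" if "r < 5" for r
        using \<open>outside_eq (n * n + M) (stride n) (?R, Mem) (R', Mem')\<close> that by (simp add: outside_eq_def)
      have m: "Mem' x = Mem x" if "\<And>i. x \<noteq> n * n + M + stride n * i" for x
        using \<open>outside_eq (n * n + M) (stride n) (?R, Mem) (R', Mem')\<close> that by (simp add: outside_eq_def)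
      have "fresh n a (M - 1) Mem'"
        unfolding fresh_def
      proof (intro conjI allI impI)
        show "Mem' x = a x" if "x < n * n" for x
          using m[of x] that fr by (simp add: fresh_def)
        fix j x assume j: "1 \<le> j" "j \<le> M - 1"
        have "n * n + j + stride n * x \<noteq> n * n + M + stride n * i" for i
          using region_inj[of n j x M i] j M by linarith
        then show "Mem' (n * n + j + stride n * x) = 0"
          using m j fr by (simp add: fresh_def)
      qed
      moreover have "R' (0 + 40) = fst s' 0"
        using that(1) unfolding simulates_def by (metis add_gr_0 fst_conv zero_less_numeral)
      ultimately show ?thesis
        using core_cong[OF core r] M s'(3) by (simp add: called_def)
    qed
    have "\<exists>s t s'. exec c s t s' \<and> t \<le> \<tau> n \<and>
        simulates (reg_bound c + 2) (n * n + M) (stride n) s (?R, Mem) \<and>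
        (\<forall>R' Mem'. simulates (reg_bound c + 2) (n * n + M) (stride n) s' (R', Mem') \<and>
           outside_eq (n * n + M) (stride n) (?R, Mem) (R', Mem') \<longrightarrow> called n a M R' Mem')"
      using s'(1,2) sim post by blast
    moreover have "0 < stride n" by (simp add: stride_def)
    ultimately show ?thesis
      using b by (simp add: p R del: split_paired_Ex)
  qed
  done

text \<open>Compiled expressions take time polynomial in the values of their arguments, not in their
  bit lengths. The three large numbers are therefore reduced modulo \<open>M\<close> first, and only
  single arithmetic instructions touch them directly.\<close>

definition combine :: com where
  "combine = Seq (Arith 8 Mod 40 1) (Seq (Arith 9 Mod 2 1) (Seq (Arith 10 Mod 3 1)
     (Seq (compile quotE [1, 8, 9, 10] 11) (Seq (compile factorE [1, 10] 12)
     (Seq (Arith 11 Mul 3 11) (Seq (Arith 2 Add 2 11) (Seq (Arith 3 Mul 3 12)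
     (Seq (Const 11 1) (Arith 1 Sub 1 11)))))))))"

lemma combine_correct:
  "triple (\<lambda>p. W (fst p)) z
     (\<lambda>p. called (fst p) (fst (snd p)) (Suc (snd (snd p)))) combine
     (\<lambda>p R Mem. core (fst p) (fst (snd p)) (snd (snd p)) R \<and>
        fresh (fst p) (fst (snd p)) (snd (snd p)) Mem)"
  unfolding combine_def
  apply (rule triple_pre)
   apply (rule triple_Seq triple_Arith triple_Const
      triple_compile[where A = "\<lambda>x. fst (snd x)"] | (simp; fail))+
  subgoal premises pre for p R Mem
  proof -
    obtain n a i where p: "p = (n, a, i)" by (metis surj_pair)
    define M where M_def: "M = Suc i"
    let ?P = "matchings a n" and ?L = "R 3"
    interpret instance_params K n a by unfold_locales (rule K)
    have core: "core n a M R" and M: "1 \<le> M" "M \<le> moduli n" and fr: "fresh n a i Mem"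
      and res: "R 40 = card (exact_covers {..<ground K n} (set (family K a n M)))"
      using pre by (auto simp: p called_def core_def M_def)
    have L: "0 < ?L" "R 2 = ?P mod ?L" "R 1 = M" "R 0 = n" "R 4 = codes K n" and dom: "zero_one n a"
      using core by (auto simp: core_def)
    have r: "R 40 mod M = ?P mod M"
      unfolding res by (rule card_exact_covers_mod[OF M])
    let ?q = "ev a quotE [M, ?P mod M, ?P mod ?L mod M, ?L mod M]"
    let ?f = "ev a factorE [M, ?L mod M]"
    have q: "?P mod ?L + ?L * ?q = ?P mod lcm ?L M" "?q \<le> M"
      using ev_quotE[OF L(1) M(1), where p = ?P and A = a] by simp_all
    have f: "?L * ?f = lcm ?L M" using ev_factorE[OF L(1) M(1), of a] .
    have new: "core n a i R'"
      if "R' 0 = n" "R' 1 = i" "R' 2 = ?P mod lcm ?L M" "R' 3 = lcm ?L M" "R' 4 = codes K n" for R'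
      unfolding core_def
    proof (intro conjI allI impI)
      show "0 < R' 3" using that L M(1) by (simp add: lcm_pos_nat)
      \<comment> \<open>One more modulus costs at most one more factor \<open>moduli n\<close>,
        matching the exponent \<open>moduli n - i\<close>.\<close>
      have "lcm ?L M \<le> ?L * M" using L(1) M(1) by (intro dvd_imp_le) auto
      also have "\<dots> \<le> moduli n ^ (moduli n - M) * moduli n"
        using core M by (intro mult_le_mono) (auto simp: core_def)
      also have "\<dots> = moduli n ^ (moduli n - i)"
        using M(2) unfolding M_def by (simp add: Suc_diff_Suc flip: power_Suc2)
      finally show "R' 3 \<le> moduli n ^ (moduli n - i)" using that by simp
      show "j dvd R' 3" if "i < j" "j \<le> moduli n" for j
      proof (cases "j = M")
        case True
        then show ?thesis using \<open>R' 3 = lcm ?L M\<close> by simp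
      next
        case False
        then have "j dvd ?L" using that core by (simp add: core_def M_def)
        then show ?thesis using \<open>R' 3 = lcm ?L M\<close> by (simp add: dvd_lcmI1)
      qed
    qed (use that dom M in \<open>auto simp: M_def\<close>)
    have fM: "?f \<le> M"
    proof -
      have "?L * ?f \<le> ?L * M" unfolding f using L(1) M(1) by (intro dvd_imp_le) auto
      then show ?thesis using L(1) by (simp only: nat_mult_le_cancel1)
    qed
    have small: "x \<le> W n" if "x \<le> M" for x
      using that M(2) unfolding work_bound_def by linarith
    have bits_small: "bits x \<le> W n + 2" if "x \<le> M" for x
      by (rule bits_le_bound[OF small[OF that]])
    have big: "moduli n * moduli n + moduli n + 1 \<le> W n" unfolding work_bound_def by linarith
    have b3: "bits ?L \<le> W n + 2" "bits (?P mod ?L) \<le> W n + 2"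
      using core_bits[OF core] big unfolding L(2) by linarith+
    have b11: "bits (?L * ?q) \<le> W n + 2"
      using bits_mult_le[of ?L ?q] core_bits(1)[OF core] big q(2) bits_le_Suc[of ?q] M(2) by linarith
    have b40: "bits (R 40) \<le> W n + 2"
    proof -
      let ?F = "set (family K a n M)"
      \<comment> \<open>Solutions are subfamilies, so the answer has at most one bit more than the
        family has members.\<close>
      have "R 40 \<le> card (Pow ?F)"
        unfolding res by (rule card_mono) (auto simp: exact_covers_def)
      also have "\<dots> = 2 ^ card ?F" by (rule card_Pow) simp
      also have "\<dots> \<le> 2 ^ numbers K n"
        using card_length[of "family K a n M"] length_goods_le[of a n M]
        by (intro power_increasing) (simp_all add: family_def)
      also have "\<dots> < 2 ^ (numbers K n + 1)" by simp
      finally have "bits (R 40) \<le> numbers K n + 1" by (rule bits_le) simp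
      then show ?thesis unfolding work_bound_def by linarith
    qed
    have reads: "reads_matrix a R' Mem" if "R' 0 = n" for R'
      by (rule reads_matrix_core[of n a R' i, OF dom that fr])
    have nW: "n \<le> W n" unfolding work_bound_def by linarith
    have mods: "R 40 mod M \<le> M" "?P mod M \<le> M" "?P mod ?L mod M \<le> M" "?L mod M \<le> M" "Suc 0 \<le> M" "M \<le> M"
      using M(1) by (simp_all add: less_imp_le)
    have Mi: "M - Suc 0 = i" by (simp add: M_def)
    note smalls = mods[THEN small] mods[THEN bits_small] bits_small[OF fM] bits_small[OF q(2)]
    have step: "core n a i (R''(2 := ?P mod lcm ?L M, 3 := lcm ?L M, 11 := Suc 0, Suc 0 := i)) \<and> fresh n a i Mem"
      if "R' 11 = ?q \<and> (\<forall>r<11. R' r = (if r = 10 then ?L mod M else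
          (R(8 := ?P mod M, 9 := ?P mod ?L mod M)) r))"
        "R'' 12 = ?f \<and> (\<forall>r<12. R'' r = R' r)" for R' R''
      using that L fr by (intro conjI new) simp_all
    show ?thesis
      using smalls b3 b11 b40 nW
      by (simp add: p M_def[symmetric] L L(3)[unfolded One_nat_def] r reads q(1) f Mi step
          del: split_paired_All cong: conj_cong)
  qed
  done

definition main_body :: com where
  "main_body = Seq prepare (Seq call combine)"

text \<open>The phases are specified over tuples \<open>(n, a, M)\<close>, the loop rule over a pair
  with the counter last; this changes the shape of the parameter.\<close>

lemma triple_reindex:
  assumes "triple w z P d Q"
  shows "triple (\<lambda>x. w (f x)) (\<lambda>x. z (f x)) (\<lambda>x. P (f x)) d (\<lambda>x. Q (f x))"
  using assms unfolding triple_def by blast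

lemma main_body_correct:
  "triple (\<lambda>x. W (fst (fst x))) (\<lambda>x. \<tau> (fst (fst x)))
     (\<lambda>x R Mem. core (fst (fst x)) (snd (fst x)) (Suc (snd x)) R \<and>
        fresh (fst (fst x)) (snd (fst x)) (Suc (snd x)) Mem) main_body
     (\<lambda>x R Mem. core (fst (fst x)) (snd (fst x)) (snd x) R \<and>
        fresh (fst (fst x)) (snd (fst x)) (snd x) Mem)"
proof -
  note cmb = triple_reindex[OF combine_correct[where z = "\<lambda>p. \<tau> (fst p)"],
      where f = "\<lambda>x. (fst (fst x), snd (fst x), snd x)", simplified fst_conv snd_conv]
  note cl = triple_reindex[OF call_correct,
      where f = "\<lambda>x. (fst (fst x), snd (fst x), Suc (snd x))", simplified fst_conv snd_conv]
  note prep = triple_reindex[OF prepare_correct[where z = "\<lambda>p. \<tau> (fst p)"],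
      where f = "\<lambda>x. (fst (fst x), snd (fst x), Suc (snd x))", simplified fst_conv snd_conv]
  show ?thesis
    unfolding main_body_def
    by (rule triple_pre[OF triple_Seq[OF triple_Seq[OF cmb cl] prep]]) simp
qed

definition power_step :: com where
  "power_step = Seq (Const 6 1) (Seq (Arith 7 Add 0 6) (Seq (Arith 4 Mul 4 7) (Arith 5 Sub 5 6)))"

definition powering :: "nat \<Rightarrow> (nat \<Rightarrow> nat) \<Rightarrow> nat \<Rightarrow> (reg \<Rightarrow> nat) \<Rightarrow> (nat \<Rightarrow> nat) \<Rightarrow> bool" where
  "powering n a i R Mem \<longleftrightarrow> zero_one n a \<and> Mem = a \<and> R 0 = n \<and> R 1 = moduli n \<and> R 2 = 0 \<and> R 3 = 1 \<and>
     R 4 = Suc n ^ (block K n - i) \<and> R 5 = i \<and> i \<le> block K n"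

lemma power_step_correct:
  "triple (\<lambda>x. W (fst (fst x))) z (\<lambda>x. powering (fst (fst x)) (snd (fst x)) (Suc (snd x))) power_step
     (\<lambda>x. powering (fst (fst x)) (snd (fst x)) (snd x))"
  unfolding power_step_def
  apply (rule triple_pre)
   apply (rule triple_Seq triple_Arith triple_Const)+
  subgoal premises pre for p R Mem
  proof -
    obtain n a i where p: "p = ((n, a), i)" by (metis surj_pair)
    have f: "powering n a (Suc i) R Mem" using pre by (simp add: p)
    then have R: "R 0 = n" "R 4 = Suc n ^ (block K n - Suc i)" "R 5 = Suc i" "Suc i \<le> block K n"
      by (auto simp: powering_def)
    have "Suc n ^ (block K n - Suc i) \<le> codes K n"
      unfolding codes_def by (rule power_increasing) auto
    then have "Suc n ^ (block K n - Suc i) \<le> W n" unfolding work_bound_def by linarith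
    moreover have "Suc i \<le> W n" "n \<le> W n" "Suc 0 \<le> W n" "Suc n \<le> W n"
      using R(4) unfolding work_bound_def by linarith+
    ultimately have b: "bits (Suc n ^ (block K n - Suc i)) \<le> W n + 2" "bits (Suc i) \<le> W n + 2"
      "bits n \<le> W n + 2" "bits (Suc 0) \<le> W n + 2" "bits (Suc n) \<le> W n + 2"
      by (simp_all only: bits_le_bound)
    have "block K n - i = Suc (block K n - Suc i)" using R(4) by linarith
    then have "Suc n ^ (block K n - i) = Suc n ^ (block K n - Suc i) * Suc n"
      by (simp only: power_Suc2)
    moreover have "i \<le> block K n" using R(4) by linarith
    ultimately show ?thesis
      using f b by (auto simp: p R powering_def)
  qed
  done

lemma power_loop_correct:
  "triple (\<lambda>p. W (fst p)) z (\<lambda>p R Mem. (\<exists>i. powering (fst p) (snd p) i R Mem) \<and>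
      (\<forall>R' Mem'. powering (fst p) (snd p) 0 R' Mem' \<longrightarrow> Q p R' Mem'))
     (While 5 power_step) Q"
proof (rule triple_countdown[where I = "\<lambda>p. powering (fst p) (snd p)"])
  fix p i R Mem assume f: "powering (fst p) (snd p) i R Mem"
  then have "i \<le> block K (fst p)" by (simp add: powering_def)
  then have "i \<le> W (fst p)" unfolding work_bound_def by linarith
  then show "R 5 = i \<and> i \<le> W (fst p)" using f by (simp add: powering_def)
qed (rule power_step_correct)

lemma main_loop_correct:
  "triple (\<lambda>p. W (fst p)) (\<lambda>p. \<tau> (fst p)) (\<lambda>p R Mem. (\<exists>M. core (fst p) (snd p) M R \<and> fresh (fst p) (snd p) M Mem) \<and>
      (\<forall>R' Mem'. core (fst p) (snd p) 0 R' \<and> fresh (fst p) (snd p) 0 Mem' \<longrightarrow> Q p R' Mem'))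
     (While 1 main_body) Q"
proof (rule triple_countdown[where I = "\<lambda>p M R Mem. core (fst p) (snd p) M R \<and> fresh (fst p) (snd p) M Mem"])
  fix p i R Mem assume f: "core (fst p) (snd p) i R \<and> fresh (fst p) (snd p) i Mem"
  then have "i \<le> moduli (fst p)" by (simp add: core_def)
  then have "i \<le> W (fst p)" unfolding work_bound_def by linarith
  then show "R 1 = i \<and> i \<le> W (fst p)" using f by (simp add: core_def)
qed (rule main_body_correct)

definition permanent_program :: com where
  "permanent_program =
     Seq (compile moduliE [0] 1) (Seq (Const 2 0) (Seq (Const 3 1) (Seq (Const 4 1)
    (Seq (compile (blockE K) [0] 5) (Seq (While 5 power_step)
    (Seq (While 1 main_body) (Seq (Const 0 0) (Arith 0 Add 2 0))))))))"

text \<open>When no modulus is left, register \<open>3\<close> is a common multiple of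
  \<open>1\<close> to \<open>2 * (n * n + 1) + 1\<close>, hence exceeds the permanent, and the
  residue is the permanent itself.\<close>

lemma core_0:
  assumes "core n a 0 R"
  shows "R 2 = matchings a n"
proof -
  have "4 ^ (n * n + 1) \<le> R 3"
    by (rule four_power_le_common_multiple)
      (use assms in \<open>auto simp: core_def moduli_def\<close>)
  then have "matchings a n < R 3" using matchings_less[of a n] by linarith
  then show ?thesis using assms by (simp add: core_def)
qed

lemma permanent_program_correct:
  "triple (\<lambda>p. W (fst p)) (\<lambda>p. \<tau> (fst p))
     (\<lambda>p R Mem. zero_one (fst p) (snd p) \<and> R = (\<lambda>_. 0)(0 := fst p) \<and> Mem = snd p) permanent_program
     (\<lambda>p R Mem. R 0 = matchings (snd p) (fst p))"
  unfolding permanent_program_def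
  apply (rule triple_pre)
   apply (rule triple_Seq triple_Arith triple_Const main_loop_correct power_loop_correct
      triple_compile[where A = "\<lambda>x. snd x"] | (simp; fail))+
  subgoal premises pre for p R Mem
  proof -
    obtain n a where p: "p = (n, a)" by (metis surj_pair)
    have dom: "zero_one n a" and R: "R = (\<lambda>_. 0)(0 := n)" and Mem: "Mem = a" using pre by (auto simp: p)
    have reads: "reads_matrix a R' a" if "R' 0 = n" for R'
      using dom that unfolding reads_matrix_def zero_one_def by auto
    have nW: "n \<le> W n" unfolding work_bound_def by linarith
    have b0: "bits 0 \<le> W n + 2" by (rule bits_le_bound) simp
    have fr: "fresh n a (moduli n) a"
      using dom unfolding fresh_def zero_one_def by auto
    have ex2: "\<exists>M. core n a M R' \<and> fresh n a M Mem'" if "powering n a 0 R' Mem'" for R' Mem'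
    proof -
      \<comment> \<open>Before the first modulus the common multiple is \<open>1\<close> and the
        residue modulo it is \<open>0\<close>, whatever the permanent is.\<close>
      have "core n a (moduli n) R'" using that by (auto simp: powering_def core_def codes_def)
      moreover have "Mem' = a" using that by (simp add: powering_def)
      ultimately show ?thesis using fr by blast
    qed
    have fin: "bits (R' 2) \<le> W n + 2 \<and> R' 2 = matchings a n" if "core n a 0 R'" for R'
    proof -
      have "bits (R' 2) \<le> moduli n * moduli n" by (rule core_bits(2)[OF that])
      also have "\<dots> \<le> W n + 2" unfolding work_bound_def by linarith
      finally show ?thesis using core_0[OF that] by simp
    qed
    have fin': "bits (matchings a n) \<le> Suc (Suc (W n))" if "core n a 0 R'" for R'
      using fin[OF that] by auto
    have ex1: "\<exists>i. powering n a i R'' a"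
      if "R' (Suc 0) = moduli n \<and> R' 0 = n"
        "R'' 5 = block K n \<and> (\<forall>r<5. R'' r = (if r = 4 then Suc 0 else (R'(2 := 0, 3 := Suc 0)) r))" for R' R''
      by (rule exI[of _ "block K n"]) (use that dom in \<open>simp add: powering_def\<close>)
    show ?thesis
      using nW b0 by (simp add: p R Mem reads ev_moduliE ev_blockE ex1 ex2 fin) (use fin' in blast)
  qed
  done

end

section \<open>Asymptotics\<close>

text \<open>The class of \<open>n\<close> to the power O(\<open>lg n\<close>), the size of
  \<open>codes K n\<close>. It is closed under sums, products and fixed powers, and still
  subexponential.\<close>

definition quasi_poly :: "(nat \<Rightarrow> nat) \<Rightarrow> bool" where
  "quasi_poly F \<longleftrightarrow> (\<exists>D. \<forall>n. F n \<le> 2 ^ (D * (lg n)\<^sup>2))"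

lemma quasi_polyI: "(\<And>n. F n \<le> 2 ^ (D * (lg n)\<^sup>2)) \<Longrightarrow> quasi_poly F"
  unfolding quasi_poly_def by blast

lemma lg_sq_pos: "1 \<le> (lg n)\<^sup>2"
  by (simp add: lg_def)

lemma quasi_poly_const: "quasi_poly (\<lambda>n. c)"
proof (rule quasi_polyI)
  fix n
  have "c \<le> 2 ^ c" by (rule less_imp_le) (rule less_exp)
  also have "\<dots> \<le> 2 ^ (c * (lg n)\<^sup>2)" using lg_sq_pos[of n] by (intro power_increasing) auto
  finally show "c \<le> 2 ^ (c * (lg n)\<^sup>2)" .
qed

lemma quasi_poly_mult:
  assumes "quasi_poly F" "quasi_poly G"
  shows "quasi_poly (\<lambda>n. F n * G n)"
proof -
  obtain D E where "\<And>n. F n \<le> 2 ^ (D * (lg n)\<^sup>2)" "\<And>n. G n \<le> 2 ^ (E * (lg n)\<^sup>2)"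
    using assms unfolding quasi_poly_def by blast
  then have "F n * G n \<le> 2 ^ ((D + E) * (lg n)\<^sup>2)" for n
    unfolding distrib_right power_add by (intro mult_le_mono)
  then show ?thesis by (rule quasi_polyI)
qed

lemma quasi_poly_add:
  assumes "quasi_poly F" "quasi_poly G"
  shows "quasi_poly (\<lambda>n. F n + G n)"
proof -
  obtain D E where DE: "\<And>n. F n \<le> 2 ^ (D * (lg n)\<^sup>2)" "\<And>n. G n \<le> 2 ^ (E * (lg n)\<^sup>2)"
    using assms unfolding quasi_poly_def by blast
  have "F n + G n \<le> 2 ^ ((D + E + 1) * (lg n)\<^sup>2)" for n
  proof -
    let ?l = "(lg n)\<^sup>2"
    have "2 ^ (D * ?l) \<le> (2 ^ ((D + E) * ?l) :: nat)" "2 ^ (E * ?l) \<le> (2 ^ ((D + E) * ?l) :: nat)"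
      by (auto intro!: power_increasing)
    then have "F n + G n \<le> 2 * 2 ^ ((D + E) * ?l)" using DE[of n] by linarith
    also have "\<dots> = 2 ^ ((D + E) * ?l + 1)" by simp
    also have "\<dots> \<le> 2 ^ ((D + E + 1) * ?l)"
      using lg_sq_pos[of n] by (intro power_increasing) (auto simp: distrib_right)
    finally show ?thesis .
  qed
  then show ?thesis by (rule quasi_polyI)
qed

lemma quasi_poly_power: "quasi_poly F \<Longrightarrow> quasi_poly (\<lambda>n. F n ^ k)"
  by (induction k) (simp_all add: quasi_poly_const quasi_poly_mult)

lemma quasi_poly_mono: "quasi_poly G \<Longrightarrow> (\<And>n. F n \<le> G n) \<Longrightarrow> quasi_poly F"
  unfolding quasi_poly_def by (meson order_trans)

lemma lg_le_sq: "lg n \<le> (lg n)\<^sup>2"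
  by (simp add: power2_eq_square lg_def)

lemma quasi_poly_id: "quasi_poly (\<lambda>n. n)"
proof (rule quasi_polyI)
  fix n
  have "n \<le> 2 ^ lg n" by (rule less_imp_le) (rule less_two_power_lg)
  also have "\<dots> \<le> 2 ^ (1 * (lg n)\<^sup>2)" using lg_le_sq by (intro power_increasing) auto
  finally show "n \<le> 2 ^ (1 * (lg n)\<^sup>2)" .
qed

lemma quasi_poly_lg: "quasi_poly lg"
proof (rule quasi_polyI)
  fix n
  have "lg n \<le> 2 ^ lg n" by (rule less_imp_le) (rule less_exp)
  also have "\<dots> \<le> 2 ^ (1 * (lg n)\<^sup>2)" using lg_le_sq by (intro power_increasing) auto
  finally show "lg n \<le> 2 ^ (1 * (lg n)\<^sup>2)" .
qed

lemma codes_le: "codes K n \<le> 2 ^ (K * (lg n)\<^sup>2)"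
proof -
  have "codes K n \<le> (2 ^ lg n) ^ block K n"
    unfolding codes_def using less_two_power_lg[of n] by (intro power_mono) (auto simp: Suc_le_eq)
  then show ?thesis by (simp add: block_def power2_eq_square flip: power_mult) (simp add: ac_simps)
qed

lemma quasi_poly_params:
  "quasi_poly (codes K)" "quasi_poly (block K)" "quasi_poly (blocks K)"
  "quasi_poly extras" "quasi_poly moduli"
proof -
  show "quasi_poly (codes K)" by (rule quasi_polyI) (rule codes_le)
  show "quasi_poly (block K)" unfolding block_def
    by (intro quasi_poly_mult quasi_poly_const quasi_poly_lg)
  have "quasi_poly (\<lambda>n. n + 1)" by (intro quasi_poly_add quasi_poly_id quasi_poly_const)
  then show "quasi_poly (blocks K)" by (rule quasi_poly_mono) (simp add: blocks_def)
  show "quasi_poly extras" unfolding extras_def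
    by (intro quasi_poly_add quasi_poly_mult quasi_poly_const quasi_poly_lg)
  show "quasi_poly moduli" unfolding moduli_def
    by (intro quasi_poly_add quasi_poly_mult quasi_poly_const quasi_poly_id)
qed

lemma quasi_poly_ground: "quasi_poly (ground K)"
  unfolding ground_def by (intro quasi_poly_add quasi_poly_mult quasi_poly_id quasi_poly_params)

lemma quasi_poly_numbers: "quasi_poly (numbers K)"
  unfolding numbers_def by (intro quasi_poly_add quasi_poly_mult quasi_poly_id quasi_poly_params)

lemma quasi_poly_work_bound: "quasi_poly (work_bound K)"
  unfolding work_bound_def stride_def
  by (intro quasi_poly_add quasi_poly_mult quasi_poly_const quasi_poly_id quasi_poly_params
      quasi_poly_numbers quasi_poly_ground)

section \<open>The instance measured by its ground set\<close>

lemma lg_le_log: "real (lg n) \<le> log 2 (real n) + 2" if "1 \<le> n"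
proof -
  have "2 ^ (floorlog 2 n - 1) \<le> n" using floorlog_bounds[of n 2] that by auto
  then have "2 ^ (lg n - 2) \<le> n" by (simp add: lg_def)
  then have "real (2 ^ (lg n - 2)) \<le> real n" by (simp only: of_nat_le_iff)
  then have "2 powr real (lg n - 2) \<le> real n" by (simp add: powr_realpow)
  then have "real (lg n - 2) \<le> log 2 (real n)" using that by (simp add: le_log_iff)
  then show ?thesis by linarith
qed

lemma ground_ge: "n \<le> ground K n" "4 \<le> ground K n"
  by (auto simp: ground_def blocks_def extras_def lg_def)

text \<open>The additive \<open>2\<close> in \<open>lg n \<le> log 2 n + 2\<close> is absorbed
  because the ground set has at least \<open>4\<close> elements.\<close>

lemma lg_le_ground: "real (lg n) \<le> 2 * log 2 (real (ground K n))"
proof -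
  have "2 = log 2 (2 powr 2)" by (subst log_powr_cancel) auto
  also have "\<dots> \<le> log 2 (real (ground K n))"
    using ground_ge(2)[of K n] by (intro log_mono) auto
  finally have 2: "2 \<le> log 2 (real (ground K n))" .
  show ?thesis
  proof (cases "n = 0")
    case True
    then have "lg n = 1" by (simp add: lg_def floorlog_def)
    then show ?thesis using 2 by simp
  next
    case False
    then have "real (lg n) \<le> log 2 (real n) + 2" by (intro lg_le_log) simp
    also have "log 2 (real n) \<le> log 2 (real (ground K n))"
      using False ground_ge(1)[of n K] by (intro log_mono) auto
    finally show ?thesis using 2 by linarith
  qed
qed

lemma numbers_le: "numbers K n \<le> 2 ^ ((K + 6) * (lg n)\<^sup>2)"
proof -
  let ?l = "(lg n)\<^sup>2"
  have l: "1 \<le> lg n" "lg n \<le> ?l" using lg_le_sq by (auto simp: lg_def)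
  have "blocks K n \<le> Suc n" by (simp add: blocks_def)
  also have "\<dots> \<le> 2 ^ lg n" using less_two_power_lg[of n] by simp
  also have "\<dots> \<le> 2 ^ ?l" using l by (intro power_increasing) auto
  finally have b: "blocks K n \<le> 2 ^ ?l" .
  have "lg n < 2 ^ lg n" by (rule less_exp)
  then have "extras n \<le> 4 * 2 ^ lg n" unfolding extras_def using l(1) by linarith
  also have "\<dots> = 2 ^ (lg n + 2)" by simp
  also have "\<dots> \<le> 2 ^ ((K + 4) * ?l)"
  proof (rule power_increasing)
    have "lg n + 2 \<le> 3 * ?l" using l by linarith
    also have "\<dots> \<le> (K + 4) * ?l" by (intro mult_le_mono1) simp
    finally show "lg n + 2 \<le> (K + 4) * ?l" .
  qed simp
  finally have e: "extras n \<le> 2 ^ ((K + 4) * ?l)" .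
  have "codes K n \<le> 2 ^ ((K + 4) * ?l)"
    by (rule order_trans[OF codes_le]) (auto intro!: power_increasing)
  then have "codes K n + extras n \<le> 2 * 2 ^ ((K + 4) * ?l)" using e by linarith
  also have "\<dots> = 2 ^ ((K + 4) * ?l + 1)" by simp
  also have "\<dots> \<le> 2 ^ ((K + 5) * ?l)"
    using l by (intro power_increasing) (auto simp: distrib_right)
  finally have "numbers K n \<le> 2 ^ ?l * 2 ^ ((K + 5) * ?l)"
    unfolding numbers_def distrib_left[symmetric] using b by (intro mult_le_mono)
  also have "\<dots> = 2 ^ ((K + 6) * ?l)" by (simp add: algebra_simps flip: power_add)
  finally show ?thesis .
qed

text \<open>The restriction on families refers to the ground set and not to \<open>n\<close>. With
  \<open>u\<close> its size, \<open>lg n \<le> 2 * log 2 u\<close> turns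
  \<open>2 ^ ((K + 6) * (lg n)\<^sup>2)\<close> into a power of \<open>u\<close>; squaring the
  \<open>2\<close> gives the constant \<open>4\<close>.\<close>

lemma numbers_le_powr:
  "real (numbers K n) \<le> real (ground K n) powr (4 * (real K + 6) / ln 2 * ln (real (ground K n)))"
proof -
  let ?u = "real (ground K n)"
  have u: "1 < ?u" using ground_ge(2)[of K n] by simp
  have "real (numbers K n) \<le> real (2 ^ ((K + 6) * (lg n)\<^sup>2))"
    using numbers_le by (simp only: of_nat_le_iff)
  also have "\<dots> = 2 powr (real (K + 6) * (real (lg n))\<^sup>2)"
  proof -
    have "real (2 ^ N) = 2 powr real N" for N by (simp add: powr_realpow)
    then show ?thesis by (simp only: of_nat_mult of_nat_power)
  qed
  also have "\<dots> \<le> 2 powr (real (K + 6) * (2 * log 2 ?u)\<^sup>2)"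
    using lg_le_ground[of n K] by (intro powr_mono mult_left_mono power_mono) auto
  also have "\<dots> = (2 powr log 2 ?u) powr (4 * (real K + 6) * log 2 ?u)"
    unfolding powr_powr by (simp add: power2_eq_square algebra_simps)
  also have "\<dots> = ?u powr (4 * (real K + 6) * log 2 ?u)" using u by simp
  also have "\<dots> = ?u powr (4 * (real K + 6) / ln 2 * ln ?u)" by (simp add: log_def)
  finally show ?thesis .
qed

text \<open>A block adds its label and \<open>2 * lg n + 2\<close> extra elements, at most
  \<open>5 * lg n\<close> in all, and there are at most \<open>n / (K * lg n) + 1\<close> blocks;
  the logarithms cancel.\<close>

lemma ground_le:
  assumes "1 \<le> K"
  shows "real (ground K n) \<le> real n + 5 * real n / real K + 5 * real (lg n)"
proof -
  have l: "1 \<le> lg n" by (simp add: lg_def)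
  have "real (ground K n) = real n + real (blocks K n) * (1 + real (extras n))"
    by (simp add: ground_def algebra_simps)
  also have "\<dots> \<le> real n + (real n / real (block K n) + 1) * (5 * real (lg n))"
  proof (intro add_left_mono mult_mono)
    show "1 + real (extras n) \<le> 5 * real (lg n)" using l by (simp add: extras_def)
    show "real (blocks K n) \<le> real n / real (block K n) + 1"
      using of_nat_div_le_of_nat[of n "block K n"] by (simp add: blocks_def)
  qed auto
  also have "\<dots> = real n + 5 * real n / real K + 5 * real (lg n)"
    using l assms by (simp add: block_def field_simps)
  finally show ?thesis .
qed

lemma lg_square_le_linear:
  assumes "0 < \<delta>"
  shows "eventually (\<lambda>n. real (D * (lg n)\<^sup>2) \<le> \<delta> * real n) sequentially"
proof -
  have "(\<lambda>n. (log 2 (real n) + 2)\<^sup>2 / real n) \<longlonglongrightarrow> 0" by real_asymp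
  moreover have "0 < \<delta> / (real D + 1)" using assms by simp
  ultimately have "eventually (\<lambda>n. (log 2 (real n) + 2)\<^sup>2 / real n < \<delta> / (real D + 1)) sequentially"
    by (rule order_tendstoD(2))
  then show ?thesis
    using eventually_ge_at_top[of 1]
  proof eventually_elim
    case (elim n)
    have "(real (lg n))\<^sup>2 \<le> (log 2 (real n) + 2)\<^sup>2"
      using lg_le_log[OF elim(2)] by (intro power_mono) auto
    also have "\<dots> \<le> \<delta> / (real D + 1) * real n"
      using elim by (simp add: divide_less_eq less_imp_le)
    finally have "(real D + 1) * (real (lg n))\<^sup>2 \<le> \<delta> * real n"
      by (simp add: field_simps)
    moreover have "real (D * (lg n)\<^sup>2) \<le> (real D + 1) * (real (lg n))\<^sup>2"
      by (simp add: distrib_right)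
    ultimately show ?case by linarith
  qed
qed

text \<open>By the choice of \<open>K\<close> the ground set has at most
  \<open>(1 + \<epsilon>) * n + 5 * lg n\<close> elements, so the exponent of the given algorithm is
  at most \<open>(1 - \<epsilon>\<^sup>2) * n + 5 * lg n\<close>. All other factors are
  quasi-polynomial and are eventually swallowed by
  \<open>2 powr (\<epsilon>\<^sup>2 / 2 * n)\<close>.\<close>

lemma time_bound:
  fixes T :: "nat \<Rightarrow> real" and \<epsilon> \<epsilon>\<^sub>1 :: real
  assumes T: "T \<in> Ostar (\<lambda>n. 2 powr ((1 - \<epsilon>\<^sub>1) * real n))"
    and \<epsilon>: "0 < \<epsilon>" "\<epsilon> \<le> \<epsilon>\<^sub>1" "\<epsilon> \<le> 1 / 2" and K: "1 \<le> K" "5 \<le> \<epsilon> * real K"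
  shows "(\<lambda>n. real ((work_bound K n + 2) ^ k * (nat \<lfloor>T (ground K n)\<rfloor> + 1)))
    \<in> O(\<lambda>n. 2 powr ((1 - \<epsilon>\<^sup>2 / 2) * real n))"
proof -
  obtain k' where "T \<in> O(\<lambda>n. 2 powr ((1 - \<epsilon>\<^sub>1) * real n) * ln (2 powr ((1 - \<epsilon>\<^sub>1) * real n)) ^ k')"
    using T unfolding Ostar_def by blast
  then obtain c where c: "0 < c" "eventually (\<lambda>n. norm (T n) \<le>
      c * norm (2 powr ((1 - \<epsilon>\<^sub>1) * real n) * ln (2 powr ((1 - \<epsilon>\<^sub>1) * real n)) ^ k')) sequentially"
    by (rule landau_o.bigE) blast
  then obtain n0 where n0: "\<And>n. n \<ge> n0 \<Longrightarrow> norm (T n) \<le>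
      c * norm (2 powr ((1 - \<epsilon>\<^sub>1) * real n) * ln (2 powr ((1 - \<epsilon>\<^sub>1) * real n)) ^ k')"
    unfolding eventually_sequentially by blast
  \<comment> \<open>The logarithm of the exponential is linear in its argument, so the suppressed
    factor is a fixed power of \<open>B * u\<close>. The absolute value covers
    \<open>\<epsilon>\<^sub>1 > 1\<close>, where that logarithm is negative.\<close>
  define B where "B = \<bar>(1 - \<epsilon>\<^sub>1) * ln 2\<bar>"
  have B: "0 \<le> B" by (simp add: B_def)
  have Tn: "T u \<le> c * B ^ k' * (real u ^ k' * 2 powr ((1 - \<epsilon>) * real u))" if "n0 \<le> u" for u
  proof -
    have "T u \<le> c * (2 powr ((1 - \<epsilon>\<^sub>1) * real u) * \<bar>(1 - \<epsilon>\<^sub>1) * real u * ln 2\<bar> ^ k')"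
      using n0[OF that] by (simp add: ln_powr abs_mult power_abs)
    also have "\<bar>(1 - \<epsilon>\<^sub>1) * real u * ln 2\<bar> = B * real u" by (simp add: B_def abs_mult)
    also have "c * (2 powr ((1 - \<epsilon>\<^sub>1) * real u) * (B * real u) ^ k') \<le>
        c * (2 powr ((1 - \<epsilon>) * real u) * (B * real u) ^ k')"
      using c(1) \<epsilon>(2) B by (intro mult_left_mono mult_right_mono powr_mono mult_right_mono) auto
    also have "\<dots> = c * B ^ k' * (real u ^ k' * 2 powr ((1 - \<epsilon>) * real u))"
      by (simp add: power_mult_distrib)
    finally show ?thesis .
  qed
  \<comment> \<open>These factors are the overhead of the reduction, the factor suppressed in the
    time of the given algorithm, and the logarithmic excess of the ground set in the
    exponent.\<close>
  have "quasi_poly (\<lambda>n. (work_bound K n + 2) ^ k * ground K n ^ k' * 2 ^ (5 * lg n))"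
  proof (intro quasi_poly_mult quasi_poly_power quasi_poly_add quasi_poly_const
      quasi_poly_work_bound quasi_poly_ground)
    show "quasi_poly (\<lambda>n. 2 ^ (5 * lg n))"
      by (rule quasi_polyI[where D = 5]) (auto intro!: power_increasing lg_le_sq)
  qed
  then obtain D where D: "\<And>n. (work_bound K n + 2) ^ k * ground K n ^ k' * 2 ^ (5 * lg n) \<le> 2 ^ (D * (lg n)\<^sup>2)"
    unfolding quasi_poly_def by blast
  define \<delta> where "\<delta> = \<epsilon>\<^sup>2 / 2"
  have \<delta>: "0 < \<delta>" using \<epsilon> by (simp add: \<delta>_def)
  have exponent: "(1 - \<epsilon>) * real (ground K n) \<le> (1 - 2 * \<delta>) * real n + real (5 * lg n)" for n
  proof -
    have "5 * real n / real K \<le> \<epsilon> * real n"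
    proof -
      have "5 * real n \<le> \<epsilon> * real K * real n" using K(2) by (intro mult_right_mono) auto
      then show ?thesis using K(1) by (simp add: divide_le_eq ac_simps)
    qed
    then have "real (ground K n) \<le> (1 + \<epsilon>) * real n + 5 * real (lg n)"
      using ground_le[OF K(1), of n] by (simp add: algebra_simps)
    then have "(1 - \<epsilon>) * real (ground K n) \<le> (1 - \<epsilon>) * ((1 + \<epsilon>) * real n + 5 * real (lg n))"
      using \<epsilon> by (intro mult_left_mono) auto
    also have "\<dots> = (1 - 2 * \<delta>) * real n + (1 - \<epsilon>) * (5 * real (lg n))"
      by (simp add: \<delta>_def power2_eq_square algebra_simps)
    also have "(1 - \<epsilon>) * (5 * real (lg n)) \<le> 1 * (5 * real (lg n))"
      using \<epsilon> by (intro mult_right_mono) auto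
    finally show ?thesis by simp
  qed
  show ?thesis
    unfolding \<delta>_def[symmetric]
  proof (rule bigoI)
    show "eventually (\<lambda>n. norm (real ((work_bound K n + 2) ^ k * (nat \<lfloor>T (ground K n)\<rfloor> + 1))) \<le>
        (c * B ^ k' + 1) * norm (2 powr ((1 - \<delta>) * real n))) sequentially"
      using lg_square_le_linear[OF \<delta>, of D] eventually_ge_at_top[of n0]
    proof eventually_elim
      case (elim n)
      let ?u = "ground K n" and ?W = "real ((work_bound K n + 2) ^ k)"
      let ?E = "2 powr ((1 - 2 * \<delta>) * real n)"
      have u: "n0 \<le> ?u" using elim(2) ground_ge(1)[of n K] by linarith
      have E: "1 \<le> ?E" using \<epsilon> by (intro ge_one_powr_ge_zero) (auto simp: \<delta>_def power2_eq_square mult_le_one)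
      have X: "real ?u ^ k' * 2 powr ((1 - \<epsilon>) * real ?u) \<le> real ?u ^ k' * 2 ^ (5 * lg n) * ?E"
      proof -
        have "2 powr ((1 - \<epsilon>) * real ?u) \<le> 2 powr ((1 - 2 * \<delta>) * real n + real (5 * lg n))"
          using exponent by (intro powr_mono) auto
        also have "\<dots> = ?E * 2 ^ (5 * lg n)"
          unfolding powr_add by (subst powr_realpow) auto
        finally show ?thesis by (simp add: mult_left_mono ac_simps)
      qed
      \<comment> \<open>This lets the main term absorb the \<open>+ 1\<close> added to the rounded
        running time.\<close>
      have one: "1 \<le> real ?u ^ k' * 2 ^ (5 * lg n) * ?E"
      proof -
        have "1 \<le> real ?u ^ k'" using ground_ge(2)[of K n] by (intro one_le_power) simp
        moreover have "1 \<le> (2::real) ^ (5 * lg n)" by (rule one_le_power) simp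
        ultimately have "1 * 1 * 1 \<le> real ?u ^ k' * 2 ^ (5 * lg n) * ?E"
          using E by (intro mult_mono) auto
        then show ?thesis by simp
      qed
      have "real (nat \<lfloor>T ?u\<rfloor>) \<le> c * B ^ k' * (real ?u ^ k' * 2 powr ((1 - \<epsilon>) * real ?u))"
      proof (cases "0 \<le> T ?u")
        case True
        then have "real (nat \<lfloor>T ?u\<rfloor>) \<le> T ?u" by simp
        then show ?thesis using Tn[OF u] by (rule order_trans)
      next
        case False
        then have "nat \<lfloor>T ?u\<rfloor> = 0" by simp
        then show ?thesis using c(1) B by simp
      qed
      also have "\<dots> \<le> c * B ^ k' * (real ?u ^ k' * 2 ^ (5 * lg n) * ?E)"
        using X c(1) B by (intro mult_left_mono) auto
      finally have "real (nat \<lfloor>T ?u\<rfloor> + 1) \<le> (c * B ^ k' + 1) * (real ?u ^ k' * 2 ^ (5 * lg n) * ?E)"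
        using one by (simp add: distrib_right)
      then have "?W * real (nat \<lfloor>T ?u\<rfloor> + 1) \<le>
          ?W * ((c * B ^ k' + 1) * (real ?u ^ k' * 2 ^ (5 * lg n) * ?E))"
        by (rule mult_left_mono) simp
      also have "\<dots> = (c * B ^ k' + 1) * (real ((work_bound K n + 2) ^ k * ?u ^ k' * 2 ^ (5 * lg n)) * ?E)"
        by simp
      also have "\<dots> \<le> (c * B ^ k' + 1) * (real (2 ^ (D * (lg n)\<^sup>2)) * ?E)"
        using c(1) B D[of n] by (intro mult_left_mono mult_right_mono) (simp_all only: of_nat_le_iff, simp_all)
      also have "real (2 ^ (D * (lg n)\<^sup>2)) = 2 powr real (D * (lg n)\<^sup>2)"
        by (simp add: powr_realpow del: of_nat_mult)
      also have "2 powr real (D * (lg n)\<^sup>2) * ?E \<le> 2 powr (\<delta> * real n) * ?E"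
        using elim(1) by (intro mult_right_mono powr_mono) auto
      also have "2 powr (\<delta> * real n) * ?E = 2 powr ((1 - \<delta>) * real n)"
        by (simp add: powr_add[symmetric] algebra_simps)
      finally have "?W * real (nat \<lfloor>T ?u\<rfloor> + 1) \<le> (c * B ^ k' + 1) * 2 powr ((1 - \<delta>) * real n)"
        using c(1) B by (simp add: mult_left_mono)
      moreover have "norm (real ((work_bound K n + 2) ^ k * (nat \<lfloor>T ?u\<rfloor> + 1))) =
          ?W * real (nat \<lfloor>T ?u\<rfloor> + 1)"
        by (simp only: of_nat_mult norm_mult norm_of_nat)
      ultimately show ?case by simp
    qed
  qed
qed

theorem theorem2:
  fixes \<epsilon>\<^sub>1 :: real
  assumes "\<epsilon>\<^sub>1 > 0"
  shows "\<exists>\<epsilon>\<^sub>2 > 0.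
    (\<forall>g :: nat \<Rightarrow> real. g \<in> O(\<lambda>n. ln (real n)) \<longrightarrow>
       (\<exists>c. \<exists>T \<in> Ostar (\<lambda>n. 2 powr ((1 - \<epsilon>\<^sub>1) * real n)). counts_exact_covers c g T)) \<longrightarrow>
    (\<exists>c. \<exists>T \<in> Ostar (\<lambda>n. 2 powr ((1 - \<epsilon>\<^sub>2) * real n)). computes_01_permanents c T)"
proof -
  \<comment> \<open>Replacing the saving by a smaller one only weakens the time bound that is
    assumed, and \<open>\<epsilon> \<le> 1 / 2\<close> keeps \<open>1 - \<epsilon>\<close> and
    \<open>1 - \<epsilon>\<^sup>2\<close> positive.\<close>
  define \<epsilon> where "\<epsilon> = min \<epsilon>\<^sub>1 (1 / 2)"
  have \<epsilon>: "0 < \<epsilon>" "\<epsilon> \<le> \<epsilon>\<^sub>1" "\<epsilon> \<le> 1 / 2" using assms by (auto simp: \<epsilon>_def)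
  \<comment> \<open>Chosen so that the term \<open>5 * n / K\<close> in the size of the ground set
    is at most \<open>\<epsilon> * n\<close>.\<close>
  define K where "K = nat \<lceil>5 / \<epsilon>\<rceil>"
  have "5 / \<epsilon> \<le> real K" unfolding K_def by (rule real_nat_ceiling_ge)
  then have K5: "5 \<le> \<epsilon> * real K" using \<epsilon>(1) by (simp add: divide_le_eq ac_simps)
  then have K: "1 \<le> K" by (cases K) auto
  show ?thesis
  proof (intro exI[of _ "\<epsilon>\<^sup>2 / 2"] conjI impI)
    show "0 < \<epsilon>\<^sup>2 / 2" using \<epsilon> by simp
    assume hyp: "\<forall>g :: nat \<Rightarrow> real. g \<in> O(\<lambda>n. ln (real n)) \<longrightarrow>
       (\<exists>c. \<exists>T \<in> Ostar (\<lambda>n. 2 powr ((1 - \<epsilon>\<^sub>1) * real n)). counts_exact_covers c g T)"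
    \<comment> \<open>The exponent that bounds the families constructed here; it depends on
      \<open>K\<close>, hence only on \<open>\<epsilon>\<^sub>1\<close>, and the given algorithm is
      the one for this exponent.\<close>
    define g where "g u = 4 * (real K + 6) / ln 2 * ln (real u)" for u :: nat
    have "g \<in> O(\<lambda>n. ln (real n))" unfolding g_def by simp
    then obtain c T where T: "T \<in> Ostar (\<lambda>n. 2 powr ((1 - \<epsilon>\<^sub>1) * real n))"
      and c: "counts_exact_covers c g T" using hyp by blast
    \<comment> \<open>Running times are natural numbers, so the bound may be rounded down.\<close>
    define \<tau> where "\<tau> n = nat \<lfloor>T (ground K n)\<rfloor>" for n
    interpret reduction K c \<tau>
    proof
      show "1 \<le> K" by (rule K)
      fix n A M assume M: "1 \<le> M" "M \<le> moduli n"
      interpret instance_params K n A by unfold_locales (rule K)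
      let ?F = "set (family K A n M)"
      have "card ?F \<le> numbers K n"
        using card_length[of "family K A n M"] length_filter_le[of "good K A n M" "[0..<numbers K n]"]
        by (simp add: family_def goods_def)
      then have "real (card ?F) \<le> real (card {..<ground K n}) powr g (card {..<ground K n})"
        using numbers_le_powr[of K n] by (simp add: g_def)
      moreover have "exact_cover_instance {..<ground K n} ?F"
        by (auto simp: exact_cover_instance_def family_def)
      moreover have "distinct (family K A n M)" by (rule distinct_family[OF M])
      ultimately have "outputs_within c (cover_input [0..<ground K n] (family K A n M))
          (card (exact_covers {..<ground K n} ?F)) (T (card {..<ground K n}))"
        using c[unfolded counts_exact_covers_def, rule_format, of "{..<ground K n}" ?F "[0..<ground K n]"
          "family K A n M"] by (simp add: atLeast0LessThan)
      then obtain t s' where "exec c (cover_input [0..<ground K n] (family K A n M)) t s'"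
        "fst s' 0 = card (exact_covers {..<ground K n} ?F)" "real t \<le> T (ground K n)"
        unfolding outputs_within_def by auto
      moreover from this have "t \<le> \<tau> n" unfolding \<tau>_def by (simp add: le_nat_floor)
      ultimately show "\<exists>t s'. exec c (cover_input [0..<ground K n] (family K A n M)) t s' \<and> t \<le> \<tau> n \<and>
          fst s' 0 = card (exact_covers {..<ground K n} ?F)" by blast
    qed
    obtain k where k: "\<And>p R M. zero_one (fst p) (snd p) \<and> R = (\<lambda>_. 0)(0 := fst p) \<and> M = snd p \<Longrightarrow>
        \<exists>R' M'. run permanent_program (R, M) ((work_bound K (fst p) + 2) ^ k * (\<tau> (fst p) + 1)) (R', M') \<and>
          R' 0 = matchings (snd p) (fst p)"
      using permanent_program_correct by (rule tripleE) blast
    let ?T = "\<lambda>n. real ((work_bound K n + 2) ^ k * (\<tau> n + 1))"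
    have "computes_01_permanents permanent_program ?T"
      unfolding computes_01_permanents_def
    proof (intro allI ballI impI)
      fix n and A :: "int mat"
      assume A: "A \<in> carrier_mat n n" and el: "elements_mat A \<subseteq> {0, 1}"
      let ?a = "snd (matrix_input A)"
      have inp: "matrix_input A = ((\<lambda>_. 0)(0 := n), ?a)"
        using A by (simp add: matrix_input_def)
      have "zero_one n ?a"
        unfolding zero_one_def
      proof (intro allI conjI impI)
        fix x
        show "?a x \<le> 1"
        proof (cases "x < n * n")
          case True
          then have "0 < n" by (cases n) auto
          then have "x div n < n" "x mod n < n" using True by (auto simp: less_mult_imp_div_less)
          then have "A $$ (x div n, x mod n) \<in> elements_mat A"
            using A by (auto simp: elements_mat_def intro!: bexI[of _ "x div n"])
          then have "A $$ (x div n, x mod n) \<in> {0, 1}" using el by blast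
          then show ?thesis using A by (auto simp: matrix_input_def)
        next
          case False
          then show ?thesis using A by (simp add: matrix_input_def)
        qed
        show "?a x = 0" if "n * n \<le> x" using that A by (simp add: matrix_input_def)
      qed
      then obtain R' M' where R': "run permanent_program ((\<lambda>_. 0)(0 := n), ?a)
          ((work_bound K n + 2) ^ k * (\<tau> n + 1)) (R', M')" "R' 0 = matchings ?a n"
        using k[of "(n, ?a)" "(\<lambda>_. 0)(0 := n)" ?a] by auto
      then show "outputs_within permanent_program (matrix_input A) (nat (permanent A)) (?T n)"
        unfolding outputs_within_def run_def permanent_eq_matchings[OF A el]
        by (subst inp) (metis fst_conv of_nat_le_iff)
    qed
    moreover have "?T \<in> O(\<lambda>n. 2 powr ((1 - \<epsilon>\<^sup>2 / 2) * real n))"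
      unfolding \<tau>_def by (rule time_bound[OF T \<epsilon> K K5])
    then have "?T \<in> Ostar (\<lambda>n. 2 powr ((1 - \<epsilon>\<^sup>2 / 2) * real n))"
      unfolding Ostar_def by (auto intro!: exI[of _ 0])
    ultimately show "\<exists>c. \<exists>T \<in> Ostar (\<lambda>n. 2 powr ((1 - \<epsilon>\<^sup>2 / 2) * real n)). computes_01_permanents c T"
      by blast
  qed
qed

end
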